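(* Let $\mathcal{X}=(X,dX)$ be a dispace with trace category $\overrightarrow{\mathbf{P}}(\mathcal{X})$. For each $n\in\{0,1\}$ (resp. each $n\geq 2$) there exists a split object $\mathcal{C}^n_{\mathcal{X}}$ (resp. an internal group $\mathcal{C}^n_{\mathcal{X}}$) in the category $\mathbf{Cat}_{X}/\overrightarrow{\mathbf{P}}(\mathcal{X})$ such that $$\overrightarrow{P}_n(\mathcal{X})_f = (\mathcal{C}^n_{\mathcal{X}})_f$$ for all traces $f$ of $\mathcal{X}$ (as pointed sets for $n\leq 1$, as groups for $n\geq 2$), and this assignment is functorial in $\mathcal{X}$, i.e. $\mathcal{X}\mapsto \mathcal{C}^n_{\mathcal{X}}$ extends to a functor $\mathcal{C}^n_{-}:\mathbf{dTop}\to\mathbf{Cat}$.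
   Context: Dispaces. A dispace (directed space) is a pair $\mathcal{X}=(X,dX)$ with $X$ a topological space and $dX$ a set of continuous paths $[0,1]\to X$ (called dipaths) containing all constant paths, closed under monotonic reparametrization (precomposition with non-decreasing continuous maps $[0,1]\to[0,1]$), and closed under concatenation $\star$. A morphism $(X,dX)\to(Y,dY)$ is a continuous map $X\to Y$ sending dipaths to dipaths. The category of dispaces is $\mathbf{dTop}$. Traces. For $x,y\in X$, $\overrightarrow{Di}(\mathcal{X})(x,y)$ is the space of dipaths from $x$ to $y$ with the compact-open topology; the trace space $\overrightarrow{\mathfrak{T}}(\mathcal{X})(x,y)$ is its quotient (with quotient topology) by the equivalence relation generated by $f\sim f\circ\varphi$, $\varphi:[0,1]\to[0,1]$ a non-decreasing continuous surjection. Its elements are traces; concatenation $\star$ descends to traces. The trace category $\overrightarrow{\mathbf{P}}(\mathcal{X})$ has objects the points of $X$, morphisms $x\to y$ the traces from $x$ to $y$, and composition the concatenation of traces. Natural homotopy. For a trace $f:x\to y$: $\overrightarrow{P}_0(\mathcal{X})_f=\{f\}$ (pointed singleton); $\overrightarrow{P}_1(\mathcal{X})_f=\pi_0(\overrightarrow{\mathfrak{T}}(\mathcal{X})(x,y))$ pointed at the path component $[f]$ of $f$; and for $n\geq 2$, $\overrightarrow{P}_n(\mathcal{X})_f$ is the group $\pi_{n-1}(\overrightarrow{\mathfrak{T}}(\mathcal{X})(x,y),f)$. Categories over a category. $\mathbf{Cat}$ is the category of small categories. For a category $\mathcal{B}$ with set of objects $\mathcal{B}_0$, $\mathbf{Cat}_{\mathcal{B}_0}/\mathcal{B}$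 is the category whose objects are pairs $(\mathcal{C},p)$, with $\mathcal{C}$ a category with object set $\mathcal{B}_0$ and $p:\mathcal{C}\to\mathcal{B}$ a functor that is the identity on objects; morphisms are functors over $\mathcal{B}$ that are the identity on objects. For a morphism $f$ of $\mathcal{B}$, the fibre is $\mathcal{C}_f=\{c : p(c)=f\}$. A split object is a pair $((\mathcal{C},p),\epsilon)$ with $\epsilon:\mathcal{B}\to\mathcal{C}$ a functor, identity on objects, such that $p\circ\epsilon=\mathrm{id}_{\mathcal{B}}$; its fibre $\mathcal{C}_f$ is pointed at $\epsilon(f)$. An internal group in $\mathbf{Cat}_{\mathcal{B}_0}/\mathcal{B}$ is a group object $((\mathcal{C},p),\mu,\eta,(-)^{-1})$ with respect to finite products (the product is the fibre product over $\mathcal{B}$, the terminal object is $(\mathcal{B},\mathrm{id})$); each fibre $\mathcal{C}_f$ is then a group under $\mu$ with identity $\eta(f)$. *)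

theory Defs
  imports "HOL-Analysis.Analysis" "HOL-Algebra.Group"
begin

section \<open>Small categories\<close>

text \<open>Composition is written in diagrammatic order: \<open>cmp C f g\<close> is ``first \<open>f\<close>, then \<open>g\<close>'',
  matching concatenation of traces.\<close>

record ('o, 'm) cat =
  Ob :: "'o set"
  Ar :: "'m set"
  src :: "'m \<Rightarrow> 'o"
  tgt :: "'m \<Rightarrow> 'o"
  idt :: "'o \<Rightarrow> 'm"
  cmp :: "'m \<Rightarrow> 'm \<Rightarrow> 'm"

text \<open>The operations are required to be \<open>undefined\<close> outside their domains, so that two categories
  are equal as records exactly when they are equal as categories.\<close>

locale category =
  fixes C :: "('o, 'm) cat"
  assumes src_in: "f \<in> Ar C \<Longrightarrow> src C f \<in> Ob C"
    and tgt_in: "f \<in> Ar C \<Longrightarrow> tgt C f \<in> Ob C"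
    and idt_in: "x \<in> Ob C \<Longrightarrow> idt C x \<in> Ar C"
    and src_idt: "x \<in> Ob C \<Longrightarrow> src C (idt C x) = x"
    and tgt_idt: "x \<in> Ob C \<Longrightarrow> tgt C (idt C x) = x"
    and cmp_in: "\<lbrakk>f \<in> Ar C; g \<in> Ar C; tgt C f = src C g\<rbrakk> \<Longrightarrow> cmp C f g \<in> Ar C"
    and src_cmp: "\<lbrakk>f \<in> Ar C; g \<in> Ar C; tgt C f = src C g\<rbrakk> \<Longrightarrow> src C (cmp C f g) = src C f"
    and tgt_cmp: "\<lbrakk>f \<in> Ar C; g \<in> Ar C; tgt C f = src C g\<rbrakk> \<Longrightarrow> tgt C (cmp C f g) = tgt C g"
    and idt_left: "f \<in> Ar C \<Longrightarrow> cmp C (idt C (src C f)) f = f"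
    and idt_right: "f \<in> Ar C \<Longrightarrow> cmp C f (idt C (tgt C f)) = f"
    and assoc: "\<lbrakk>f \<in> Ar C; g \<in> Ar C; h \<in> Ar C; tgt C f = src C g; tgt C g = src C h\<rbrakk>
      \<Longrightarrow> cmp C (cmp C f g) h = cmp C f (cmp C g h)"
    and src_ext: "src C \<in> extensional (Ar C)"
    and tgt_ext: "tgt C \<in> extensional (Ar C)"
    and idt_ext: "idt C \<in> extensional (Ob C)"
    and cmp_ext: "\<not> (f \<in> Ar C \<and> g \<in> Ar C \<and> tgt C f = src C g) \<Longrightarrow> cmp C f g = undefined"

definition mk_cat ::
  "'o set \<Rightarrow> 'm set \<Rightarrow> ('m \<Rightarrow> 'o) \<Rightarrow> ('m \<Rightarrow> 'o) \<Rightarrow> ('o \<Rightarrow> 'm) \<Rightarrow> ('m \<Rightarrow> 'm \<Rightarrow> 'm) \<Rightarrow> ('o, 'm) cat" where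
  "mk_cat Obs Ars s t i c =
    \<lparr>Ob = Obs, Ar = Ars, src = restrict s Ars, tgt = restrict t Ars, idt = restrict i Obs,
     cmp = (\<lambda>f g. if f \<in> Ars \<and> g \<in> Ars \<and> t f = s g then c f g else undefined)\<rparr>"

locale is_functor = C: category C + D: category D
  for C :: "('o, 'm) cat" and D :: "('p, 'n) cat" +
  fixes Fo :: "'o \<Rightarrow> 'p" and Fa :: "'m \<Rightarrow> 'n"
  assumes ob_map: "x \<in> Ob C \<Longrightarrow> Fo x \<in> Ob D"
    and ar_map: "f \<in> Ar C \<Longrightarrow> Fa f \<in> Ar D"
    and src_map: "f \<in> Ar C \<Longrightarrow> src D (Fa f) = Fo (src C f)"
    and tgt_map: "f \<in> Ar C \<Longrightarrow> tgt D (Fa f) = Fo (tgt C f)"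
    and idt_map: "x \<in> Ob C \<Longrightarrow> Fa (idt C x) = idt D (Fo x)"
    and cmp_map: "\<lbrakk>f \<in> Ar C; g \<in> Ar C; tgt C f = src C g\<rbrakk>
      \<Longrightarrow> Fa (cmp C f g) = cmp D (Fa f) (Fa g)"

text \<open>\<open>Cat\<close>: the small categories with objects in \<open>'o\<close> and arrows in \<open>'m\<close>. An arrow is a triple
  (domain, functor, codomain), the functor being a pair of maps made unique by extensionality.\<close>

type_synonym ('o, 'm) cat_arrow =
  "('o, 'm) cat \<times> (('o \<Rightarrow> 'o) \<times> ('m \<Rightarrow> 'm)) \<times> ('o, 'm) cat"

definition Cat :: "(('o, 'm) cat, ('o, 'm) cat_arrow) cat" where
  "Cat = mk_cat {C. category C}
    {(C, (Fo, Fa), D). is_functor C D Fo Fa \<and> Fo \<in> extensional (Ob C) \<and> Fa \<in> extensional (Ar C)}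
    fst (\<lambda>F. snd (snd F))
    (\<lambda>C. (C, (\<lambda>x\<in>Ob C. x, \<lambda>f\<in>Ar C. f), C))
    (\<lambda>(C, (Fo, Fa), _) (_, (Go, Ga), E). (C, (restrict (Go \<circ> Fo) (Ob C), restrict (Ga \<circ> Fa) (Ar C)), E))"


section \<open>Categories over a category, split objects, internal groups\<close>

text \<open>Functors which are the identity on objects are given by their action on arrows.\<close>

definition over_object :: "('o, 'b) cat \<Rightarrow> ('o, 'm) cat \<Rightarrow> ('m \<Rightarrow> 'b) \<Rightarrow> bool" where
  "over_object B C p \<longleftrightarrow> Ob C = Ob B \<and> is_functor C B (\<lambda>x. x) p"

definition over_morphism ::
  "('o, 'b) cat \<Rightarrow> ('o, 'm) cat \<Rightarrow> ('m \<Rightarrow> 'b) \<Rightarrow> ('o, 'n) cat \<Rightarrow> ('n \<Rightarrow> 'b) \<Rightarrow> ('m \<Rightarrow> 'n) \<Rightarrow> bool" where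
  "over_morphism B C p D q F \<longleftrightarrow> over_object B C p \<and> over_object B D q \<and>
     is_functor C D (\<lambda>x. x) F \<and> (\<forall>c \<in> Ar C. q (F c) = p c)"

definition fibre :: "('o, 'm) cat \<Rightarrow> ('m \<Rightarrow> 'b) \<Rightarrow> 'b \<Rightarrow> 'm set" where
  "fibre C p f = {c \<in> Ar C. p c = f}"

definition split_object ::
  "('o, 'b) cat \<Rightarrow> ('o, 'm) cat \<Rightarrow> ('m \<Rightarrow> 'b) \<Rightarrow> ('b \<Rightarrow> 'm) \<Rightarrow> bool" where
  "split_object B C p \<epsilon> \<longleftrightarrow> over_object B C p \<and> is_functor B C (\<lambda>x. x) \<epsilon> \<and> (\<forall>f \<in> Ar B. p (\<epsilon> f) = f)"

definition fibre_product ::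
  "('o, 'm) cat \<Rightarrow> ('m \<Rightarrow> 'b) \<Rightarrow> ('o, 'n) cat \<Rightarrow> ('n \<Rightarrow> 'b) \<Rightarrow> ('o, 'm \<times> 'n) cat" where
  "fibre_product C p D q = mk_cat (Ob C)
    {(c, d). c \<in> Ar C \<and> d \<in> Ar D \<and> p c = q d}
    (\<lambda>(c, d). src C c) (\<lambda>(c, d). tgt C c)
    (\<lambda>x. (idt C x, idt D x))
    (\<lambda>(c, d) (c', d'). (cmp C c c', cmp D d d'))"

text \<open>A group object: the structure maps are morphisms out of the product
  \<open>(C, p) \<times> (C, p)\<close>, the terminal object \<open>(B, id)\<close> and \<open>(C, p)\<close>; the group diagrams are equations
  between functors which are the identity on objects, hence equations on arrows.\<close>

definition internal_group ::
  "('o, 'b) cat \<Rightarrow> ('o, 'm) cat \<Rightarrow> ('m \<Rightarrow> 'b) \<Rightarrow> ('m \<times> 'm \<Rightarrow> 'm) \<Rightarrow> ('b \<Rightarrow> 'm) \<Rightarrow> ('m \<Rightarrow> 'm) \<Rightarrow> bool" where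
  "internal_group B C p \<mu> \<eta> \<iota> \<longleftrightarrow>
     over_object B C p \<and>
     over_morphism B (fibre_product C p C p) (\<lambda>(c, d). p c) C p \<mu> \<and>
     over_morphism B B (\<lambda>f. f) C p \<eta> \<and>
     over_morphism B C p C p \<iota> \<and>
     (\<forall>c \<in> Ar C. \<forall>d \<in> Ar C. \<forall>e \<in> Ar C. p c = p d \<and> p d = p e \<longrightarrow> \<mu> (\<mu> (c, d), e) = \<mu> (c, \<mu> (d, e))) \<and>
     (\<forall>c \<in> Ar C. \<mu> (\<eta> (p c), c) = c \<and> \<mu> (c, \<eta> (p c)) = c) \<and>
     (\<forall>c \<in> Ar C. \<mu> (\<iota> c, c) = \<eta> (p c) \<and> \<mu> (c, \<iota> c) = \<eta> (p c))"

definition fibre_group ::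
  "('o, 'm) cat \<Rightarrow> ('m \<Rightarrow> 'b) \<Rightarrow> ('m \<times> 'm \<Rightarrow> 'm) \<Rightarrow> ('b \<Rightarrow> 'm) \<Rightarrow> 'b \<Rightarrow> 'm monoid" where
  "fibre_group C p \<mu> \<eta> f = \<lparr>carrier = fibre C p f, mult = (\<lambda>c d. \<mu> (c, d)), one = \<eta> f\<rparr>"

text \<open>A pointed set is a pair (set, base point).\<close>

definition pointed_iso :: "('s \<Rightarrow> 't) \<Rightarrow> 's set \<times> 's \<Rightarrow> 't set \<times> 't \<Rightarrow> bool" where
  "pointed_iso \<phi> S T \<longleftrightarrow> bij_betw \<phi> (fst S) (fst T) \<and> \<phi> (snd S) = snd T"


section \<open>Dispaces\<close>

text \<open>Paths are functions on the reals that are \<open>undefined\<close> outside the unit interval.\<close>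

definition reparams :: "(real \<Rightarrow> real) set" where
  "reparams = {\<phi>. continuous_on {0..1} \<phi> \<and> mono_on {0..1} \<phi> \<and> \<phi> ` {0..1} \<subseteq> {0..1}}"

definition path_concat :: "(real \<Rightarrow> 'a) \<Rightarrow> (real \<Rightarrow> 'a) \<Rightarrow> real \<Rightarrow> 'a" where
  "path_concat f g = (\<lambda>t\<in>{0..1}. if t \<le> 1/2 then f (2 * t) else g (2 * t - 1))"

record 'a dispace =
  spc :: "'a topology"
  dip :: "(real \<Rightarrow> 'a) set"

locale dispace =
  fixes X :: "'a dispace"
  assumes dip_path: "f \<in> dip X \<Longrightarrow> pathin (spc X) f"
    and dip_ext: "f \<in> dip X \<Longrightarrow> f \<in> extensional {0..1}"
    and dip_const: "x \<in> topspace (spc X) \<Longrightarrow> (\<lambda>t\<in>{0..1}. x) \<in> dip X"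
    and dip_reparam: "\<lbrakk>f \<in> dip X; \<phi> \<in> reparams\<rbrakk> \<Longrightarrow> restrict (f \<circ> \<phi>) {0..1} \<in> dip X"
    and dip_concat: "\<lbrakk>f \<in> dip X; g \<in> dip X; f 1 = g 0\<rbrakk> \<Longrightarrow> path_concat f g \<in> dip X"

definition dimap :: "'a dispace \<Rightarrow> 'b dispace \<Rightarrow> ('a \<Rightarrow> 'b) \<Rightarrow> bool" where
  "dimap X Y h \<longleftrightarrow> continuous_map (spc X) (spc Y) h \<and>
     (\<forall>f \<in> dip X. restrict (h \<circ> f) {0..1} \<in> dip Y)"

text \<open>\<open>dTop\<close>: the dispaces whose points form a (varying) subset of \<open>'a\<close>.\<close>

definition dTop :: "('a dispace, 'a dispace \<times> ('a \<Rightarrow> 'a) \<times> 'a dispace) cat" where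
  "dTop = mk_cat {X. dispace X}
    {(X, h, Y). dispace X \<and> dispace Y \<and> dimap X Y h \<and> h \<in> extensional (topspace (spc X))}
    fst (\<lambda>h. snd (snd h))
    (\<lambda>X. (X, \<lambda>x\<in>topspace (spc X). x, X))
    (\<lambda>(X, h, _) (_, k, Z). (X, restrict (k \<circ> h) (topspace (spc X)), Z))"


section \<open>Traces\<close>

definition compact_open :: "'a topology \<Rightarrow> 'b topology \<Rightarrow> ('a \<Rightarrow> 'b) topology" where
  "compact_open A B = topology_generated_by
     {{f \<in> extensional (topspace A). continuous_map A B f \<and> f ` K \<subseteq> U} | K U.
        compactin A K \<and> openin B U}"

definition quotient_topology :: "'a topology \<Rightarrow> ('a \<Rightarrow> 'b) \<Rightarrow> 'b topology" where
  "quotient_topology T q =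
     topology (\<lambda>U. U \<subseteq> q ` topspace T \<and> openin T {x \<in> topspace T. q x \<in> U})"

definition dipaths :: "'a dispace \<Rightarrow> 'a \<Rightarrow> 'a \<Rightarrow> (real \<Rightarrow> 'a) set" where
  "dipaths X x y = {f \<in> dip X. f 0 = x \<and> f 1 = y}"

definition dipath_space :: "'a dispace \<Rightarrow> 'a \<Rightarrow> 'a \<Rightarrow> (real \<Rightarrow> 'a) topology" where
  "dipath_space X x y = subtopology (compact_open (top_of_set {0..1}) (spc X)) (dipaths X x y)"

text \<open>A trace is an equivalence class of dipaths. The relation is generated on all dipaths at once:
  a reparametrization \<open>\<phi>\<close> that is onto fixes 0 and 1, so each class lies in one \<open>dipaths X x y\<close>.\<close>

type_synonym 'a trace = "(real \<Rightarrow> 'a) set"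

definition reparam_step :: "'a dispace \<Rightarrow> (real \<Rightarrow> 'a) \<Rightarrow> (real \<Rightarrow> 'a) \<Rightarrow> bool" where
  "reparam_step X f g \<longleftrightarrow> f \<in> dip X \<and>
     (\<exists>\<phi> \<in> reparams. \<phi> ` {0..1} = {0..1} \<and> g = restrict (f \<circ> \<phi>) {0..1})"

definition trace_of :: "'a dispace \<Rightarrow> (real \<Rightarrow> 'a) \<Rightarrow> 'a trace" where
  "trace_of X f = {g. equivclp (reparam_step X) f g}"

definition trace_space :: "'a dispace \<Rightarrow> 'a \<Rightarrow> 'a \<Rightarrow> 'a trace topology" where
  "trace_space X x y = quotient_topology (dipath_space X x y) (trace_of X)"

definition trace_src :: "'a trace \<Rightarrow> 'a" where
  "trace_src A = (THE x. \<forall>f \<in> A. f 0 = x)"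

definition trace_tgt :: "'a trace \<Rightarrow> 'a" where
  "trace_tgt A = (THE y. \<forall>f \<in> A. f 1 = y)"

text \<open>Operations on classes are unions over representatives; well-definedness makes each such union
  a single class.\<close>

definition trace_concat :: "'a dispace \<Rightarrow> 'a trace \<Rightarrow> 'a trace \<Rightarrow> 'a trace" where
  "trace_concat X A B = (\<Union>f\<in>A. \<Union>g\<in>B. trace_of X (path_concat f g))"

definition trace_category :: "'a dispace \<Rightarrow> ('a, 'a trace) cat" where
  "trace_category X = mk_cat (topspace (spc X)) (trace_of X ` dip X) trace_src trace_tgt
     (\<lambda>x. trace_of X (\<lambda>t\<in>{0..1}. x)) (trace_concat X)"

definition trace_map :: "'a dispace \<Rightarrow> ('b \<Rightarrow> 'a) \<Rightarrow> 'b trace \<Rightarrow> 'a trace" where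
  "trace_map Y h A = (\<Union>f\<in>A. trace_of Y (restrict (h \<circ> f) {0..1}))"


section \<open>Homotopy groups\<close>

definition cube :: "nat \<Rightarrow> (nat \<Rightarrow> real) topology" where
  "cube k = product_topology (\<lambda>_. top_of_set {0..1}) {..<k}"

definition cube_boundary :: "nat \<Rightarrow> (nat \<Rightarrow> real) set" where
  "cube_boundary k = {t \<in> topspace (cube k). \<exists>i<k. t i = 0 \<or> t i = 1}"

text \<open>Values off the cube are unconstrained here; maps that agree on the cube have the same
  homotopy class.\<close>

definition cube_loops :: "nat \<Rightarrow> 'a topology \<Rightarrow> 'a \<Rightarrow> ((nat \<Rightarrow> real) \<Rightarrow> 'a) set" where
  "cube_loops k T b = {\<gamma>. continuous_map (cube k) T \<gamma> \<and> (\<forall>t \<in> cube_boundary k. \<gamma> t = b)}"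

definition loop_class ::
  "nat \<Rightarrow> 'a topology \<Rightarrow> 'a \<Rightarrow> ((nat \<Rightarrow> real) \<Rightarrow> 'a) \<Rightarrow> ((nat \<Rightarrow> real) \<Rightarrow> 'a) set" where
  "loop_class k T b \<gamma> =
     {\<delta>. homotopic_with (\<lambda>\<sigma>. \<forall>t \<in> cube_boundary k. \<sigma> t = b) (cube k) T \<gamma> \<delta>}"

definition loop_concat ::
  "((nat \<Rightarrow> real) \<Rightarrow> 'a) \<Rightarrow> ((nat \<Rightarrow> real) \<Rightarrow> 'a) \<Rightarrow> (nat \<Rightarrow> real) \<Rightarrow> 'a" where
  "loop_concat \<gamma> \<delta> = (\<lambda>t. if t 0 \<le> 1/2 then \<gamma> (t(0 := 2 * t 0)) else \<delta> (t(0 := 2 * t 0 - 1)))"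

text \<open>\<open>homotopy_group k T b\<close> is the \<open>k\<close>-th homotopy group of \<open>T\<close> at \<open>b\<close>, for \<open>k \<ge> 1\<close>.\<close>

definition homotopy_group ::
  "nat \<Rightarrow> 'a topology \<Rightarrow> 'a \<Rightarrow> ((nat \<Rightarrow> real) \<Rightarrow> 'a) set monoid" where
  "homotopy_group k T b =
    \<lparr>carrier = loop_class k T b ` cube_loops k T b,
     mult = (\<lambda>A B. \<Union>\<gamma>\<in>A. \<Union>\<delta>\<in>B. loop_class k T b (loop_concat \<gamma> \<delta>)),
     one = loop_class k T b (\<lambda>_. b)\<rparr>"


section \<open>Natural homotopy\<close>

definition nat_htpy0 :: "'a dispace \<Rightarrow> 'a trace \<Rightarrow> 'a trace set \<times> 'a trace" where
  "nat_htpy0 X f = ({f}, f)"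

definition nat_htpy1 :: "'a dispace \<Rightarrow> 'a trace \<Rightarrow> 'a trace set set \<times> 'a trace set" where
  "nat_htpy1 X f =
    (let T = trace_space X (trace_src f) (trace_tgt f)
     in (path_components_of T, path_component_of_set T f))"

definition nat_htpy :: "nat \<Rightarrow> 'a dispace \<Rightarrow> 'a trace \<Rightarrow> ((nat \<Rightarrow> real) \<Rightarrow> 'a trace) set monoid" where
  "nat_htpy n X f = homotopy_group (n - 1) (trace_space X (trace_src f) (trace_tgt f)) f"

text \<open>The maps induced on natural homotopy at the trace \<open>f\<close> of \<open>X\<close> by a morphism
  \<open>h\<close> from \<open>X\<close> to \<open>Y\<close>.\<close>

definition nat_htpy0_map ::
  "'a dispace \<Rightarrow> ('a \<Rightarrow> 'b) \<Rightarrow> 'b dispace \<Rightarrow> 'a trace \<Rightarrow> 'a trace \<Rightarrow> 'b trace" where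
  "nat_htpy0_map X h Y f c = trace_map Y h c"

definition nat_htpy1_map ::
  "'a dispace \<Rightarrow> ('a \<Rightarrow> 'b) \<Rightarrow> 'b dispace \<Rightarrow> 'a trace \<Rightarrow> 'a trace set \<Rightarrow> 'b trace set" where
  "nat_htpy1_map X h Y f c =
    (\<Union>g\<in>c. path_component_of_set (trace_space Y (h (trace_src f)) (h (trace_tgt f))) (trace_map Y h g))"

definition nat_htpy_map ::
  "nat \<Rightarrow> 'a dispace \<Rightarrow> ('a \<Rightarrow> 'b) \<Rightarrow> 'b dispace \<Rightarrow> 'a trace
    \<Rightarrow> ((nat \<Rightarrow> real) \<Rightarrow> 'a trace) set \<Rightarrow> ((nat \<Rightarrow> real) \<Rightarrow> 'b trace) set" where
  "nat_htpy_map n X h Y f c =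
    (\<Union>\<gamma>\<in>c. loop_class (n - 1) (trace_space Y (h (trace_src f)) (h (trace_tgt f))) (trace_map Y h f)
              (trace_map Y h \<circ> \<gamma>))"

text \<open>Fibres over different traces are disjoint, whereas (for instance) the sets underlying
  \<open>nat_htpy1 X f\<close> and \<open>nat_htpy1 X g\<close> coincide for parallel \<open>f\<close>, \<open>g\<close>. So the arrows of the categories
  realizing natural homotopy are pairs \<open>(f, c)\<close>, and the fibre over \<open>f\<close> is identified with
  natural homotopy at \<open>f\<close> by \<open>Pair f\<close>. On such pairs a morphism of dispaces acts as follows, where
  \<open>N\<close> is one of the three induced maps above.\<close>

definition induced_action ::
  "('a dispace \<Rightarrow> ('a \<Rightarrow> 'b) \<Rightarrow> 'b dispace \<Rightarrow> 'a trace \<Rightarrow> 'c \<Rightarrow> 'd)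
    \<Rightarrow> 'a dispace \<Rightarrow> ('a \<Rightarrow> 'b) \<Rightarrow> 'b dispace \<Rightarrow> 'a trace \<times> 'c \<Rightarrow> 'b trace \<times> 'd" where
  "induced_action N X h Y = (\<lambda>(f, c). (trace_map Y h f, N X h Y f c))"

end

theory Submission
  imports Defs
begin

text \<open>An arrow of \<open>C\<^sup>n\<close> is a trace \<open>f\<close> together with an element of the natural homotopy at \<open>f\<close>, and arrows
  are composed by concatenating representatives pointwise. For this to respect homotopy, concatenation
  of traces has to be jointly continuous. A product of quotient maps need not be a quotient map, but the
  projection from dipaths to traces is open: a surjective reparametrization \<open>\<phi>\<close> is the uniform limit of
  the homeomorphisms \<open>(1 - \<epsilon>) \<phi> + \<epsilon> id\<close>, so the saturation of an open set of dipaths is its orbit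
  under homeomorphisms. The fibrewise group law is a functor because concatenating loops in a cube
  coordinate commutes strictly with concatenating their values.\<close>

section \<open>Categories\<close>

text \<open>A path or loop in a trace space comes with no lift to dipaths, so such classes can be
  concatenated pointwise only if concatenation is continuous on the trace spaces themselves;
  openness helps because a product of open surjections is open. The obstacle to openness is that the
  generating reparametrizations may pause, so equivalent dipaths are joined by a zigzag of maps
  without inverses. The invariant along a zigzag is that some homeomorphic reparametrization of the
  current dipath lies in the given open set; a step in either direction is absorbed by moving a
  noninvertible map to a nearby invertible one. The degrees differ only in their fibres, so the
  categorical part is done once for an abstract family of fibres with a pairing over concatenation;
  internal groups add group structures on the fibres and compatibility of the pairing with
  multiplication.\<close>

lemma mk_cat_simps [simp]:
  "Ob (mk_cat V E s t i c) = V"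
  "Ar (mk_cat V E s t i c) = E"
  "f \<in> E \<Longrightarrow> src (mk_cat V E s t i c) f = s f"
  "f \<in> E \<Longrightarrow> tgt (mk_cat V E s t i c) f = t f"
  "x \<in> V \<Longrightarrow> idt (mk_cat V E s t i c) x = i x"
  "\<lbrakk>f \<in> E; g \<in> E; t f = s g\<rbrakk> \<Longrightarrow> cmp (mk_cat V E s t i c) f g = c f g"
  by (auto simp: mk_cat_def)

text \<open>Extensionality is built into \<open>mk_cat\<close> by its restrictions, which leaves
  exactly the algebraic laws to check.\<close>

lemma category_mk_cat:
  assumes "\<And>f. f \<in> E \<Longrightarrow> s f \<in> V" "\<And>f. f \<in> E \<Longrightarrow> t f \<in> V"
    and "\<And>x. x \<in> V \<Longrightarrow> i x \<in> E" "\<And>x. x \<in> V \<Longrightarrow> s (i x) = x" "\<And>x. x \<in> V \<Longrightarrow> t (i x) = x"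
    and "\<And>f g. \<lbrakk>f \<in> E; g \<in> E; t f = s g\<rbrakk> \<Longrightarrow> c f g \<in> E"
    and "\<And>f g. \<lbrakk>f \<in> E; g \<in> E; t f = s g\<rbrakk> \<Longrightarrow> s (c f g) = s f"
    and "\<And>f g. \<lbrakk>f \<in> E; g \<in> E; t f = s g\<rbrakk> \<Longrightarrow> t (c f g) = t g"
    and "\<And>f. f \<in> E \<Longrightarrow> c (i (s f)) f = f" "\<And>f. f \<in> E \<Longrightarrow> c f (i (t f)) = f"
    and "\<And>f g h. \<lbrakk>f \<in> E; g \<in> E; h \<in> E; t f = s g; t g = s h\<rbrakk> \<Longrightarrow> c (c f g) h = c f (c g h)"
  shows "category (mk_cat V E s t i c)"
  using assms by unfold_locales (auto simp: mk_cat_def)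

text \<open>Passes from a functor to its restricted form, which is the one that arrows of
  \<open>Cat\<close> carry.\<close>

lemma is_functor_cong:
  assumes "is_functor C D Fo Fa"
    and o: "\<And>x. x \<in> Ob C \<Longrightarrow> Fo' x = Fo x" and a: "\<And>f. f \<in> Ar C \<Longrightarrow> Fa' f = Fa f"
  shows "is_functor C D Fo' Fa'"
proof -
  interpret is_functor C D Fo Fa by fact
  show ?thesis
    by unfold_locales
      (auto simp: o a ob_map ar_map src_map tgt_map idt_map cmp_map C.src_in C.tgt_in C.idt_in C.cmp_in)
qed

lemma is_functor_comp:
  assumes "is_functor C D Fo Fa" "is_functor D E Go Ga"
  shows "is_functor C E (Go \<circ> Fo) (Ga \<circ> Fa)"
proof -
  interpret F: is_functor C D Fo Fa by fact
  interpret G: is_functor D E Go Ga by fact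
  show ?thesis
    by unfold_locales
      (auto simp: F.ob_map F.ar_map F.src_map F.tgt_map F.idt_map F.cmp_map
        G.ob_map G.ar_map G.src_map G.tgt_map G.idt_map G.cmp_map)
qed

lemma is_functor_id: "category C \<Longrightarrow> is_functor C C (\<lambda>x. x) (\<lambda>f. f)"
  by (intro is_functor.intro is_functor_axioms.intro) auto

lemma category_Cat: "category (Cat :: (('o, 'm) cat, ('o, 'm) cat_arrow) cat)"
proof -
  have i: "is_functor C C (\<lambda>x\<in>Ob C. x) (\<lambda>f\<in>Ar C. f)" if "category C" for C :: "('o, 'm) cat"
    by (rule is_functor_cong[OF is_functor_id[OF that]]) auto
  have c: "is_functor C E (restrict (Go \<circ> Fo) (Ob C)) (restrict (Ga \<circ> Fa) (Ar C))"
    if "is_functor C D Fo Fa" "is_functor D E Go Ga"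
    for C D E :: "('o, 'm) cat" and Fo Fa Go Ga
    by (rule is_functor_cong[OF is_functor_comp[OF that]]) auto
  show ?thesis unfolding Cat_def
    apply (rule category_mk_cat)
              apply (auto intro: i c is_functor.axioms)[8]
      \<comment> \<open>The unit and associativity laws remain. Being equalities of restricted maps,
        they need the fact that objects and arrows land in the domain of the next
        restriction.\<close>
      apply (auto simp: fun_eq_iff restrict_def extensional_def is_functor.ob_map is_functor.ar_map)
    done
qed

section \<open>Dispaces\<close>

lemma (in dispace) dip_in_topspace: "\<lbrakk>f \<in> dip X; t \<in> {0..1}\<rbrakk> \<Longrightarrow> f t \<in> topspace (spc X)"
  using dip_path[of f] by (auto simp: pathin_def continuous_map_def)

lemma dimap_restrict_cong:
  assumes "dispace X" "\<And>x. x \<in> topspace (spc X) \<Longrightarrow> h x = k x" "f \<in> dip X"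
  shows "restrict (h \<circ> f) {0..1} = restrict (k \<circ> f) {0..1}"
  using assms dispace.dip_in_topspace[OF assms(1)] by (auto simp: restrict_def fun_eq_iff)

lemma dimap_cong:
  assumes "dispace X" "\<And>x. x \<in> topspace (spc X) \<Longrightarrow> h x = k x" "dimap X Y k"
  shows "dimap X Y h"
  using assms dimap_restrict_cong[of X h k] by (auto simp: dimap_def intro: continuous_map_eq)

lemma dimap_comp: "\<lbrakk>dispace X; dimap X Y h; dimap Y Z k\<rbrakk> \<Longrightarrow> dimap X Z (k \<circ> h)"
proof -
  assume X: "dispace X" "dimap X Y h" "dimap Y Z k"
  have "restrict (k \<circ> restrict (h \<circ> f) {0..1}) {0..1} = restrict (k \<circ> h \<circ> f) {0..1}" for f :: "real \<Rightarrow> 'a"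
    by (auto simp: restrict_def)
  then show ?thesis
    using X by (auto simp: dimap_def continuous_map_compose) metis
qed

lemma (in dispace) dimap_id: "dimap X X (\<lambda>x. x)"
proof -
  have "restrict ((\<lambda>x. x) \<circ> f) {0..1} = f" if "f \<in> dip X" for f
    using dip_ext[OF that] by (simp add: o_def extensional_restrict)
  then show ?thesis by (auto simp: dimap_def)
qed

lemma category_dTop: "category (dTop :: ('a dispace, 'a dispace \<times> ('a \<Rightarrow> 'a) \<times> 'a dispace) cat)"
proof -
  have i: "dimap X X (\<lambda>x\<in>topspace (spc X). x)" if "dispace X" for X :: "'a dispace"
    by (rule dimap_cong[OF that _ dispace.dimap_id[OF that]]) auto
  have c: "dimap X Z (restrict (k \<circ> h) (topspace (spc X)))"
    if "dispace X" "dimap X Y h" "dimap Y Z k" for X Y Z :: "'a dispace" and h k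
    by (rule dimap_cong[OF that(1) _ dimap_comp[OF that]]) auto
  have m: "h x \<in> topspace (spc Y)" if "dimap X Y h" "x \<in> topspace (spc X)"
    for X Y :: "'a dispace" and h x
    using that by (auto simp: dimap_def continuous_map_def)
  show ?thesis unfolding dTop_def
    apply (rule category_mk_cat)
              apply (auto intro: i c)[8]
      apply (auto simp: fun_eq_iff restrict_def extensional_def m)
    done
qed

lemma Ar_dTop_iff:
  "(X, h, Y) \<in> Ar dTop \<longleftrightarrow> dispace X \<and> dispace Y \<and> dimap X Y h \<and> h \<in> extensional (topspace (spc X))"
  by (simp add: dTop_def)

section \<open>Reparametrizations\<close>

definition surj_reparams :: "(real \<Rightarrow> real) set" where
  "surj_reparams = {\<phi> \<in> reparams. \<phi> ` {0..1} = {0..1}}"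

text \<open>Monotonicity forces a surjection to fix both endpoints, and the intermediate value
  theorem gives the converse. For the explicit formulas used later, surjectivity thus reduces to two
  evaluations.\<close>

lemma surj_reparams_iff:
  "\<phi> \<in> surj_reparams \<longleftrightarrow> continuous_on {0..1} \<phi> \<and> mono_on {0..1} \<phi> \<and> \<phi> 0 = 0 \<and> \<phi> 1 = 1"
proof
  assume s: "\<phi> \<in> surj_reparams"
  then have m: "mono_on {0..1} \<phi>" and onto: "\<phi> ` {0..1} = {0..1}"
    by (auto simp: surj_reparams_def reparams_def)
  have "0 \<in> \<phi> ` {0..1}" "1 \<in> \<phi> ` {0..1}" unfolding onto by simp_all
  then obtain a b where "a \<in> {0..1}" "\<phi> a = 0" "b \<in> {0..1}" "\<phi> b = 1" by (metis imageE)
  moreover have "\<phi> 0 \<in> \<phi> ` {0..1}" "\<phi> 1 \<in> \<phi> ` {0..1}" by (rule imageI, simp)+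
  then have "\<phi> 0 \<in> {0..1}" "\<phi> 1 \<in> {0..1}" unfolding onto .
  ultimately have "\<phi> 0 = 0" "\<phi> 1 = 1"
    using mono_onD[OF m, of 0 a] mono_onD[OF m, of b 1] by auto
  then show "continuous_on {0..1} \<phi> \<and> mono_on {0..1} \<phi> \<and> \<phi> 0 = 0 \<and> \<phi> 1 = 1"
    using s by (auto simp: surj_reparams_def reparams_def)
next
  assume r: "continuous_on {0..1} \<phi> \<and> mono_on {0..1} \<phi> \<and> \<phi> 0 = 0 \<and> \<phi> 1 = 1"
  have le: "\<phi> t \<in> {0..1}" if "t \<in> {0..1}" for t
    using that r mono_onD[of "{0..1}" \<phi> 0 t] mono_onD[of "{0..1}" \<phi> t 1] by auto
  have "u \<in> \<phi> ` {0..1}" if "u \<in> {0..1}" for u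
    using IVT'[of \<phi> 0 u 1] that r by force
  then show "\<phi> \<in> surj_reparams"
    using r le by (auto simp: surj_reparams_def reparams_def)
qed

lemma surj_reparams_in: "\<lbrakk>\<phi> \<in> surj_reparams; t \<in> {0..1}\<rbrakk> \<Longrightarrow> \<phi> t \<in> {0..1}"
  by (auto simp: surj_reparams_def)

lemma surj_reparams_comp:
  assumes "\<phi> \<in> surj_reparams" "\<psi> \<in> surj_reparams" shows "\<phi> \<circ> \<psi> \<in> surj_reparams"
proof -
  have "mono_on {0..1} (\<phi> \<circ> \<psi>)"
  proof (rule mono_onI)
    fix r s :: real assume "r \<in> {0..1}" "s \<in> {0..1}" "r \<le> s"
    then show "(\<phi> \<circ> \<psi>) r \<le> (\<phi> \<circ> \<psi>) s"
      using assms surj_reparams_in[OF assms(2)] by (auto simp: surj_reparams_iff mono_on_def)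
  qed
  moreover have "continuous_on {0..1} (\<phi> \<circ> \<psi>)"
    using assms by (intro continuous_on_compose) (auto simp: surj_reparams_def reparams_def)
  ultimately show ?thesis
    using assms by (auto simp: surj_reparams_iff)
qed

lemma surj_reparams_id: "(\<lambda>t. t) \<in> surj_reparams"
  by (auto simp: surj_reparams_iff mono_on_def)

text \<open>Injectivity is enough to obtain homeomorphisms, since a continuous bijection of the
  compact interval has a continuous inverse.\<close>

definition homeo_reparams :: "(real \<Rightarrow> real) set" where
  "homeo_reparams = {\<phi> \<in> surj_reparams. inj_on \<phi> {0..1}}"

lemma homeo_reparams_inverse:
  assumes "\<phi> \<in> homeo_reparams"
  obtains \<psi> where "\<psi> \<in> homeo_reparams" "\<And>t. t \<in> {0..1} \<Longrightarrow> \<psi> (\<phi> t) = t" "\<And>t. t \<in> {0..1} \<Longrightarrow> \<phi> (\<psi> t) = t"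
proof
  let ?\<psi> = "inv_into {0..1} \<phi>"
  have c: "continuous_on {0..1} \<phi>" and m: "mono_on {0..1} \<phi>" and i: "inj_on \<phi> {0..1}" and o: "\<phi> ` {0..1} = {0..1}"
    using assms by (auto simp: homeo_reparams_def surj_reparams_def reparams_def)
  show 1: "?\<psi> (\<phi> t) = t" if "t \<in> {0..1}" for t using i that by simp
  show 2: "\<phi> (?\<psi> t) = t" if "t \<in> {0..1}" for t using o that by (simp add: f_inv_into_f)
  have in01: "?\<psi> t \<in> {0..1}" if "t \<in> {0..1}" for t using o that by (metis inv_into_into)
  have "continuous_on {0..1} ?\<psi>" using continuous_on_inv[OF c compact_Icc, of ?\<psi>] 1 o by simp
  moreover have "mono_on {0..1} ?\<psi>"
  proof (rule mono_onI, rule ccontr)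
    fix r s :: real assume rs: "r \<in> {0..1}" "s \<in> {0..1}" "r \<le> s" and "\<not> ?\<psi> r \<le> ?\<psi> s"
    then have "\<phi> (?\<psi> s) \<le> \<phi> (?\<psi> r)" using m in01 by (intro mono_onD[OF m]) auto
    then have "r = s" using rs 2 by auto
    then show False using \<open>\<not> ?\<psi> r \<le> ?\<psi> s\<close> by simp
  qed
  moreover have "?\<psi> 0 = 0" "?\<psi> 1 = 1"
    using 1[of 0] 1[of 1] assms by (auto simp: homeo_reparams_def surj_reparams_iff)
  moreover have "inj_on ?\<psi> {0..1}" using 2 by (metis inj_onI)
  ultimately show "?\<psi> \<in> homeo_reparams" by (simp add: homeo_reparams_def surj_reparams_iff)
qed

text \<open>A nondecreasing map with nonnegative weight plus a strictly increasing one with positive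
  weight is strictly increasing. As \<open>\<epsilon>\<close> tends to 0 this approximates
  \<open>\<phi>\<close> uniformly.\<close>

lemma homeo_reparams_convex:
  assumes "\<phi> \<in> surj_reparams" "0 < \<epsilon>" "\<epsilon> \<le> 1"
  shows "(\<lambda>t. (1 - \<epsilon>) * \<phi> t + \<epsilon> * t) \<in> homeo_reparams"
proof -
  let ?\<psi> = "\<lambda>t. (1 - \<epsilon>) * \<phi> t + \<epsilon> * t"
  have less: "?\<psi> r < ?\<psi> s" if "r \<in> {0..1}" "s \<in> {0..1}" "r < s" for r s
  proof -
    have "\<phi> r \<le> \<phi> s" using that assms by (auto simp: surj_reparams_iff mono_on_def)
    then show ?thesis using assms that by (intro add_le_less_mono mult_left_mono) auto
  qed
  have "inj_on ?\<psi> {0..1}" by (rule linorder_inj_onI) (use less in force)+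
  moreover have "mono_on {0..1} ?\<psi>" using less by (intro mono_onI) (metis less_eq_real_def)
  moreover have "continuous_on {0..1} ?\<psi>" "?\<psi> 0 = 0" "?\<psi> 1 = 1"
    using assms by (auto simp: surj_reparams_iff intro!: continuous_intros)
  ultimately show ?thesis by (simp add: homeo_reparams_def surj_reparams_iff)
qed

section \<open>Traces\<close>

abbreviation reparametrize :: "(real \<Rightarrow> 'a) \<Rightarrow> (real \<Rightarrow> real) \<Rightarrow> real \<Rightarrow> 'a" where
  "reparametrize f \<phi> \<equiv> restrict (f \<circ> \<phi>) {0..1}"

abbreviation const_path :: "'a \<Rightarrow> real \<Rightarrow> 'a" where
  "const_path x \<equiv> (\<lambda>t\<in>{0..1}. x)"

abbreviation traces :: "'a dispace \<Rightarrow> 'a trace set" where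
  "traces X \<equiv> trace_of X ` dip X"

lemma reparam_step_iff:
  "reparam_step X f g \<longleftrightarrow> f \<in> dip X \<and> (\<exists>\<phi>\<in>surj_reparams. g = reparametrize f \<phi>)"
  by (auto simp: reparam_step_def surj_reparams_def)

lemma reparam_stepI: "\<lbrakk>f \<in> dip X; \<phi> \<in> surj_reparams\<rbrakk> \<Longrightarrow> reparam_step X f (reparametrize f \<phi>)"
  by (auto simp: reparam_step_iff)

lemma equivclp_reparam: "reparam_step X f g \<Longrightarrow> equivclp (reparam_step X) f g"
  by (meson r_into_equivclp)

lemma equivclp_invariant:
  assumes "equivclp r x y" "\<And>x y. r x y \<Longrightarrow> H x = H y"
  shows "H x = H y"
  using assms by (induction rule: equivclp_induct) metis+

lemma trace_of_eq_iff: "trace_of X f = trace_of X g \<longleftrightarrow> equivclp (reparam_step X) f g"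
  using equivp_evquivclp[of "reparam_step X"] unfolding equivp_def trace_of_def
  by (metis (mono_tags, lifting) Collect_cong mem_Collect_eq)

lemma in_trace_of_self: "f \<in> trace_of X f"
  using equivp_evquivclp[of "reparam_step X"] by (simp add: trace_of_def equivp_reflp)

lemma in_trace_of_iff: "g \<in> trace_of X f \<longleftrightarrow> trace_of X g = trace_of X f"
  unfolding trace_of_eq_iff by (auto simp: trace_of_def intro: equivclp_sym)

text \<open>Evaluates the unions by which operations on classes are defined; the class is nonempty
  because it contains \<open>f\<close>.\<close>

lemma UN_trace_of:
  assumes "\<And>g. trace_of X g = trace_of X f \<Longrightarrow> H g = H f"
  shows "(\<Union>g\<in>trace_of X f. H g) = H f"
proof -
  have "(\<Union>g\<in>trace_of X f. H g) = (\<Union>g\<in>trace_of X f. H f)"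
    by (rule SUP_cong[OF refl], rule assms) (simp add: in_trace_of_iff)
  then show ?thesis using in_trace_of_self[of f X] by auto
qed

section \<open>Endpoints, concatenation and the category of traces\<close>

context dispace
begin

lemma reparam_step_dip:
  assumes "reparam_step X f g" shows "f \<in> dip X" "g \<in> dip X" "g 0 = f 0" "g 1 = f 1"
proof -
  obtain \<phi> where f: "f \<in> dip X" and \<phi>: "\<phi> \<in> surj_reparams" and g: "g = reparametrize f \<phi>"
    using assms by (auto simp: reparam_step_iff)
  then have "\<phi> \<in> reparams" by (simp add: surj_reparams_def)
  then show "f \<in> dip X" "g \<in> dip X" "g 0 = f 0" "g 1 = f 1"
    using f g dip_reparam[OF f] \<phi>[unfolded surj_reparams_iff] by simp_all
qed

lemma trace_of_eq_dip:
  assumes "trace_of X f = trace_of X g" "f \<in> dip X"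
  shows "g \<in> dip X" "g 0 = f 0" "g 1 = f 1"
proof -
  have e: "equivclp (reparam_step X) f g" using assms(1) by (simp only: trace_of_eq_iff)
  have "(f \<in> dip X) = (g \<in> dip X)"
    by (rule equivclp_invariant[OF e, of "\<lambda>f. f \<in> dip X"]) (metis reparam_step_dip(1,2))
  then show "g \<in> dip X" using assms(2) by simp
  show "g 0 = f 0"
    by (rule equivclp_invariant[OF e, of "\<lambda>f. f 0", symmetric]) (metis reparam_step_dip(3))
  show "g 1 = f 1"
    by (rule equivclp_invariant[OF e, of "\<lambda>f. f 1", symmetric]) (metis reparam_step_dip(4))
qed

lemma trace_of_reparam:
  "\<lbrakk>f \<in> dip X; \<phi> \<in> surj_reparams\<rbrakk> \<Longrightarrow> trace_of X (reparametrize f \<phi>) = trace_of X f"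
  unfolding trace_of_eq_iff by (rule equivclp_sym[OF equivclp_reparam[OF reparam_stepI]])

text \<open>Invariance of \<open>H\<close> is demanded only at dipaths with the endpoints of
  \<open>g\<close>, because concatenation with a fixed path makes sense only for those.\<close>

lemma trace_of_lift:
  assumes "trace_of X f = trace_of X g" "f \<in> dip X"
    and "\<And>f \<phi>. \<lbrakk>f \<in> dip X; f 0 = g 0; f 1 = g 1; \<phi> \<in> surj_reparams\<rbrakk> \<Longrightarrow> H (reparametrize f \<phi>) = H f"
  shows "H f = H g"
proof -
  have "equivclp (reparam_step X) f g" using assms(1) by (simp add: trace_of_eq_iff)
  have "f 0 = g 0" "f 1 = g 1" using trace_of_eq_dip[OF assms(1,2)] by auto
  \<comment> \<open>The value \<open>None\<close> for all other endpoints turns this partial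
    hypothesis into invariance under every generating step, since steps preserve endpoints.\<close>
  define H' where "H' k = (if k 0 = g 0 \<and> k 1 = g 1 then Some (H k) else None)" for k
  have "H' f = H' g"
  proof (rule equivclp_invariant[OF \<open>equivclp (reparam_step X) f g\<close>])
    fix k l assume s: "reparam_step X k l"
    then obtain \<phi> where "\<phi> \<in> surj_reparams" "l = reparametrize k \<phi>" by (auto simp: reparam_step_iff)
    then show "H' k = H' l" using reparam_step_dip[OF s] assms(3)[of k \<phi>] by (simp add: H'_def)
  qed
  then show ?thesis using \<open>f 0 = g 0\<close> \<open>f 1 = g 1\<close> by (simp add: H'_def)
qed

lemma trace_src_trace_of [simp]: "f \<in> dip X \<Longrightarrow> trace_src (trace_of X f) = f 0"
  unfolding trace_src_def
  by (rule the_equality) (auto simp: in_trace_of_iff dest: trace_of_eq_dip[OF sym] intro: in_trace_of_self)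

lemma trace_tgt_trace_of [simp]: "f \<in> dip X \<Longrightarrow> trace_tgt (trace_of X f) = f 1"
  unfolding trace_tgt_def
  by (rule the_equality) (auto simp: in_trace_of_iff dest: trace_of_eq_dip[OF sym] intro: in_trace_of_self)

text \<open>Reparametrizing both factors amounts to one reparametrization of the concatenation. The
  two factors are then replaced one after the other, with the identity acting on the factor that
  stays.\<close>

lemma trace_of_path_concat_cong:
  assumes "trace_of X f = trace_of X f'" "trace_of X g = trace_of X g'"
    and "f \<in> dip X" "g \<in> dip X" "f 1 = g 0"
  shows "trace_of X (path_concat f g) = trace_of X (path_concat f' g')"
proof -
  have r: "trace_of X (path_concat (reparametrize f \<phi>) (reparametrize g \<psi>)) = trace_of X (path_concat f g)"
    if "f \<in> dip X" "g \<in> dip X" "f 1 = g 0" "\<phi> \<in> surj_reparams" "\<psi> \<in> surj_reparams" for f g \<phi> \<psi>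
  proof -
    \<comment> \<open>This is \<open>\<phi>\<close> squeezed into the lower left quarter of the unit
      square, followed by \<open>\<psi>\<close> in the upper right one. With the clamps a single
      continuous formula covers both halves: the idle term is 0 before time 1/2 and 1/2 after
      it.\<close>
    let ?\<chi> = "\<lambda>t. \<phi> (min 1 (2 * t)) / 2 + \<psi> (max 0 (2 * t - 1)) / 2"
    have \<phi>: "continuous_on {0..1} \<phi>" "mono_on {0..1} \<phi>" "\<phi> 0 = 0" "\<phi> 1 = 1"
      and \<psi>: "continuous_on {0..1} \<psi>" "mono_on {0..1} \<psi>" "\<psi> 0 = 0" "\<psi> 1 = 1"
      using that by (auto simp: surj_reparams_iff)
    have "?\<chi> \<in> surj_reparams"
      unfolding surj_reparams_iff
    proof (intro conjI)
      have "continuous_on {0..1} (\<phi> \<circ> (\<lambda>t. min 1 (2 * t)))"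
        by (intro continuous_on_compose continuous_on_subset[OF \<phi>(1)] continuous_intros) auto
      moreover have "continuous_on {0..1} (\<psi> \<circ> (\<lambda>t. max 0 (2 * t - 1)))"
        by (intro continuous_on_compose continuous_on_subset[OF \<psi>(1)] continuous_intros) auto
      ultimately show "continuous_on {0..1} ?\<chi>" by (auto simp: o_def intro!: continuous_intros)
      show "mono_on {0..1} ?\<chi>"
      proof (rule mono_onI)
        fix r s :: real assume "r \<in> {0..1}" "s \<in> {0..1}" "r \<le> s"
        then show "?\<chi> r \<le> ?\<chi> s"
          by (intro add_mono divide_right_mono mono_onD[OF \<phi>(2)] mono_onD[OF \<psi>(2)]) auto
      qed
    qed (use \<phi> \<psi> in auto)
    moreover have "path_concat (reparametrize f \<phi>) (reparametrize g \<psi>) = reparametrize (path_concat f g) ?\<chi>"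
    proof
      fix t :: real
      have "t \<notin> {0..1} \<or> 0 \<le> t \<and> t \<le> 1/2 \<or> 1/2 < t \<and> t \<le> 1" by auto
      then consider "t \<notin> {0..1}" | "0 \<le> t" "t \<le> 1/2" | "1/2 < t" "t \<le> 1" by blast
      then show "path_concat (reparametrize f \<phi>) (reparametrize g \<psi>) t = reparametrize (path_concat f g) ?\<chi> t"
      proof cases
        case 2
        then have "\<phi> (2 * t) \<in> {0..1}" by (intro surj_reparams_in[OF that(4)]) auto
        moreover have "?\<chi> t = \<phi> (2 * t) / 2" using 2 \<psi> by (simp add: min_absorb2 max_absorb1)
        ultimately show ?thesis using 2 by (simp add: path_concat_def)
      next
        case 3
        then have "\<psi> (2 * t - 1) \<in> {0..1}" by (intro surj_reparams_in[OF that(5)]) auto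
        moreover have "?\<chi> t = 1 / 2 + \<psi> (2 * t - 1) / 2" using 3 \<phi> by (simp add: min_absorb1 max_absorb2)
        \<comment> \<open>Where \<open>\<psi>\<close> is still 0, the concatenation is evaluated at
          1/2 and returns \<open>f 1\<close>; the matching condition identifies this with
          \<open>g 0\<close>.\<close>
        ultimately show ?thesis using 3 that(3) by (auto simp: path_concat_def)
      qed (auto simp: path_concat_def)
    qed
    ultimately show ?thesis using trace_of_reparam[OF dip_concat, of f g] that by simp
  qed
  have id: "reparametrize f (\<lambda>t. t) = f" if "f \<in> dip X" for f
    using dip_ext[OF that] by (simp add: o_def extensional_restrict)
  have f': "f' \<in> dip X" "f' 0 = f 0" "f' 1 = f 1" using trace_of_eq_dip[OF assms(1,3)] by auto
  have "trace_of X (path_concat f g) = trace_of X (path_concat f' g)"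
  proof (rule trace_of_lift[OF assms(1,3)])
    fix k \<phi> assume "k \<in> dip X" "k 0 = f' 0" "k 1 = f' 1" "\<phi> \<in> surj_reparams"
    then show "trace_of X (path_concat (reparametrize k \<phi>) g) = trace_of X (path_concat k g)"
      using r[of k g \<phi> "\<lambda>t. t"] surj_reparams_id id[OF assms(4)] f' assms by simp
  qed
  also have "\<dots> = trace_of X (path_concat f' g')"
  proof (rule trace_of_lift[OF assms(2,4)])
    have "g' 0 = g 0" using trace_of_eq_dip[OF assms(2,4)] by auto
    fix k \<phi> assume "k \<in> dip X" "k 0 = g' 0" "k 1 = g' 1" "\<phi> \<in> surj_reparams"
    then show "trace_of X (path_concat f' (reparametrize k \<phi>)) = trace_of X (path_concat f' k)"
      using r[of f' k "\<lambda>t. t" \<phi>] surj_reparams_id id[OF f'(1)] f' assms \<open>g' 0 = g 0\<close> by simp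
  qed
  finally show ?thesis .
qed

lemma trace_concat_trace_of:
  assumes "f \<in> dip X" "g \<in> dip X" "f 1 = g 0"
  shows "trace_concat X (trace_of X f) (trace_of X g) = trace_of X (path_concat f g)"
proof -
  have "trace_concat X (trace_of X f) (trace_of X g)
      = (\<Union>f'\<in>trace_of X f. trace_of X (path_concat f' g))"
    unfolding trace_concat_def
  proof (rule SUP_cong[OF refl])
    fix f' assume "f' \<in> trace_of X f"
    then have f': "trace_of X f' = trace_of X f" by (simp add: in_trace_of_iff)
    then have "f' \<in> dip X" "f' 1 = f 1" using trace_of_eq_dip[OF f'[symmetric] assms(1)] by auto
    then show "(\<Union>g\<in>trace_of X g. trace_of X (path_concat f' g)) = trace_of X (path_concat f' g)"
      using assms
      by (intro UN_trace_of[where H = "\<lambda>g. trace_of X (path_concat f' g)"] sym[OF trace_of_path_concat_cong]) auto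
  qed
  also have "\<dots> = trace_of X (path_concat f g)"
    using assms
    by (intro UN_trace_of[where H = "\<lambda>f. trace_of X (path_concat f g)"] sym[OF trace_of_path_concat_cong]) auto
  finally show ?thesis .
qed

lemma path_concat_ends [simp]: "path_concat f g 0 = f 0" "path_concat f g 1 = g 1"
  by (auto simp: path_concat_def)

lemma trace_concat_in:
  assumes "a \<in> traces X" "b \<in> traces X" "trace_tgt a = trace_src b"
  shows "trace_concat X a b \<in> traces X" "trace_src (trace_concat X a b) = trace_src a"
    "trace_tgt (trace_concat X a b) = trace_tgt b"
  using assms by (auto simp: trace_concat_trace_of dip_concat)

text \<open>A surjective reparametrization may pause, and pausing for the first half is the same as
  prefixing a constant path. Hence the unit laws of traces are strict.\<close>

lemma path_concat_const_left:
  assumes "f \<in> dip X"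
  shows "trace_of X (path_concat (const_path (f 0)) f) = trace_of X f"
proof -
  have "(\<lambda>t. max 0 (2 * t - 1)) \<in> surj_reparams"
    by (auto simp: surj_reparams_iff mono_on_def intro!: continuous_intros)
  moreover have "path_concat (const_path (f 0)) f = reparametrize f (\<lambda>t. max 0 (2 * t - 1))"
  proof
    fix t :: real
    show "path_concat (const_path (f 0)) f t = reparametrize f (\<lambda>t. max 0 (2 * t - 1)) t"
    proof (cases "t = 1/2")
      case True
      show ?thesis unfolding True by (simp add: path_concat_def)
    qed (auto simp: path_concat_def min_def max_def)
  qed
  ultimately show ?thesis using trace_of_reparam assms by simp
qed

lemma path_concat_const_right:
  assumes "f \<in> dip X"
  shows "trace_of X (path_concat f (const_path (f 1))) = trace_of X f"
proof -
  have "(\<lambda>t. min 1 (2 * t)) \<in> surj_reparams"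
    by (auto simp: surj_reparams_iff mono_on_def intro!: continuous_intros)
  moreover have "path_concat f (const_path (f 1)) = reparametrize f (\<lambda>t. min 1 (2 * t))"
  proof
    fix t :: real
    show "path_concat f (const_path (f 1)) t = reparametrize f (\<lambda>t. min 1 (2 * t)) t"
    proof (cases "t = 1/2")
      case True
      show ?thesis unfolding True by (simp add: path_concat_def)
    qed (auto simp: path_concat_def min_def max_def)
  qed
  ultimately show ?thesis using trace_of_reparam assms by simp
qed

lemma path_concat_assoc:
  assumes "f \<in> dip X" "g \<in> dip X" "h \<in> dip X" "f 1 = g 0" "g 1 = h 0"
  shows "trace_of X (path_concat (path_concat f g) h) = trace_of X (path_concat f (path_concat g h))"
proof -
  \<comment> \<open>The piecewise linear map that sends the breakpoints 1/4, 1/2 of the left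
    bracketing to the breakpoints 1/2, 3/4 of the right one. Its slopes 2, 1, 1/2 decrease, so it is
    concave and equals the minimum of its three linear pieces.\<close>
  let ?\<phi> = "\<lambda>t::real. min (2 * t) (min (t + 1/4) (t / 2 + 1/2))"
  have "?\<phi> \<in> surj_reparams"
    by (auto simp: surj_reparams_iff mono_on_def intro!: continuous_intros)
  moreover have "path_concat (path_concat f g) h = reparametrize (path_concat f (path_concat g h)) ?\<phi>"
  proof
    fix t :: real
    have "t \<notin> {0..1} \<or> 0 \<le> t \<and> t \<le> 1/4 \<or> 1/4 < t \<and> t \<le> 1/2 \<or> 1/2 < t \<and> t \<le> 1" by auto
    then consider "t \<notin> {0..1}" | "0 \<le> t" "t \<le> 1/4" | "1/4 < t" "t \<le> 1/2" | "1/2 < t" "t \<le> 1" by blast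
    then show "path_concat (path_concat f g) h t = reparametrize (path_concat f (path_concat g h)) ?\<phi> t"
    proof cases
      case 2
      then have "?\<phi> t = 2 * t" by auto
      then show ?thesis using 2 by (auto simp: path_concat_def)
    next
      case 3
      then have "?\<phi> t = t + 1/4" by auto
      then show ?thesis using 3 by (auto simp: path_concat_def algebra_simps)
    next
      case 4
      then have "?\<phi> t = t / 2 + 1/2" by auto
      then show ?thesis using 4 by (auto simp: path_concat_def algebra_simps)
    qed (auto simp: path_concat_def)
  qed
  ultimately show ?thesis
    using trace_of_reparam[of "path_concat f (path_concat g h)" ?\<phi>] dip_concat assms by simp
qed

lemma trace_concat_id:
  assumes "a \<in> traces X"
  shows "trace_concat X (trace_of X (const_path (trace_src a))) a = a"
    and "trace_concat X a (trace_of X (const_path (trace_tgt a))) = a"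
proof -
  obtain f where f: "f \<in> dip X" "a = trace_of X f" using assms by blast
  have "f 0 \<in> topspace (spc X)" "f 1 \<in> topspace (spc X)" using dip_in_topspace[OF f(1)] by auto
  then show "trace_concat X (trace_of X (const_path (trace_src a))) a = a"
    "trace_concat X a (trace_of X (const_path (trace_tgt a))) = a"
    using f by (simp_all add: trace_concat_trace_of dip_const path_concat_const_left path_concat_const_right)
qed

lemma trace_concat_assoc:
  assumes "a \<in> traces X" "b \<in> traces X" "c \<in> traces X" "trace_tgt a = trace_src b" "trace_tgt b = trace_src c"
  shows "trace_concat X (trace_concat X a b) c = trace_concat X a (trace_concat X b c)"
  using assms by (auto simp: trace_concat_trace_of dip_concat path_concat_assoc)

lemma trace_ends_in_topspace:
  "a \<in> traces X \<Longrightarrow> trace_src a \<in> topspace (spc X)" "a \<in> traces X \<Longrightarrow> trace_tgt a \<in> topspace (spc X)"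
  using dip_in_topspace by auto

lemma category_trace_category: "category (trace_category X)"
  unfolding trace_category_def
  by (rule category_mk_cat)
    (auto simp: trace_concat_id trace_concat_assoc dip_const dip_in_topspace trace_concat_trace_of dip_concat
      path_concat_const_left path_concat_const_right path_concat_assoc)

end

text \<open>Postcomposition with \<open>h\<close> commutes with reparametrization, so it respects
  the generating steps.\<close>

lemma trace_map_trace_of:
  assumes "dispace X" "dispace Y" "dimap X Y h" "f \<in> dip X"
  shows "trace_map Y h (trace_of X f) = trace_of Y (restrict (h \<circ> f) {0..1})"
proof -
  interpret X: dispace X by fact
  interpret Y: dispace Y by fact
  show ?thesis
    unfolding trace_map_def
  proof (rule UN_trace_of)
    fix g assume "trace_of X g = trace_of X f"
    then have g: "trace_of X f = trace_of X g" by simp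
    show "trace_of Y (restrict (h \<circ> g) {0..1}) = trace_of Y (restrict (h \<circ> f) {0..1})"
    proof (rule sym, rule X.trace_of_lift[OF g assms(4)])
      fix k \<phi> assume k: "k \<in> dip X" "\<phi> \<in> surj_reparams"
      then have "restrict (h \<circ> k) {0..1} \<in> dip Y" using assms by (auto simp: dimap_def)
      moreover have "restrict (h \<circ> reparametrize k \<phi>) {0..1} = reparametrize (restrict (h \<circ> k) {0..1}) \<phi>"
        using surj_reparams_in[OF k(2)] by (auto simp: restrict_def fun_eq_iff)
      ultimately show "trace_of Y (restrict (h \<circ> reparametrize k \<phi>) {0..1}) = trace_of Y (restrict (h \<circ> k) {0..1})"
        using Y.trace_of_reparam k by simp
    qed
  qed
qed

lemma dimap_dip: "\<lbrakk>dimap X Y h; f \<in> dip X\<rbrakk> \<Longrightarrow> restrict (h \<circ> f) {0..1} \<in> dip Y"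
  by (auto simp: dimap_def)

lemma trace_map_in:
  assumes "dispace X" "dispace Y" "dimap X Y h" "a \<in> traces X"
  shows "trace_map Y h a \<in> traces Y" "trace_src (trace_map Y h a) = h (trace_src a)"
    "trace_tgt (trace_map Y h a) = h (trace_tgt a)"
  using assms
  by (auto simp: trace_map_trace_of dimap_dip dispace.trace_src_trace_of dispace.trace_tgt_trace_of)

lemma trace_map_concat:
  assumes "dispace X" "dispace Y" "dimap X Y h" "a \<in> traces X" "b \<in> traces X" "trace_tgt a = trace_src b"
  shows "trace_map Y h (trace_concat X a b) = trace_concat Y (trace_map Y h a) (trace_map Y h b)"
proof -
  interpret X: dispace X by fact
  interpret Y: dispace Y by fact
  have "restrict (h \<circ> path_concat f g) {0..1} = path_concat (restrict (h \<circ> f) {0..1}) (restrict (h \<circ> g) {0..1})" for f g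
    by (auto simp: path_concat_def fun_eq_iff)
  then show ?thesis
    using assms by (auto simp: X.trace_concat_trace_of Y.trace_concat_trace_of trace_map_trace_of dimap_dip X.dip_concat)
qed

lemma trace_map_const:
  assumes "dispace X" "dispace Y" "dimap X Y h" "x \<in> topspace (spc X)"
  shows "trace_map Y h (trace_of X (const_path x)) = trace_of Y (const_path (h x))"
  using trace_map_trace_of[OF assms(1-3) dispace.dip_const[OF assms(1,4)]]
  by (simp add: restrict_def o_def cong: if_cong)

lemma trace_map_id:
  assumes "dispace X" "a \<in> traces X"
  shows "trace_map X (\<lambda>x\<in>topspace (spc X). x) a = a"
proof -
  interpret X: dispace X by fact
  obtain f where f: "f \<in> dip X" "a = trace_of X f" using assms by blast
  have d: "dimap X X (\<lambda>x\<in>topspace (spc X). x)"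
    by (rule dimap_cong[OF assms(1) _ X.dimap_id]) auto
  have "restrict ((\<lambda>x\<in>topspace (spc X). x) \<circ> f) {0..1} = f"
    using dimap_restrict_cong[OF assms(1), of "\<lambda>x\<in>topspace (spc X). x" "\<lambda>x. x" f] f X.dip_ext[OF f(1)]
    by (simp add: o_def extensional_restrict)
  then show ?thesis using trace_map_trace_of[OF assms(1,1) d f(1)] f by simp
qed

lemma trace_map_comp:
  assumes "dispace X" "dispace Y" "dispace Z" "dimap X Y h" "dimap Y Z k" "a \<in> traces X"
  shows "trace_map Z (restrict (k \<circ> h) (topspace (spc X))) a = trace_map Z k (trace_map Y h a)"
proof -
  interpret X: dispace X by fact
  obtain f where f: "f \<in> dip X" "a = trace_of X f" using assms by blast
  have d: "dimap X Z (restrict (k \<circ> h) (topspace (spc X)))"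
    by (rule dimap_cong[OF assms(1) _ dimap_comp[OF assms(1,4,5)]]) auto
  have "restrict (restrict (k \<circ> h) (topspace (spc X)) \<circ> f) {0..1} = restrict (k \<circ> restrict (h \<circ> f) {0..1}) {0..1}"
    using dimap_restrict_cong[OF assms(1), of "restrict (k \<circ> h) (topspace (spc X))" "k \<circ> h" f] f
    by (auto simp: fun_eq_iff)
  then show ?thesis
    using f trace_map_trace_of[OF assms(1,3) d f(1)] trace_map_trace_of[OF assms(1,2,4) f(1)]
      trace_map_trace_of[OF assms(2,3,5) dimap_dip[OF assms(4) f(1)]] by simp
qed

section \<open>The topology of trace spaces\<close>

text \<open>\<open>quotient_topology\<close> is made with the abstraction function
  \<open>topology\<close>, so its open sets are known only once the axioms of a topology have been
  checked.\<close>

lemma openin_quotient_topology: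
  "openin (quotient_topology T q) U \<longleftrightarrow> U \<subseteq> q ` topspace T \<and> openin T {x \<in> topspace T. q x \<in> U}"
proof -
  have "istopology (\<lambda>U. U \<subseteq> q ` topspace T \<and> openin T {x \<in> topspace T. q x \<in> U})"
    unfolding istopology_def
  proof (intro conjI allI impI)
    fix U V
    assume U: "U \<subseteq> q ` topspace T \<and> openin T {x \<in> topspace T. q x \<in> U}"
      and V: "V \<subseteq> q ` topspace T \<and> openin T {x \<in> topspace T. q x \<in> V}"
    have "{x \<in> topspace T. q x \<in> U \<inter> V} = {x \<in> topspace T. q x \<in> U} \<inter> {x \<in> topspace T. q x \<in> V}" by auto
    then show "openin T {x \<in> topspace T. q x \<in> U \<inter> V}" using U V by (simp add: openin_Int)
    show "U \<inter> V \<subseteq> q ` topspace T" using U by blast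
  next
    fix \<K>
    assume K: "\<forall>U\<in>\<K>. U \<subseteq> q ` topspace T \<and> openin T {x \<in> topspace T. q x \<in> U}"
    have "{x \<in> topspace T. q x \<in> \<Union>\<K>} = (\<Union>U\<in>\<K>. {x \<in> topspace T. q x \<in> U})" by auto
    moreover have "openin T \<dots>" using K by (intro openin_Union) auto
    ultimately show "openin T {x \<in> topspace T. q x \<in> \<Union>\<K>}" by simp
    show "\<Union>\<K> \<subseteq> q ` topspace T" using K by blast
  qed
  then show ?thesis by (simp add: quotient_topology_def topology_inverse')
qed

lemma topspace_quotient_topology [simp]: "topspace (quotient_topology T q) = q ` topspace T"
proof
  show "topspace (quotient_topology T q) \<subseteq> q ` topspace T"
    using openin_topspace[of "quotient_topology T q"] unfolding openin_quotient_topology by blast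
  have "{x \<in> topspace T. q x \<in> q ` topspace T} = topspace T" by auto
  then show "q ` topspace T \<subseteq> topspace (quotient_topology T q)"
    by (intro openin_subset) (simp add: openin_quotient_topology)
qed

lemma continuous_map_quotient_topology: "continuous_map T (quotient_topology T q) q"
  by (auto simp: continuous_map openin_quotient_topology)

lemma compactin_top_of_set: "compactin (top_of_set S) K \<longleftrightarrow> compact K \<and> K \<subseteq> S"
  by (auto simp: compactin_subtopology)

lemma dipath_space_basic_open:
  assumes "compact K" "K \<subseteq> {0..1}" "openin (spc X) U" and X: "dispace X"
  shows "openin (dipath_space X x y) {f \<in> dipaths X x y. f ` K \<subseteq> U}"
proof -
  let ?B = "{f \<in> extensional {0..1}. continuous_map (top_of_set {0..1}) (spc X) f \<and> f ` K \<subseteq> U}"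
  have "openin (compact_open (top_of_set {0..1}) (spc X)) ?B"
    unfolding compact_open_def
    by (rule topology_generated_by_Basis) (use assms in \<open>auto simp: compactin_top_of_set\<close>)
  moreover have "{f \<in> dipaths X x y. f ` K \<subseteq> U} = ?B \<inter> dipaths X x y"
    using dispace.dip_path[OF X] dispace.dip_ext[OF X] by (auto simp: dipaths_def pathin_def)
  ultimately show ?thesis by (auto simp: dipath_space_def openin_subtopology)
qed

context dispace
begin

lemma topspace_dipath_space [simp]: "topspace (dipath_space X x y) = dipaths X x y"
proof
  show "topspace (dipath_space X x y) \<subseteq> dipaths X x y" by (simp add: dipath_space_def)
  \<comment> \<open>With an empty compact set the subbasic condition is vacuous, so the whole set of
    dipaths is open.\<close>
  have "openin (dipath_space X x y) {f \<in> dipaths X x y. f ` {} \<subseteq> {}}"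
    by (rule dipath_space_basic_open) (auto simp: dispace_axioms)
  then show "dipaths X x y \<subseteq> topspace (dipath_space X x y)" using openin_subset by auto
qed

lemma topspace_trace_space: "topspace (trace_space X x y) = trace_of X ` dipaths X x y"
  by (simp add: trace_space_def)

lemma in_trace_space_iff:
  "a \<in> topspace (trace_space X x y) \<longleftrightarrow> a \<in> traces X \<and> trace_src a = x \<and> trace_tgt a = y"
  by (auto simp: topspace_trace_space dipaths_def)

lemma continuous_map_trace_of: "continuous_map (dipath_space X x y) (trace_space X x y) (trace_of X)"
  unfolding trace_space_def by (rule continuous_map_quotient_topology)

lemma continuous_map_into_dipath_space:
  assumes "\<And>z. z \<in> topspace Z \<Longrightarrow> F z \<in> dipaths X x y"
    and "\<And>K U. \<lbrakk>compact K; K \<subseteq> {0..1::real}; openin (spc X) U\<rbrakk> \<Longrightarrow> openin Z {z \<in> topspace Z. F z ` K \<subseteq> U}"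
  shows "continuous_map Z (dipath_space X x y) F"
  unfolding dipath_space_def
proof (rule continuous_map_into_subtopology)
  have in_dip: "F z \<in> extensional {0..1} \<and> continuous_map (top_of_set {0..1}) (spc X) (F z)" if "z \<in> topspace Z" for z
    using assms(1)[OF that] dip_path dip_ext by (auto simp: dipaths_def pathin_def)
  show "continuous_map Z (compact_open (top_of_set {0..1}) (spc X)) F"
    unfolding compact_open_def
  proof (rule continuous_on_generated_topo)
    fix B
    assume "B \<in> {{f \<in> extensional (topspace (top_of_set {0..1::real})).
        continuous_map (top_of_set {0..1}) (spc X) f \<and> f ` K \<subseteq> U} |K U.
        compactin (top_of_set {0..1}) K \<and> openin (spc X) U}"
    then obtain K U where KU: "compact K" "K \<subseteq> {0..1::real}" "openin (spc X) U"
      and B: "B = {f \<in> extensional {0..1}. continuous_map (top_of_set {0..1}) (spc X) f \<and> f ` K \<subseteq> U}"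
      by (auto simp: compactin_top_of_set)
    have "F -` B \<inter> topspace Z = {z \<in> topspace Z. F z ` K \<subseteq> U}"
      using in_dip by (auto simp: B)
    then show "openin Z (F -` B \<inter> topspace Z)" using assms(2)[OF KU] by simp
  next
    show "F ` topspace Z \<subseteq> \<Union> {{f \<in> extensional (topspace (top_of_set {0..1})).
        continuous_map (top_of_set {0..1}) (spc X) f \<and> f ` K \<subseteq> U} |K U.
        compactin (top_of_set {0..1}) K \<and> openin (spc X) U}"
    proof safe
      fix z assume "z \<in> topspace Z"
      then show "F z \<in> \<Union> {{f \<in> extensional (topspace (top_of_set {0..1})).
        continuous_map (top_of_set {0..1}) (spc X) f \<and> f ` K \<subseteq> U} |K U.
        compactin (top_of_set {0..1}) K \<and> openin (spc X) U}"
        \<comment> \<open>The empty \<open>K\<close> and \<open>U\<close> give a subbasic set that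
          contains every continuous path.\<close>
        using in_dip[of z] by (intro UnionI[OF CollectI]) (rule exI[of _ "{}"], rule exI[of _ "{}"], auto)
    qed
  qed
qed (use assms(1) in auto)

section \<open>Openness of the projection from dipaths to traces\<close>

lemma reparametrize_dipaths:
  "\<lbrakk>f \<in> dipaths X x y; \<phi> \<in> surj_reparams\<rbrakk> \<Longrightarrow> reparametrize f \<phi> \<in> dipaths X x y"
  using reparam_step_dip[OF reparam_stepI] by (auto simp: dipaths_def)

text \<open>Precomposition pulls the subbasic set given by \<open>K\<close> and \<open>U\<close>
  back to the one given by the compact image of \<open>K\<close> under \<open>\<phi>\<close> and the
  same \<open>U\<close>.\<close>

lemma continuous_map_reparametrize:
  assumes "\<phi> \<in> surj_reparams"
  shows "continuous_map (dipath_space X x y) (dipath_space X x y) (\<lambda>f. reparametrize f \<phi>)"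
proof (rule continuous_map_into_dipath_space)
  fix K U assume K: "compact K" "K \<subseteq> {0..1::real}" and U: "openin (spc X) U"
  have "continuous_on K \<phi>"
    using assms K continuous_on_subset by (auto simp: surj_reparams_iff)
  then have "openin (dipath_space X x y) {f \<in> dipaths X x y. f ` (\<phi> ` K) \<subseteq> U}"
    using K U surj_reparams_in[OF assms]
    by (intro dipath_space_basic_open compact_continuous_image dispace_axioms) blast+
  moreover have "{f \<in> topspace (dipath_space X x y). reparametrize f \<phi> ` K \<subseteq> U}
      = {f \<in> dipaths X x y. f ` (\<phi> ` K) \<subseteq> U}"
    using K by (auto simp: subset_iff)
  ultimately show "openin (dipath_space X x y) {f \<in> topspace (dipath_space X x y). reparametrize f \<phi> ` K \<subseteq> U}"
    by simp
qed (simp add: reparametrize_dipaths assms)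

text \<open>For a fixed dipath \<open>f\<close>, precomposition is continuous from uniform
  convergence of reparametrizations to the compact-open topology. This allows a reparametrization to
  be replaced by a nearby homeomorphism without leaving \<open>W\<close>.\<close>

lemma reparametrize_near:
  assumes "openin (dipath_space X x y) W" "f \<in> dip X" "\<phi> \<in> surj_reparams" "reparametrize f \<phi> \<in> W"
  shows "\<exists>\<delta>>0. \<forall>\<omega>\<in>surj_reparams. (\<forall>t\<in>{0..1}. \<bar>\<omega> t - \<phi> t\<bar> < \<delta>) \<longrightarrow> reparametrize f \<omega> \<in> W"
proof -
  let ?near = "\<lambda>V \<delta>. \<forall>\<omega>\<in>surj_reparams. (\<forall>t\<in>{0..1}. \<bar>\<omega> t - \<phi> t\<bar> < \<delta>) \<longrightarrow> reparametrize f \<omega> \<in> V"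
  let ?S = "{{f \<in> extensional {0..1}. continuous_map (top_of_set {0..1}) (spc X) f \<and> f ` K \<subseteq> U} |K U.
        compactin (top_of_set {0..1}) K \<and> openin (spc X) U}"
  obtain V where V: "openin (compact_open (top_of_set {0..1}) (spc X)) V" and W: "W = V \<inter> dipaths X x y"
    using assms(1) by (auto simp: dipath_space_def openin_subtopology)
  from V have "generate_topology_on ?S V" by (simp add: compact_open_def openin_topology_generated_by_iff)
  \<comment> \<open>Induction over the generation of the topology: an intersection takes the smaller
    tolerance, a union any member that contains the path, and only subbasic sets require
    analysis.\<close>
  then have "reparametrize f \<phi> \<in> V \<longrightarrow> (\<exists>\<delta>>0. ?near V \<delta>)"
  proof (induction rule: generate_topology_on.induct)
    case (Int A B)
    show ?case
    proof
      assume "reparametrize f \<phi> \<in> A \<inter> B"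
      then obtain \<delta> \<epsilon> where "\<delta> > 0" "?near A \<delta>" "\<epsilon> > 0" "?near B \<epsilon>" using Int by blast
      then have "min \<delta> \<epsilon> > 0" "?near (A \<inter> B) (min \<delta> \<epsilon>)" by auto
      then show "\<exists>\<delta>>0. ?near (A \<inter> B) \<delta>" by blast
    qed
  next
    case (UN \<K>)
    show ?case
    proof
      assume "reparametrize f \<phi> \<in> \<Union>\<K>"
      then obtain A where "A \<in> \<K>" "reparametrize f \<phi> \<in> A" by blast
      then obtain \<delta> where "\<delta> > 0" "?near A \<delta>" using UN by blast
      then show "\<exists>\<delta>>0. ?near (\<Union>\<K>) \<delta>" using \<open>A \<in> \<K>\<close> by blast
    qed
  next
    case (Basis B)
    then obtain K U where K: "compact K" "K \<subseteq> {0..1::real}" and U: "openin (spc X) U"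
      and B: "B = {f \<in> extensional {0..1}. continuous_map (top_of_set {0..1}) (spc X) f \<and> f ` K \<subseteq> U}"
      by (auto simp: compactin_top_of_set)
    show ?case
    proof
      assume "reparametrize f \<phi> \<in> B"
      then have fK: "f (\<phi> t) \<in> U" if "t \<in> K" for t
      proof -
        have "reparametrize f \<phi> t \<in> U" using \<open>reparametrize f \<phi> \<in> B\<close> that unfolding B by blast
        then show ?thesis using K that by auto
      qed
      have "continuous_map (top_of_set {0..1}) (spc X) f" using dip_path[OF assms(2)] by (simp add: pathin_def)
      then have "openin (top_of_set {0..1}) {t \<in> {0..1}. f t \<in> U}"
        using openin_continuous_map_preimage[OF _ U] by fastforce
      then obtain G where G: "open G" "{t \<in> {0..1}. f t \<in> U} = {0..1} \<inter> G" by (auto simp: openin_open)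
      \<comment> \<open>A compact subset of an open set has a uniform neighbourhood inside it, which
        provides one tolerance for all times in \<open>K\<close>.\<close>
      have "compact (\<phi> ` K)"
        using assms(3) K continuous_on_subset by (auto simp: surj_reparams_iff intro!: compact_continuous_image)
      moreover have "\<phi> ` K \<subseteq> G" using G fK surj_reparams_in[OF assms(3)] K by blast
      ultimately obtain \<delta> where \<delta>: "\<delta> > 0" "(\<Union>u\<in>\<phi> ` K. ball u \<delta>) \<subseteq> G"
        using compact_subset_open_imp_ball_epsilon_subset G(1) by metis
      have "?near B \<delta>"
      proof (intro ballI impI)
        fix \<omega> assume \<omega>: "\<omega> \<in> surj_reparams" "\<forall>t\<in>{0..1}. \<bar>\<omega> t - \<phi> t\<bar> < \<delta>"
        have "f (\<omega> t) \<in> U" if "t \<in> K" for t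
        proof -
          have "\<omega> t \<in> ball (\<phi> t) \<delta>" using \<omega> that K by (auto simp: dist_real_def abs_minus_commute)
          then have "\<omega> t \<in> G" using \<delta> that by blast
          then show ?thesis using G surj_reparams_in[OF \<omega>(1)] that K by blast
        qed
        moreover have "reparametrize f \<omega> \<in> dip X"
          using reparam_step_dip[OF reparam_stepI[OF assms(2) \<omega>(1)]] by simp
        then have "reparametrize f \<omega> \<in> extensional {0..1}" "continuous_map (top_of_set {0..1}) (spc X) (reparametrize f \<omega>)"
          using dip_path[of "reparametrize f \<omega>"] dip_ext[of "reparametrize f \<omega>"] by (simp_all only: pathin_def)
        ultimately show "reparametrize f \<omega> \<in> B" using K by (auto simp: B)
      qed
      then show "\<exists>\<delta>>0. ?near B \<delta>" using \<delta> by blast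
    qed
  qed auto
  then obtain \<delta> where \<delta>: "\<delta> > 0" "?near V \<delta>" using assms(4) W by blast
  \<comment> \<open>The induction took place in the ambient compact-open topology. To return to
    \<open>W\<close> the endpoints are needed, and surjective reparametrizations fix them.\<close>
  have "reparametrize f \<phi> \<in> dipaths X x y" using assms(4) W by simp
  then have "f \<in> dipaths X x y" using assms(2,3) by (auto simp: dipaths_def surj_reparams_iff)
  then have "?near W \<delta>" using \<delta> reparametrize_dipaths W by auto
  then show ?thesis using \<delta> by blast
qed

text \<open>Induction along the zigzag from \<open>f\<close> to \<open>g\<close>, starting from the
  identity homeomorphism. Only the existence of \<open>\<omega>\<close> is carried along: each step
  chooses a new one, with a tolerance depending on the current dipath.\<close>

lemma equivclp_reparam_homeo:
  assumes W: "openin (dipath_space X x y) W" and f: "f \<in> W" and e: "equivclp (reparam_step X) f g"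
  shows "\<exists>\<omega>\<in>homeo_reparams. reparametrize g \<omega> \<in> W"
  using e
proof (induction rule: equivclp_induct)
  case base
  have "f \<in> dipaths X x y" using f openin_subset[OF W] by auto
  then have "reparametrize f (\<lambda>t. t) = f"
    using dip_ext by (simp add: dipaths_def o_def extensional_restrict)
  moreover have "(\<lambda>t. t) \<in> homeo_reparams" by (simp add: homeo_reparams_def surj_reparams_id)
  ultimately show ?case using f by metis
next
  case (step g g')
  then obtain \<omega> where \<omega>: "\<omega> \<in> homeo_reparams" and g\<omega>: "reparametrize g \<omega> \<in> W" by blast
  have \<omega>s: "\<omega> \<in> surj_reparams" using \<omega> by (simp add: homeo_reparams_def)
  \<comment> \<open>Both \<open>\<theta>\<close> and the identity take values in the unit interval,
    so moving by a fraction \<open>\<delta>\<close> from one towards the other changes each value by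
    at most \<open>\<delta>\<close>.\<close>
  have approx: "\<bar>((1 - \<delta>) * \<theta> t + \<delta> * t) - \<theta> t\<bar> \<le> \<delta>" if "0 < \<delta>" "t \<in> {0..1}" "\<theta> \<in> surj_reparams" for \<delta> t \<theta>
  proof -
    have "((1 - \<delta>) * \<theta> t + \<delta> * t) - \<theta> t = \<delta> * (t - \<theta> t)" by (simp add: algebra_simps)
    moreover have "\<bar>t - \<theta> t\<bar> \<le> 1" using surj_reparams_in[OF that(3,2)] that(2) by auto
    ultimately show ?thesis using that(1) by (simp add: abs_mult mult_left_le)
  qed
  from step(2) show ?case
  proof
    assume s: "reparam_step X g g'"
    then obtain \<phi> where \<phi>: "\<phi> \<in> surj_reparams" "g' = reparametrize g \<phi>" by (auto simp: reparam_step_iff)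
    obtain \<psi> where \<psi>: "\<psi> \<in> homeo_reparams" "\<And>t. t \<in> {0..1} \<Longrightarrow> \<psi> (\<omega> t) = t" "\<And>t. t \<in> {0..1} \<Longrightarrow> \<omega> (\<psi> t) = t"
      using homeo_reparams_inverse[OF \<omega>] by metis
    have \<psi>s: "\<psi> \<in> surj_reparams" using \<psi>(1) by (simp add: homeo_reparams_def)
    \<comment> \<open>The new \<open>\<rho>\<close> has to make
      \<open>g \<circ> \<phi> \<circ> \<rho>\<close> close to \<open>g \<circ> \<omega>\<close>,
      that is, to be an approximate right inverse of \<open>\<psi> \<circ> \<phi>\<close>, where
      \<open>\<psi>\<close> inverts \<open>\<omega>\<close>. No homeomorphism is an exact one unless
      \<open>\<phi>\<close> is injective.\<close>
    let ?\<theta> = "\<psi> \<circ> \<phi>"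
    have \<theta>: "?\<theta> \<in> surj_reparams" by (rule surj_reparams_comp[OF \<psi>s \<phi>(1)])
    have g: "g \<in> dip X" using reparam_step_dip(1)[OF s] .
    then have g\<omega>_dip: "reparametrize g \<omega> \<in> dip X" using reparam_step_dip(2)[OF reparam_stepI] \<omega>s by blast
    have "reparametrize (reparametrize g \<omega>) (\<lambda>t. t) = reparametrize g \<omega>" by auto
    then obtain \<delta> where \<delta>: "\<delta> > 0"
      "\<And>\<kappa>. \<lbrakk>\<kappa> \<in> surj_reparams; \<forall>t\<in>{0..1}. \<bar>\<kappa> t - t\<bar> < \<delta>\<rbrakk> \<Longrightarrow> reparametrize (reparametrize g \<omega>) \<kappa> \<in> W"
      using reparametrize_near[OF W g\<omega>_dip surj_reparams_id] g\<omega> by auto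
    \<comment> \<open>Halving \<open>\<delta>\<close> makes the final bound strict; the cap at 1
      keeps the combination convex.\<close>
    let ?\<epsilon> = "min 1 (\<delta> / 2)"
    let ?\<kappa> = "\<lambda>t. (1 - ?\<epsilon>) * ?\<theta> t + ?\<epsilon> * t"
    have \<kappa>: "?\<kappa> \<in> homeo_reparams" by (rule homeo_reparams_convex[OF \<theta>]) (use \<delta> in auto)
    then obtain \<rho> where \<rho>: "\<rho> \<in> homeo_reparams" "\<And>t. t \<in> {0..1} \<Longrightarrow> ?\<kappa> (\<rho> t) = t"
      using homeo_reparams_inverse[OF \<kappa>] by metis
    have \<rho>s: "\<rho> \<in> surj_reparams" using \<rho>(1) by (simp add: homeo_reparams_def)
    \<comment> \<open>Evaluated at time \<open>\<rho> u\<close>, closeness of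
      \<open>\<kappa>\<close> to \<open>\<theta>\<close> becomes closeness of the identity to
      \<open>\<theta> \<circ> \<rho>\<close>, because \<open>\<rho>\<close> inverts
      \<open>\<kappa>\<close>.\<close>
    have "\<bar>(?\<theta> \<circ> \<rho>) u - u\<bar> < \<delta>" if "u \<in> {0..1}" for u
    proof -
      have "\<bar>?\<kappa> (\<rho> u) - ?\<theta> (\<rho> u)\<bar> \<le> ?\<epsilon>"
        by (rule approx[OF _ surj_reparams_in[OF \<rho>s that] \<theta>]) (use \<delta> in auto)
      then have "\<bar>u - ?\<theta> (\<rho> u)\<bar> \<le> ?\<epsilon>" unfolding \<rho>(2)[OF that] .
      moreover have "?\<epsilon> < \<delta>" using \<delta>(1) by auto
      ultimately show ?thesis by (simp only: o_apply abs_minus_commute)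
    qed
    then have "reparametrize (reparametrize g \<omega>) (?\<theta> \<circ> \<rho>) \<in> W"
      by (intro \<delta>(2) surj_reparams_comp[OF \<theta> \<rho>s] ballI)
    \<comment> \<open>In the middle \<open>\<omega> \<circ> \<psi>\<close> cancels, which leaves
      \<open>g \<circ> \<phi> \<circ> \<rho>\<close>.\<close>
    moreover have "reparametrize (reparametrize g \<omega>) (?\<theta> \<circ> \<rho>) = reparametrize g' \<rho>"
    proof
      fix t
      show "reparametrize (reparametrize g \<omega>) (?\<theta> \<circ> \<rho>) t = reparametrize g' \<rho> t"
      proof (cases "t \<in> {0..1}")
        case True
        then have r: "\<rho> t \<in> {0..1}" by (rule surj_reparams_in[OF \<rho>s])
        then have "\<phi> (\<rho> t) \<in> {0..1}" by (rule surj_reparams_in[OF \<phi>(1)])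
        then show ?thesis
          using True r \<psi>(3) surj_reparams_in[OF \<theta> r] by (simp add: \<phi>(2))
      qed auto
    qed
    ultimately have "reparametrize g' \<rho> \<in> W" by simp
    then show ?case using \<rho>(1) by blast
  next
    assume s: "reparam_step X g' g"
    then obtain \<phi> where \<phi>: "\<phi> \<in> surj_reparams" "g = reparametrize g' \<phi>" by (auto simp: reparam_step_iff)
    \<comment> \<open>The backward direction is easier: \<open>g \<circ> \<omega>\<close> is already
      the reparametrization of \<open>g'\<close> by \<open>\<phi> \<circ> \<omega>\<close>, which
      only has to be moved to a nearby homeomorphism.\<close>
    have \<phi>\<omega>: "\<phi> \<circ> \<omega> \<in> surj_reparams" by (rule surj_reparams_comp[OF \<phi>(1) \<omega>s])
    have "reparametrize g \<omega> = reparametrize g' (\<phi> \<circ> \<omega>)"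
      using surj_reparams_in[OF \<omega>s] by (auto simp: \<phi>(2) fun_eq_iff)
    then obtain \<delta> where \<delta>: "\<delta> > 0"
      "\<And>\<kappa>. \<lbrakk>\<kappa> \<in> surj_reparams; \<forall>t\<in>{0..1}. \<bar>\<kappa> t - (\<phi> \<circ> \<omega>) t\<bar> < \<delta>\<rbrakk> \<Longrightarrow> reparametrize g' \<kappa> \<in> W"
      using reparametrize_near[OF W reparam_step_dip(1)[OF s] \<phi>\<omega>] g\<omega> by auto
    let ?\<epsilon> = "min 1 (\<delta> / 2)"
    let ?\<kappa> = "\<lambda>t. (1 - ?\<epsilon>) * (\<phi> \<circ> \<omega>) t + ?\<epsilon> * t"
    have \<kappa>: "?\<kappa> \<in> homeo_reparams" by (rule homeo_reparams_convex[OF \<phi>\<omega>]) (use \<delta> in auto)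
    have "\<bar>?\<kappa> t - (\<phi> \<circ> \<omega>) t\<bar> < \<delta>" if "t \<in> {0..1}" for t
      using approx[OF _ that \<phi>\<omega>, of ?\<epsilon>] \<delta>(1) by linarith
    then have "reparametrize g' ?\<kappa> \<in> W" using \<delta>(2) \<kappa> by (auto simp: homeo_reparams_def)
    then show ?case using \<kappa> by blast
  qed
qed

lemma openin_trace_of_image:
  assumes W: "openin (dipath_space X x y) W"
  shows "openin (trace_space X x y) (trace_of X ` W)"
proof -
  have sub: "W \<subseteq> dipaths X x y" using openin_subset[OF W] by simp
  let ?P = "\<lambda>\<omega>. {g \<in> topspace (dipath_space X x y). reparametrize g \<omega> \<in> W}"
  \<comment> \<open>One inclusion is the zigzag lemma; for the other, a reparametrized dipath
    represents the same trace. Each set of the union is open by continuity of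
    reparametrization.\<close>
  have "{g \<in> dipaths X x y. trace_of X g \<in> trace_of X ` W} = (\<Union>\<omega>\<in>homeo_reparams. ?P \<omega>)"
  proof (intro equalityI subsetI)
    fix g assume "g \<in> {g \<in> dipaths X x y. trace_of X g \<in> trace_of X ` W}"
    then obtain f where "f \<in> W" "trace_of X f = trace_of X g" "g \<in> dipaths X x y" by force
    then have "f \<in> W" "equivclp (reparam_step X) f g" "g \<in> dipaths X x y" by (simp_all only: trace_of_eq_iff)
    then show "g \<in> (\<Union>\<omega>\<in>homeo_reparams. ?P \<omega>)" using equivclp_reparam_homeo[OF W] by auto
  next
    fix g assume "g \<in> (\<Union>\<omega>\<in>homeo_reparams. ?P \<omega>)"
    then obtain \<omega> where "\<omega> \<in> surj_reparams" and g: "g \<in> dipaths X x y" "reparametrize g \<omega> \<in> W"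
      by (auto simp: homeo_reparams_def)
    then have "trace_of X (reparametrize g \<omega>) = trace_of X g"
      by (intro trace_of_reparam) (auto simp: dipaths_def)
    then have "trace_of X g \<in> trace_of X ` W" using g(2) by (metis imageI)
    then show "g \<in> {g \<in> dipaths X x y. trace_of X g \<in> trace_of X ` W}" using g(1) by simp
  qed
  moreover have "openin (dipath_space X x y) (?P \<omega>)" if "\<omega> \<in> homeo_reparams" for \<omega>
    using that by (intro openin_continuous_map_preimage[OF continuous_map_reparametrize W])
      (simp add: homeo_reparams_def)
  ultimately show ?thesis
    using sub by (auto simp: trace_space_def openin_quotient_topology intro!: openin_Union)
qed

section \<open>Joint continuity of concatenation\<close>

lemma path_concat_image_iff:
  assumes "f 1 = g 0" "K \<subseteq> {0..1}"
  shows "path_concat f g ` K \<subseteq> U \<longleftrightarrow>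
    f ` (\<lambda>t. 2 * t) ` (K \<inter> {..1/2}) \<subseteq> U \<and> g ` (\<lambda>t. 2 * t - 1) ` (K \<inter> {1/2..}) \<subseteq> U"
proof -
  have l: "path_concat f g t = f (2 * t)" if "t \<in> K" "t \<le> 1/2" for t
    using that assms by (auto simp: path_concat_def)
  have r: "path_concat f g t = g (2 * t - 1)" if "t \<in> K" "1/2 \<le> t" for t
  \<comment> \<open>\<open>path_concat\<close> assigns time 1/2 to the first path; the matching
    condition lets the second half contain it as well.\<close>
  proof (cases "t = 1/2")
    case True
    show ?thesis unfolding True using assms by (simp add: path_concat_def)
  qed (use that assms in \<open>auto simp: path_concat_def\<close>)
  have "K = (K \<inter> {..1/2}) \<union> (K \<inter> {1/2..})" by auto
  then have "path_concat f g ` K = path_concat f g ` (K \<inter> {..1/2}) \<union> path_concat f g ` (K \<inter> {1/2..})"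
    by (metis image_Un)
  moreover have "path_concat f g ` (K \<inter> {..1/2}) = f ` (\<lambda>t. 2 * t) ` (K \<inter> {..1/2})"
    unfolding image_image by (rule image_cong) (auto simp: l)
  moreover have "path_concat f g ` (K \<inter> {1/2..}) = g ` (\<lambda>t. 2 * t - 1) ` (K \<inter> {1/2..})"
    unfolding image_image by (rule image_cong) (auto simp: r)
  ultimately show ?thesis by simp
qed

lemma continuous_map_path_concat:
  "continuous_map (prod_topology (dipath_space X x y) (dipath_space X y z)) (dipath_space X x z)
    (\<lambda>(f, g). path_concat f g)"
proof (rule continuous_map_into_dipath_space)
  fix p assume "p \<in> topspace (prod_topology (dipath_space X x y) (dipath_space X y z))"
  then show "(case p of (f, g) \<Rightarrow> path_concat f g) \<in> dipaths X x z"
    by (auto simp: dipaths_def dip_concat)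
next
  fix K U assume K: "compact K" "K \<subseteq> {0..1::real}" and U: "openin (spc X) U"
  \<comment> \<open>Both halves are cut closed so that their rescalings stay compact. The preimage
    of a subbasic set is then a product of two subbasic sets.\<close>
  let ?K1 = "(\<lambda>t::real. 2 * t) ` (K \<inter> {..1/2})" and ?K2 = "(\<lambda>t::real. 2 * t - 1) ` (K \<inter> {1/2..})"
  have "compact ?K1" "compact ?K2"
    using K(1) by (auto intro!: compact_continuous_image continuous_intros compact_Int_closed)
  moreover have "?K1 \<subseteq> {0..1}" "?K2 \<subseteq> {0..1}" using K(2) by auto
  ultimately have "openin (prod_topology (dipath_space X x y) (dipath_space X y z))
      ({f \<in> dipaths X x y. f ` ?K1 \<subseteq> U} \<times> {g \<in> dipaths X y z. g ` ?K2 \<subseteq> U})"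
    using dipath_space_basic_open[OF _ _ U dispace_axioms] by (simp add: openin_prod_Times_iff)
  moreover have iff: "path_concat f g ` K \<subseteq> U \<longleftrightarrow> f ` ?K1 \<subseteq> U \<and> g ` ?K2 \<subseteq> U"
    if "f \<in> dipaths X x y" "g \<in> dipaths X y z" for f g
    by (rule path_concat_image_iff[OF _ K(2)]) (use that in \<open>auto simp: dipaths_def\<close>)
  moreover have "{p \<in> topspace (prod_topology (dipath_space X x y) (dipath_space X y z)).
      (case p of (f, g) \<Rightarrow> path_concat f g) ` K \<subseteq> U}
    = {f \<in> dipaths X x y. f ` ?K1 \<subseteq> U} \<times> {g \<in> dipaths X y z. g ` ?K2 \<subseteq> U}"
    by (simp add: set_eq_iff iff cong: conj_cong) meson
  ultimately show "openin (prod_topology (dipath_space X x y) (dipath_space X y z))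
      {p \<in> topspace (prod_topology (dipath_space X x y) (dipath_space X y z)).
        (case p of (f, g) \<Rightarrow> path_concat f g) ` K \<subseteq> U}" by simp
qed

text \<open>Choose representatives of a pair of traces and a box of dipaths around them whose
  concatenations lie over \<open>W\<close>. Since the projection is open, the image of the box is an
  open box of traces with the same property.\<close>

lemma continuous_map_trace_concat:
  "continuous_map (prod_topology (trace_space X x y) (trace_space X y z)) (trace_space X x z)
    (\<lambda>(a, b). trace_concat X a b)"
  unfolding continuous_map
proof (intro conjI allI impI)
  let ?T = "prod_topology (trace_space X x y) (trace_space X y z)"
  let ?D = "prod_topology (dipath_space X x y) (dipath_space X y z)"
  show "(\<lambda>(a, b). trace_concat X a b) ` topspace ?T \<subseteq> topspace (trace_space X x z)"
    using trace_concat_in by (fastforce simp: in_trace_space_iff)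
  fix W assume W: "openin (trace_space X x z) W"
  let ?V = "{p \<in> topspace ?D. (trace_of X \<circ> (\<lambda>(f, g). path_concat f g)) p \<in> W}"
  have V: "openin ?D ?V"
    by (rule openin_continuous_map_preimage[OF continuous_map_compose[OF continuous_map_path_concat continuous_map_trace_of] W])
  show "openin ?T {p \<in> topspace ?T. (\<lambda>(a, b). trace_concat X a b) p \<in> W}"
    unfolding openin_prod_topology_alt
  proof (intro allI impI)
    fix a b assume "(a, b) \<in> {p \<in> topspace ?T. (\<lambda>(a, b). trace_concat X a b) p \<in> W}"
    then obtain f g where fg: "f \<in> dipaths X x y" "g \<in> dipaths X y z" "a = trace_of X f" "b = trace_of X g"
      and "trace_concat X a b \<in> W" by (auto simp: topspace_trace_space)
    then have "(f, g) \<in> ?V" by (auto simp: dipaths_def trace_concat_trace_of)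
    with V obtain A B where AB: "openin (dipath_space X x y) A" "openin (dipath_space X y z) B"
      "f \<in> A" "g \<in> B" "A \<times> B \<subseteq> ?V"
      unfolding openin_prod_topology_alt by meson
    have "trace_of X ` A \<times> trace_of X ` B \<subseteq> {p \<in> topspace ?T. (\<lambda>(a, b). trace_concat X a b) p \<in> W}"
    proof
      fix q assume "q \<in> trace_of X ` A \<times> trace_of X ` B"
      then obtain k l where q: "q = (trace_of X k, trace_of X l)" and "k \<in> A" "l \<in> B" by blast
      then have "(k, l) \<in> ?V" using AB(5) by blast
      then show "q \<in> {p \<in> topspace ?T. (\<lambda>(a, b). trace_concat X a b) p \<in> W}"
        by (auto simp: q topspace_trace_space dipaths_def trace_concat_trace_of)
    qed
    then show "\<exists>U V. openin (trace_space X x y) U \<and> openin (trace_space X y z) V \<and> a \<in> U \<and> b \<in> V \<and>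
        U \<times> V \<subseteq> {p \<in> topspace ?T. (\<lambda>(a, b). trace_concat X a b) p \<in> W}"
      using openin_trace_of_image[OF AB(1)] openin_trace_of_image[OF AB(2)] AB(3,4) fg(3,4)
      by (intro exI[of _ "trace_of X ` A"] exI[of _ "trace_of X ` B"]) auto
  qed
qed

end

text \<open>By the quotient property, continuity may be tested on dipaths. There the preimage of the
  subbasic set of \<open>K\<close> and \<open>U\<close> is the one of \<open>K\<close> and the
  preimage of \<open>U\<close> under \<open>h\<close>.\<close>

lemma continuous_map_trace_map:
  assumes "dispace X" "dispace Y" "dimap X Y h"
  shows "continuous_map (trace_space X x y) (trace_space Y (h x) (h y)) (trace_map Y h)"
proof -
  interpret X: dispace X by fact
  interpret Y: dispace Y by fact
  let ?H = "\<lambda>f. restrict (h \<circ> f) {0..1::real}"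
  have hc: "continuous_map (spc X) (spc Y) h" using assms(3) by (simp add: dimap_def)
  have "continuous_map (dipath_space X x y) (dipath_space Y (h x) (h y)) ?H"
  proof (rule Y.continuous_map_into_dipath_space)
    fix K U assume K: "compact K" "K \<subseteq> {0..1::real}" and U: "openin (spc Y) U"
    have "openin (spc X) {p \<in> topspace (spc X). h p \<in> U}"
      by (rule openin_continuous_map_preimage[OF hc U])
    then have "openin (dipath_space X x y) {f \<in> dipaths X x y. f ` K \<subseteq> {p \<in> topspace (spc X). h p \<in> U}}"
      by (rule dipath_space_basic_open[OF K _ assms(1)])
    moreover have "{f \<in> topspace (dipath_space X x y). ?H f ` K \<subseteq> U}
        = {f \<in> dipaths X x y. f ` K \<subseteq> {p \<in> topspace (spc X). h p \<in> U}}"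
      using X.dip_in_topspace K(2) by (auto simp: dipaths_def image_subset_iff subset_iff)
    ultimately show "openin (dipath_space X x y) {f \<in> topspace (dipath_space X x y). ?H f ` K \<subseteq> U}" by simp
  qed (use dimap_dip[OF assms(3)] in \<open>auto simp: dipaths_def\<close>)
  then have c: "continuous_map (dipath_space X x y) (trace_space Y (h x) (h y)) (trace_of Y \<circ> ?H)"
    by (rule continuous_map_compose[OF _ Y.continuous_map_trace_of])
  have m: "trace_map Y h (trace_of X f) = (trace_of Y \<circ> ?H) f" if "f \<in> dipaths X x y" for f
    using that trace_map_trace_of[OF assms] by (simp add: dipaths_def)
  show ?thesis
    unfolding continuous_map
  proof (intro conjI allI impI)
    show "trace_map Y h ` topspace (trace_space X x y) \<subseteq> topspace (trace_space Y (h x) (h y))"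
      using trace_map_in[OF assms] by (auto simp: X.in_trace_space_iff Y.in_trace_space_iff)
    fix U assume U: "openin (trace_space Y (h x) (h y)) U"
    have "{f \<in> dipaths X x y. trace_of X f \<in> {a \<in> topspace (trace_space X x y). trace_map Y h a \<in> U}}
        = {f \<in> topspace (dipath_space X x y). (trace_of Y \<circ> ?H) f \<in> U}"
      using m by (auto simp: X.topspace_trace_space)
    moreover have "openin (dipath_space X x y) \<dots>" by (rule openin_continuous_map_preimage[OF c U])
    ultimately show "openin (trace_space X x y) {a \<in> topspace (trace_space X x y). trace_map Y h a \<in> U}"
      unfolding trace_space_def openin_quotient_topology by (auto simp: X.topspace_trace_space trace_space_def)
  qed
qed

section \<open>Homotopy groups\<close>

definition loop_homotopic ::
  "nat \<Rightarrow> 'a topology \<Rightarrow> 'a \<Rightarrow> ((nat \<Rightarrow> real) \<Rightarrow> 'a) \<Rightarrow> ((nat \<Rightarrow> real) \<Rightarrow> 'a) \<Rightarrow> bool" where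
  "loop_homotopic k T b = homotopic_with (\<lambda>\<sigma>. \<forall>t\<in>cube_boundary k. \<sigma> t = b) (cube k) T"

lemma in_cube_iff: "t \<in> topspace (cube k) \<longleftrightarrow> t \<in> extensional {..<k} \<and> (\<forall>i<k. t i \<in> {0..1})"
  by (auto simp: cube_def PiE_iff)

lemma continuous_map_cube_coord: "i < k \<Longrightarrow> continuous_map (cube k) (top_of_set {0..1}) (\<lambda>t. t i)"
  unfolding cube_def by (rule continuous_map_product_projection) simp

lemma continuous_map_cube_update:
  assumes "continuous_map Z (cube k) F" "continuous_map Z (top_of_set {0..1}) u" "0 < k"
  shows "continuous_map Z (cube k) (\<lambda>z. (F z)(0 := u z))"
  using assms unfolding cube_def continuous_map_componentwise
  by (auto simp: extensional_def)

lemma cube_update: "\<lbrakk>t \<in> topspace (cube k); s \<in> {0..1}; 0 < k\<rbrakk> \<Longrightarrow> t(0 := s) \<in> topspace (cube k)"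
  by (auto simp: in_cube_iff extensional_def)

lemma cube_boundary_update_end: "\<lbrakk>t \<in> topspace (cube k); s = 0 \<or> s = 1; 0 < k\<rbrakk> \<Longrightarrow> t(0 := s) \<in> cube_boundary k"
  unfolding cube_boundary_def by (intro CollectI conjI cube_update) auto

lemma cube_boundary_subset: "t \<in> cube_boundary k \<Longrightarrow> t \<in> topspace (cube k)"
  by (simp add: cube_boundary_def)

text \<open>The face containing \<open>t\<close> either belongs to another coordinate, which is left
  alone, or to coordinate 0, where the last hypothesis applies.\<close>

lemma cube_boundary_update:
  assumes "t \<in> cube_boundary k" "s \<in> {0..1}" "0 < k" "t 0 = 0 \<or> t 0 = 1 \<Longrightarrow> s = 0 \<or> s = 1"
  shows "t(0 := s) \<in> cube_boundary k"
proof -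
  obtain i where i: "i < k" "t i = 0 \<or> t i = 1" using assms(1) by (auto simp: cube_boundary_def)
  show ?thesis
  proof (cases "i = 0")
    case True
    then show ?thesis using assms i cube_boundary_update_end[OF cube_boundary_subset] by metis
  next
    case False
    then have "(t(0 := s)) i = 0 \<or> (t(0 := s)) i = 1" using i by simp
    then show ?thesis
      using cube_update[OF cube_boundary_subset[OF assms(1)] assms(2,3)] i(1) unfolding cube_boundary_def by blast
  qed
qed

lemma loop_homotopic_iff:
  "loop_homotopic k T b \<gamma> \<delta> \<longleftrightarrow>
    (\<exists>h. continuous_map (prod_topology (top_of_set {0..1::real}) (cube k)) T h \<and>
      (\<forall>t\<in>topspace (cube k). h (0, t) = \<gamma> t) \<and> (\<forall>t\<in>topspace (cube k). h (1, t) = \<delta> t) \<and>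
      (\<forall>s\<in>{0..1}. \<forall>t\<in>cube_boundary k. h (s, t) = b))"
  unfolding loop_homotopic_def by (subst homotopic_with) (simp_all add: cube_boundary_def)

lemma loop_homotopic_eq:
  assumes "loop_homotopic k T b \<gamma> \<delta>"
    and "\<And>t. t \<in> topspace (cube k) \<Longrightarrow> \<gamma>' t = \<gamma> t" "\<And>t. t \<in> topspace (cube k) \<Longrightarrow> \<delta>' t = \<delta> t"
  shows "loop_homotopic k T b \<gamma>' \<delta>'"
  using assms(1) unfolding loop_homotopic_def
  by (rule homotopic_with_eq) (auto simp: cube_boundary_def assms(2,3))

lemma loop_homotopic_refl: "loop_homotopic k T b \<gamma> \<gamma> \<longleftrightarrow> \<gamma> \<in> cube_loops k T b"
  by (auto simp: cube_loops_def loop_homotopic_def)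

text \<open>Loops are unconstrained off the cube, so pointwise laws can be expected only on it. This
  converts them into equalities of homotopy classes.\<close>

lemma loop_homotopic_on_cube:
  assumes "\<gamma> \<in> cube_loops k T b" "\<And>t. t \<in> topspace (cube k) \<Longrightarrow> \<delta> t = \<gamma> t"
  shows "loop_homotopic k T b \<delta> \<gamma>"
  by (rule loop_homotopic_eq[where \<gamma> = \<gamma> and \<delta> = \<gamma>]) (use assms in \<open>auto simp: loop_homotopic_refl\<close>)

lemma in_loop_class_iff: "\<delta> \<in> loop_class k T b \<gamma> \<longleftrightarrow> loop_homotopic k T b \<gamma> \<delta>"
  by (simp add: loop_class_def loop_homotopic_def)

lemma loop_class_eq: "loop_homotopic k T b \<gamma> \<delta> \<Longrightarrow> loop_class k T b \<gamma> = loop_class k T b \<delta>"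
  unfolding loop_class_def loop_homotopic_def using homotopic_with_trans homotopic_with_sym by blast

text \<open>The requirement that \<open>\<gamma>\<close> be a loop makes the class nonempty: for any
  other map the class, and with it the union, is empty.\<close>

lemma UN_loop_class:
  assumes "\<gamma> \<in> cube_loops k T b" "\<And>\<gamma>'. loop_homotopic k T b \<gamma> \<gamma>' \<Longrightarrow> H \<gamma>' = H \<gamma>"
  shows "(\<Union>\<gamma>\<in>loop_class k T b \<gamma>. H \<gamma>) = H \<gamma>"
proof -
  have "(\<Union>\<gamma>'\<in>loop_class k T b \<gamma>. H \<gamma>') = (\<Union>\<gamma>'\<in>loop_class k T b \<gamma>. H \<gamma>)"
    by (rule SUP_cong[OF refl], rule assms(2)) (simp add: in_loop_class_iff)
  moreover have "\<gamma> \<in> loop_class k T b \<gamma>" using assms(1) by (simp add: in_loop_class_iff loop_homotopic_refl)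
  ultimately show ?thesis by auto
qed

text \<open>The two loops may live in different spaces with different base points, as is the case
  for loops at two composable traces.\<close>

lemma UN_loop_class2:
  assumes "\<gamma> \<in> cube_loops k T b" "\<delta> \<in> cube_loops k S c"
    and "\<And>\<gamma>' \<delta>'. \<lbrakk>loop_homotopic k T b \<gamma> \<gamma>'; loop_homotopic k S c \<delta> \<delta>'\<rbrakk> \<Longrightarrow> H \<gamma>' \<delta>' = H \<gamma> \<delta>"
  shows "(\<Union>\<gamma>\<in>loop_class k T b \<gamma>. \<Union>\<delta>\<in>loop_class k S c \<delta>. H \<gamma> \<delta>) = H \<gamma> \<delta>"
proof -
  have r: "loop_homotopic k S c \<delta> \<delta>" using assms(2) by (simp add: loop_homotopic_refl)
  have "(\<Union>\<delta>\<in>loop_class k S c \<delta>. H \<gamma>' \<delta>) = H \<gamma> \<delta>" if g: "loop_homotopic k T b \<gamma> \<gamma>'" for \<gamma>'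
    using UN_loop_class[OF assms(2), of "H \<gamma>'"] assms(3)[OF g] assms(3)[OF g r] by simp
  moreover have "loop_homotopic k T b \<gamma> \<gamma>" using assms(1) by (simp add: loop_homotopic_refl)
  ultimately show ?thesis
    using UN_loop_class[OF assms(1), of "\<lambda>\<gamma>. \<Union>\<delta>\<in>loop_class k S c \<delta>. H \<gamma> \<delta>"] by simp
qed

lemma continuous_map_homotopy_compose:
  assumes "continuous_map (prod_topology (top_of_set {0..1::real}) (cube k)) T h" "0 < k"
    and "continuous_on {0..1} u" "u ` {0..1} \<subseteq> {0..1::real}"
  shows "continuous_map (prod_topology (top_of_set {0..1}) (cube k)) T (\<lambda>(s, t). h (s, t(0 := u (t 0))))"
proof -
  let ?Z = "prod_topology (top_of_set {0..1::real}) (cube k)"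
  have "continuous_map (top_of_set {0..1}) (top_of_set {0..1}) u" using assms(3,4) by (auto simp: continuous_map_in_subtopology)
  then have "continuous_map ?Z (top_of_set {0..1}) (u \<circ> ((\<lambda>t. t 0) \<circ> snd))"
    by (intro continuous_map_compose[OF continuous_map_compose[OF continuous_map_snd continuous_map_cube_coord]] assms(2))
  then have "continuous_map ?Z ?Z (\<lambda>z. (fst z, (snd z)(0 := (u \<circ> ((\<lambda>t. t 0) \<circ> snd)) z)))"
    by (intro continuous_map_pairedI continuous_map_fst continuous_map_cube_update continuous_map_snd assms(2))
  from continuous_map_compose[OF this assms(1)] show ?thesis
    by (simp add: o_def case_prod_unfold)
qed

lemma loop_homotopic_concat:
  assumes "loop_homotopic k T b \<gamma> \<gamma>'" "loop_homotopic k T b \<delta> \<delta>'" "0 < k"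
  shows "loop_homotopic k T b (loop_concat \<gamma> \<delta>) (loop_concat \<gamma>' \<delta>')"
proof -
  let ?Z = "prod_topology (top_of_set {0..1::real}) (cube k)"
  obtain A where A: "continuous_map ?Z T A" "\<And>t. t \<in> topspace (cube k) \<Longrightarrow> A (0, t) = \<gamma> t"
    "\<And>t. t \<in> topspace (cube k) \<Longrightarrow> A (1, t) = \<gamma>' t" "\<And>s t. \<lbrakk>s \<in> {0..1}; t \<in> cube_boundary k\<rbrakk> \<Longrightarrow> A (s, t) = b"
    using assms(1) unfolding loop_homotopic_iff by blast
  obtain B where B: "continuous_map ?Z T B" "\<And>t. t \<in> topspace (cube k) \<Longrightarrow> B (0, t) = \<delta> t"
    "\<And>t. t \<in> topspace (cube k) \<Longrightarrow> B (1, t) = \<delta>' t" "\<And>s t. \<lbrakk>s \<in> {0..1}; t \<in> cube_boundary k\<rbrakk> \<Longrightarrow> B (s, t) = b"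
    using assms(2) unfolding loop_homotopic_iff by blast
  \<comment> \<open>The clamps make both halves total continuous maps on the cylinder, as gluing
    along \<open>t 0 \<le> 1/2\<close> wants; on its own half each agrees with the corresponding
    half of the concatenation.\<close>
  define A' where "A' = (\<lambda>(s, t). A (s, t(0 := min 1 (2 * t 0))))"
  define B' where "B' = (\<lambda>(s, t). B (s, t(0 := max 0 (2 * t 0 - 1))))"
  define h where "h = (\<lambda>z. if snd z 0 \<le> 1/2 then A' z else B' z)"
  have A': "continuous_map ?Z T A'" unfolding A'_def
    by (rule continuous_map_homotopy_compose[OF A(1) assms(3), of "\<lambda>s. min 1 (2 * s)"])
      (auto intro!: continuous_intros)
  have B': "continuous_map ?Z T B'" unfolding B'_def
    by (rule continuous_map_homotopy_compose[OF B(1) assms(3), of "\<lambda>s. max 0 (2 * s - 1)"])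
      (auto intro!: continuous_intros)
  have "continuous_map ?Z (top_of_set {0..1}) ((\<lambda>t. t 0) \<circ> snd)"
    by (intro continuous_map_compose[OF continuous_map_snd continuous_map_cube_coord] assms)
  then have c: "continuous_map ?Z euclideanreal (\<lambda>z. snd z 0)"
    by (simp add: continuous_map_in_subtopology o_def)
  have "continuous_map ?Z T h" unfolding h_def
  proof (rule continuous_map_cases_le[OF c continuous_map_const[THEN iffD2]])
    \<comment> \<open>On the seam both maps are evaluated on a face of the cube, where both
      homotopies take the value \<open>b\<close>.\<close>
    fix z assume z: "z \<in> topspace ?Z" "snd z 0 = 1 / 2"
    then have "(snd z)(0 := 1) \<in> cube_boundary k" "(snd z)(0 := 0) \<in> cube_boundary k"
      using cube_boundary_update_end[OF _ _ assms(3)] by (auto simp: mem_Times_iff)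
    then show "A' z = B' z" using z A(4) B(4) by (auto simp: A'_def B'_def case_prod_unfold)
  qed (auto intro: continuous_map_from_subtopology A' B')
  moreover have h: "h (s, t) = loop_concat (\<lambda>t. A (s, t)) (\<lambda>t. B (s, t)) t" for s t
    by (auto simp: h_def A'_def B'_def loop_concat_def min_absorb2 max_absorb2)
  have "loop_concat (\<lambda>t. A (s, t)) (\<lambda>t. B (s, t)) t = loop_concat \<gamma>0 \<delta>0 t"
    if "t \<in> topspace (cube k)" "\<And>t. t \<in> topspace (cube k) \<Longrightarrow> A (s, t) = \<gamma>0 t"
      "\<And>t. t \<in> topspace (cube k) \<Longrightarrow> B (s, t) = \<delta>0 t" for s t \<gamma>0 \<delta>0
  proof -
    have t0: "t 0 \<in> {0..1}" using that(1) assms(3) by (simp add: in_cube_iff)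
    show ?thesis using t0 cube_update[OF that(1) _ assms(3)] by (simp add: loop_concat_def that(2,3))
  qed
  note ends = this
  have "h (s, t) = b" if "s \<in> {0..1}" "t \<in> cube_boundary k" for s t
  proof -
    have t0: "t 0 \<in> {0..1}" using that(2) assms(3) by (simp add: in_cube_iff cube_boundary_def)
    show ?thesis
    proof (cases "t 0 \<le> 1/2")
      case True
      then have "t(0 := 2 * t 0) \<in> cube_boundary k"
        using t0 by (intro cube_boundary_update[OF that(2) _ assms(3)]) auto
      then show ?thesis using True A(4)[OF that(1)] by (simp add: h loop_concat_def)
    next
      case False
      then have "t(0 := 2 * t 0 - 1) \<in> cube_boundary k"
        using t0 by (intro cube_boundary_update[OF that(2) _ assms(3)]) auto
      then show ?thesis using False B(4)[OF that(1)] by (simp add: h loop_concat_def)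
    qed
  qed
  ultimately show ?thesis
    unfolding loop_homotopic_iff using ends[OF _ A(2) B(2)] ends[OF _ A(3) B(3)] h
    by (intro exI[of _ h]) simp
qed

text \<open>Being a loop is the same as being homotopic to itself, so closure is the diagonal case
  of homotopy invariance.\<close>

lemma loop_concat_cube_loops:
  "\<lbrakk>\<gamma> \<in> cube_loops k T b; \<delta> \<in> cube_loops k T b; 0 < k\<rbrakk> \<Longrightarrow> loop_concat \<gamma> \<delta> \<in> cube_loops k T b"
  using loop_homotopic_concat[of k T b \<gamma> \<gamma> \<delta> \<delta>] by (simp add: loop_homotopic_refl)

lemma loop_homotopic_compose:
  assumes "continuous_map T S g" "loop_homotopic k T b \<gamma> \<gamma>'"
  shows "loop_homotopic k S (g b) (g \<circ> \<gamma>) (g \<circ> \<gamma>')"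
  unfolding loop_homotopic_def
  by (rule homotopic_with_compose_continuous_map_left[OF assms(2)[unfolded loop_homotopic_def] assms(1)]) simp

lemma loop_homotopic_pair:
  assumes "loop_homotopic k S a \<gamma> \<gamma>'" "loop_homotopic k T b \<delta> \<delta>'"
  shows "loop_homotopic k (prod_topology S T) (a, b) (\<lambda>t. (\<gamma> t, \<delta> t)) (\<lambda>t. (\<gamma>' t, \<delta>' t))"
proof -
  let ?Z = "prod_topology (top_of_set {0..1::real}) (cube k)"
  obtain A where A: "continuous_map ?Z S A" "\<forall>t\<in>topspace (cube k). A (0, t) = \<gamma> t"
    "\<forall>t\<in>topspace (cube k). A (1, t) = \<gamma>' t" "\<forall>s\<in>{0..1}. \<forall>t\<in>cube_boundary k. A (s, t) = a"
    using assms(1) unfolding loop_homotopic_iff by blast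
  obtain B where B: "continuous_map ?Z T B" "\<forall>t\<in>topspace (cube k). B (0, t) = \<delta> t"
    "\<forall>t\<in>topspace (cube k). B (1, t) = \<delta>' t" "\<forall>s\<in>{0..1}. \<forall>t\<in>cube_boundary k. B (s, t) = b"
    using assms(2) unfolding loop_homotopic_iff by blast
  have "continuous_map ?Z (prod_topology S T) (\<lambda>z. (A z, B z))"
    using A(1) B(1) by (simp add: continuous_map_pairedI)
  then show ?thesis unfolding loop_homotopic_iff
    using A(2-) B(2-) by (intro exI[of _ "\<lambda>z. (A z, B z)"]) simp
qed

text \<open>The homotopy is the straight line between \<open>\<phi>\<close> and
  \<open>\<psi>\<close> in coordinate 0, which stays in the interval by convexity. The endpoint
  values may be any of 0 and 1, so that reversal and folding are covered too.\<close>

lemma loop_homotopic_reparam: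
  assumes \<gamma>: "\<gamma> \<in> cube_loops k T b" and k: "0 < k"
    and \<phi>: "continuous_on {0..1} \<phi>" "\<And>s. s \<in> {0..1} \<Longrightarrow> \<phi> s \<in> {0..1::real}"
    and \<psi>: "continuous_on {0..1} \<psi>" "\<And>s. s \<in> {0..1} \<Longrightarrow> \<psi> s \<in> {0..1::real}"
    and e: "\<phi> 0 = \<psi> 0" "\<phi> 1 = \<psi> 1" "\<phi> 0 = 0 \<or> \<phi> 0 = 1" "\<phi> 1 = 0 \<or> \<phi> 1 = 1"
  shows "loop_homotopic k T b (\<lambda>t. \<gamma> (t(0 := \<phi> (t 0)))) (\<lambda>t. \<gamma> (t(0 := \<psi> (t 0))))"
proof -
  let ?Z = "prod_topology (top_of_set {0..1::real}) (cube k)"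
  let ?u = "\<lambda>(s, r). (1 - s) * \<phi> r + s * \<psi> r"
  have in01: "(1 - s) * \<phi> r + s * \<psi> r \<in> {0..1}" if "s \<in> {0..1}" "r \<in> {0..1}" for s r
    using that \<phi>(2)[of r] \<psi>(2)[of r] convexD[OF convex_closed_interval[of 0 "1::real"], of "\<phi> r" "\<psi> r" "1 - s" s]
    by auto
  have "continuous_on ({0..1} \<times> {0..1}) (\<lambda>z. \<phi> (snd z))" "continuous_on ({0..1} \<times> {0..1}) (\<lambda>z. \<psi> (snd z))"
    by (auto intro!: continuous_on_compose2[OF \<phi>(1)] continuous_on_compose2[OF \<psi>(1)] continuous_intros)
  then have "continuous_on ({0..1} \<times> {0..1}) ?u"
    unfolding case_prod_unfold by (intro continuous_intros)
  moreover have "?u \<in> {0..1} \<times> {0..1} \<rightarrow> {0..1}" using in01 by auto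
  ultimately have u: "continuous_map (prod_topology (top_of_set {0..1}) (top_of_set {0..1})) (top_of_set {0..1}) ?u"
    by (simp add: continuous_map_in_subtopology image_subset_iff_funcset flip: subtopology_Times euclidean_product_topology)
  have "continuous_map ?Z (prod_topology (top_of_set {0..1}) (top_of_set {0..1})) (\<lambda>z. (fst z, ((\<lambda>t. t 0) \<circ> snd) z))"
    by (intro continuous_map_pairedI continuous_map_fst continuous_map_compose[OF continuous_map_snd]
        continuous_map_cube_coord k)
  from continuous_map_compose[OF this u]
  have "continuous_map ?Z (cube k) (\<lambda>z. (snd z)(0 := (?u \<circ> (\<lambda>z. (fst z, ((\<lambda>t. t 0) \<circ> snd) z))) z))"
    by (intro continuous_map_cube_update continuous_map_snd k)
  then have "continuous_map ?Z T (\<gamma> \<circ> (\<lambda>z. (snd z)(0 := (?u \<circ> (\<lambda>z. (fst z, ((\<lambda>t. t 0) \<circ> snd) z))) z)))"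
    using \<gamma> by (intro continuous_map_compose) (auto simp: cube_loops_def)
  then have "continuous_map ?Z T (\<lambda>(s, t). \<gamma> (t(0 := (1 - s) * \<phi> (t 0) + s * \<psi> (t 0))))"
    by (simp add: o_def case_prod_unfold)
  moreover have "\<gamma> (t(0 := (1 - s) * \<phi> (t 0) + s * \<psi> (t 0))) = b" if "s \<in> {0..1}" "t \<in> cube_boundary k" for s t
  proof -
    have t0: "t 0 \<in> {0..1}" using that(2) k by (simp add: in_cube_iff cube_boundary_def)
    \<comment> \<open>On the faces of coordinate 0 the two maps agree, so the interpolation is
      stationary there and keeps the value 0 or 1.\<close>
    have "(1 - s) * \<psi> 0 + s * \<psi> 0 = \<psi> 0" "(1 - s) * \<psi> 1 + s * \<psi> 1 = \<psi> 1" by (simp_all add: algebra_simps)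
    then have "t(0 := (1 - s) * \<phi> (t 0) + s * \<psi> (t 0)) \<in> cube_boundary k"
      using e by (intro cube_boundary_update[OF that(2) in01[OF that(1) t0] k]) auto
    then show ?thesis using \<gamma> by (simp add: cube_loops_def)
  qed
  ultimately show ?thesis unfolding loop_homotopic_iff
    by (intro exI[of _ "\<lambda>(s, t). \<gamma> (t(0 := (1 - s) * \<phi> (t 0) + s * \<psi> (t 0)))"]) simp
qed

section \<open>Group laws for loops up to homotopy\<close>

lemma loop_reverse_cube_loops:
  assumes "\<gamma> \<in> cube_loops k T b" "0 < k"
  shows "(\<lambda>t. \<gamma> (t(0 := 1 - t 0))) \<in> cube_loops k T b"
proof -
  have "loop_homotopic k T b (\<lambda>t. \<gamma> (t(0 := 1 - t 0))) (\<lambda>t. \<gamma> (t(0 := 1 - t 0)))"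
    by (rule loop_homotopic_reparam[OF assms, of "\<lambda>s. 1 - s" "\<lambda>s. 1 - s"]) (auto intro!: continuous_intros)
  then show ?thesis by (simp only: loop_homotopic_refl)
qed

lemma const_cube_loops: "b \<in> topspace T \<Longrightarrow> (\<lambda>_. b) \<in> cube_loops k T b"
  by (simp add: cube_loops_def)

lemma cube_loops_end: "\<lbrakk>\<gamma> \<in> cube_loops k T b; t \<in> topspace (cube k); s = 0 \<or> s = 1; 0 < k\<rbrakk> \<Longrightarrow> \<gamma> (t(0 := s)) = b"
  using cube_boundary_update_end by (auto simp: cube_loops_def)

lemma loop_concat_const_left:
  assumes \<gamma>: "\<gamma> \<in> cube_loops k T b" and k: "0 < k"
  shows "loop_homotopic k T b (loop_concat (\<lambda>_. b) \<gamma>) \<gamma>"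
proof (rule loop_homotopic_eq)
  show "loop_homotopic k T b (\<lambda>t. \<gamma> (t(0 := max 0 (2 * t 0 - 1)))) (\<lambda>t. \<gamma> (t(0 := t 0)))"
    by (rule loop_homotopic_reparam[OF \<gamma> k, of "\<lambda>s. max 0 (2 * s - 1)" "\<lambda>s. s"]) (auto intro!: continuous_intros)
  fix t assume t: "t \<in> topspace (cube k)"
  show "loop_concat (\<lambda>_. b) \<gamma> t = \<gamma> (t(0 := max 0 (2 * t 0 - 1)))"
    using cube_loops_end[OF \<gamma> t _ k] by (simp add: loop_concat_def max_def)
qed simp

lemma loop_concat_assoc:
  assumes "\<gamma> \<in> cube_loops k T b" "\<delta> \<in> cube_loops k T b" "\<epsilon> \<in> cube_loops k T b" and k: "0 < k"
  shows "loop_homotopic k T b (loop_concat (loop_concat \<gamma> \<delta>) \<epsilon>) (loop_concat \<gamma> (loop_concat \<delta> \<epsilon>))"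
proof (rule loop_homotopic_eq)
  \<comment> \<open>The same concave change of parameter as for associativity of traces, now acting
    on a cube coordinate. It is homotopic to the identity with fixed ends.\<close>
  let ?\<phi> = "\<lambda>s::real. min (2 * s) (min (s + 1/4) (s / 2 + 1/2))"
  let ?\<kappa> = "loop_concat \<gamma> (loop_concat \<delta> \<epsilon>)"
  have "?\<kappa> \<in> cube_loops k T b" using assms by (simp add: loop_concat_cube_loops)
  then show "loop_homotopic k T b (\<lambda>t. ?\<kappa> (t(0 := ?\<phi> (t 0)))) (\<lambda>t. ?\<kappa> (t(0 := t 0)))"
    by (rule loop_homotopic_reparam[OF _ k, of _ _ _ ?\<phi> "\<lambda>s. s"]) (auto intro!: continuous_intros)
  fix t assume "t \<in> topspace (cube k)"
  consider "t 0 \<le> 1/4" | "1/4 < t 0" "t 0 \<le> 1/2" | "1/2 < t 0" by linarith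
  then show "loop_concat (loop_concat \<gamma> \<delta>) \<epsilon> t = ?\<kappa> (t(0 := ?\<phi> (t 0)))"
  proof cases
    case 1
    then have "?\<phi> (t 0) = 2 * t 0" by auto
    then show ?thesis using 1 by (simp add: loop_concat_def)
  next
    case 2
    then have "?\<phi> (t 0) = t 0 + 1/4" by auto
    then show ?thesis using 2 by (simp add: loop_concat_def algebra_simps)
  next
    case 3
    then have "?\<phi> (t 0) = t 0 / 2 + 1/2" by auto
    then show ?thesis using 3 by (simp add: loop_concat_def algebra_simps)
  qed
qed simp

lemma loop_concat_reverse:
  assumes \<gamma>: "\<gamma> \<in> cube_loops k T b" and k: "0 < k"
  shows "loop_homotopic k T b (loop_concat (\<lambda>t. \<gamma> (t(0 := 1 - t 0))) \<gamma>) (\<lambda>_. b)"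
proof (rule loop_homotopic_eq)
  \<comment> \<open>The fold runs from 1 down to 0 and back, tracing the reverse of
    \<open>\<gamma>\<close> and then \<open>\<gamma>\<close>. It has the same ends as the constant
    1, at which \<open>\<gamma>\<close> sits on a face and equals \<open>b\<close>.\<close>
  show "loop_homotopic k T b (\<lambda>t. \<gamma> (t(0 := \<bar>1 - 2 * t 0\<bar>))) (\<lambda>t. \<gamma> (t(0 := 1)))"
    by (rule loop_homotopic_reparam[OF \<gamma> k, of "\<lambda>s. \<bar>1 - 2 * s\<bar>" "\<lambda>s. 1"]) (auto intro!: continuous_intros)
  fix t assume t: "t \<in> topspace (cube k)"
  show "b = \<gamma> (t(0 := 1))" using cube_loops_end[OF \<gamma> t _ k] by simp
  show "loop_concat (\<lambda>t. \<gamma> (t(0 := 1 - t 0))) \<gamma> t = \<gamma> (t(0 := \<bar>1 - 2 * t 0\<bar>))"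
    by (simp add: loop_concat_def)
qed

lemma homotopy_group_mult:
  assumes "\<gamma> \<in> cube_loops k T b" "\<delta> \<in> cube_loops k T b" "0 < k"
  shows "loop_class k T b \<gamma> \<otimes>\<^bsub>homotopy_group k T b\<^esub> loop_class k T b \<delta> = loop_class k T b (loop_concat \<gamma> \<delta>)"
  unfolding homotopy_group_def monoid.simps
  by (rule UN_loop_class2[OF assms(1,2)], rule loop_class_eq[symmetric], rule loop_homotopic_concat[OF _ _ assms(3)])

text \<open>\<open>groupI\<close> derives the right-hand laws, so a left unit and left inverses are
  supplied together with associativity.\<close>

lemma group_homotopy_group:
  assumes b: "b \<in> topspace T" and k: "0 < k"
  shows "group (homotopy_group k T b)"
proof (rule groupI)
  let ?G = "homotopy_group k T b"
  have one: "\<one>\<^bsub>?G\<^esub> = loop_class k T b (\<lambda>_. b)" and carrier: "carrier ?G = loop_class k T b ` cube_loops k T b"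
    by (simp_all add: homotopy_group_def)
  note simps = one carrier homotopy_group_mult[OF _ _ k] loop_concat_cube_loops[OF _ _ k]
  show "\<one>\<^bsub>?G\<^esub> \<in> carrier ?G" using const_cube_loops[OF b] by (auto simp: simps)
  fix x assume "x \<in> carrier ?G"
  then obtain \<gamma> where \<gamma>: "\<gamma> \<in> cube_loops k T b" "x = loop_class k T b \<gamma>" by (auto simp: simps)
  show "\<one>\<^bsub>?G\<^esub> \<otimes>\<^bsub>?G\<^esub> x = x"
    using loop_class_eq[OF loop_concat_const_left[OF \<gamma>(1) k]] \<gamma> const_cube_loops[OF b] by (simp add: simps)
  show "\<exists>y\<in>carrier ?G. y \<otimes>\<^bsub>?G\<^esub> x = \<one>\<^bsub>?G\<^esub>"
    using loop_class_eq[OF loop_concat_reverse[OF \<gamma>(1) k]] loop_reverse_cube_loops[OF \<gamma>(1) k] \<gamma> by (auto simp: simps)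
  fix y assume "y \<in> carrier ?G"
  then obtain \<delta> where \<delta>: "\<delta> \<in> cube_loops k T b" "y = loop_class k T b \<delta>" by (auto simp: simps)
  show "x \<otimes>\<^bsub>?G\<^esub> y \<in> carrier ?G" using \<gamma> \<delta> by (simp add: simps)
  fix z assume "z \<in> carrier ?G"
  then obtain \<epsilon> where \<epsilon>: "\<epsilon> \<in> cube_loops k T b" "z = loop_class k T b \<epsilon>" by (auto simp: simps)
  show "x \<otimes>\<^bsub>?G\<^esub> y \<otimes>\<^bsub>?G\<^esub> z = x \<otimes>\<^bsub>?G\<^esub> (y \<otimes>\<^bsub>?G\<^esub> z)"
    using loop_class_eq[OF loop_concat_assoc[OF \<gamma>(1) \<delta>(1) \<epsilon>(1) k]] \<gamma> \<delta> \<epsilon> by (simp add: simps)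
qed

section \<open>Categories over the trace category\<close>

lemma trace_category_simps [simp]:
  "Ob (trace_category X) = topspace (spc X)"
  "Ar (trace_category X) = traces X"
  "f \<in> traces X \<Longrightarrow> src (trace_category X) f = trace_src f"
  "f \<in> traces X \<Longrightarrow> tgt (trace_category X) f = trace_tgt f"
  "x \<in> topspace (spc X) \<Longrightarrow> idt (trace_category X) x = trace_of X (const_path x)"
  "\<lbrakk>f \<in> traces X; g \<in> traces X; trace_tgt f = trace_src g\<rbrakk> \<Longrightarrow> cmp (trace_category X) f g = trace_concat X f g"
  by (simp_all add: trace_category_def)

lemma Ar_Cat_iff:
  "(C, (Fo, Fa), D) \<in> Ar Cat \<longleftrightarrow> is_functor C D Fo Fa \<and> Fo \<in> extensional (Ob C) \<and> Fa \<in> extensional (Ar C)"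
  by (simp add: Cat_def)

lemma Cat_simps:
  "Ob Cat = {C. category C}"
  "F \<in> Ar Cat \<Longrightarrow> src Cat F = fst F"
  "F \<in> Ar Cat \<Longrightarrow> tgt Cat F = snd (snd F)"
  "category C \<Longrightarrow> idt Cat C = (C, (\<lambda>x\<in>Ob C. x, \<lambda>f\<in>Ar C. f), C)"
  "\<lbrakk>(C, (Fo, Fa), D) \<in> Ar Cat; (D, (Go, Ga), E) \<in> Ar Cat\<rbrakk> \<Longrightarrow>
    cmp Cat (C, (Fo, Fa), D) (D, (Go, Ga), E) = (C, (restrict (Go \<circ> Fo) (Ob C), restrict (Ga \<circ> Fa) (Ar C)), E)"
  by (simp_all add: Cat_def)

lemma dTop_simps:
  "Ob dTop = {X. dispace X}"
  "F \<in> Ar dTop \<Longrightarrow> src dTop F = fst F"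
  "F \<in> Ar dTop \<Longrightarrow> tgt dTop F = snd (snd F)"
  "dispace X \<Longrightarrow> idt dTop X = (X, \<lambda>x\<in>topspace (spc X). x, X)"
  "\<lbrakk>(X, h, Y) \<in> Ar dTop; (Y, k, Z) \<in> Ar dTop\<rbrakk> \<Longrightarrow>
    cmp dTop (X, h, Y) (Y, k, Z) = (X, restrict (k \<circ> h) (topspace (spc X)), Z)"
  by (simp_all add: dTop_def)

lemma (in dispace) const_trace:
  assumes "x \<in> topspace (spc X)"
  shows "trace_of X (const_path x) \<in> traces X" "trace_src (trace_of X (const_path x)) = x"
    "trace_tgt (trace_of X (const_path x)) = x"
  using dip_const[OF assms] by auto

text \<open>Source and target are read off the first component. The second agrees because both
  components lie over one arrow of \<open>B\<close> and the projections are the identity on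
  objects.\<close>

lemma category_fibre_product:
  assumes "over_object B C p" "over_object B D q"
  shows "category (fibre_product C p D q)"
proof -
  interpret C: is_functor C B "\<lambda>x. x" p using assms(1) by (simp add: over_object_def)
  interpret D: is_functor D B "\<lambda>x. x" q using assms(2) by (simp add: over_object_def)
  have Ob: "Ob D = Ob B" "Ob C = Ob B" using assms by (simp_all add: over_object_def)
  have st: "src D d = src C c" "tgt D d = tgt C c" if "c \<in> Ar C" "d \<in> Ar D" "p c = q d" for c d
    using that C.src_map D.src_map C.tgt_map D.tgt_map by metis+
  have ids: "cmp D (idt D (src C c)) d = d" "cmp D d (idt D (tgt C c)) = d"
    if "c \<in> Ar C" "d \<in> Ar D" "p c = q d" for c d
    using D.C.idt_left[OF that(2)] D.C.idt_right[OF that(2)] by (simp_all add: st[OF that])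
  show ?thesis
    unfolding fibre_product_def
    by (rule category_mk_cat)
      (auto simp: st ids C.C.src_in[unfolded Ob] C.C.tgt_in[unfolded Ob] C.C.idt_in C.C.src_idt C.C.tgt_idt C.C.cmp_in C.C.src_cmp C.C.tgt_cmp
        C.C.idt_left C.C.idt_right C.C.assoc D.C.idt_in D.C.cmp_in Ob C.idt_map D.idt_map C.cmp_map D.cmp_map
        D.C.assoc)
qed

text \<open>\<open>e X f\<close> is the base point of \<open>K X f\<close>, the operation \<open>m X f g\<close> lies over the concatenation of \<open>f\<close> and
  \<open>g\<close>, and \<open>N X h Y f\<close> is the map which a morphism \<open>h\<close> from \<open>X\<close> to \<open>Y\<close> induces at \<open>f\<close>.\<close>

locale trace_system =
  fixes K :: "'a dispace \<Rightarrow> 'a trace \<Rightarrow> 'c set"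
    and e :: "'a dispace \<Rightarrow> 'a trace \<Rightarrow> 'c"
    and m :: "'a dispace \<Rightarrow> 'a trace \<Rightarrow> 'a trace \<Rightarrow> 'c \<Rightarrow> 'c \<Rightarrow> 'c"
    and N :: "'a dispace \<Rightarrow> ('a \<Rightarrow> 'a) \<Rightarrow> 'a dispace \<Rightarrow> 'a trace \<Rightarrow> 'c \<Rightarrow> 'c"
  assumes e_in: "\<lbrakk>dispace X; f \<in> traces X\<rbrakk> \<Longrightarrow> e X f \<in> K X f"
    and m_in: "\<lbrakk>dispace X; f \<in> traces X; g \<in> traces X; trace_tgt f = trace_src g; c \<in> K X f; d \<in> K X g\<rbrakk>
      \<Longrightarrow> m X f g c d \<in> K X (trace_concat X f g)"
    and m_e: "\<lbrakk>dispace X; f \<in> traces X; g \<in> traces X; trace_tgt f = trace_src g\<rbrakk>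
      \<Longrightarrow> m X f g (e X f) (e X g) = e X (trace_concat X f g)"
    and m_left: "\<lbrakk>dispace X; f \<in> traces X; c \<in> K X f\<rbrakk>
      \<Longrightarrow> m X (trace_of X (const_path (trace_src f))) f (e X (trace_of X (const_path (trace_src f)))) c = c"
    and m_right: "\<lbrakk>dispace X; f \<in> traces X; c \<in> K X f\<rbrakk>
      \<Longrightarrow> m X f (trace_of X (const_path (trace_tgt f))) c (e X (trace_of X (const_path (trace_tgt f)))) = c"
    and m_assoc: "\<lbrakk>dispace X; f \<in> traces X; g \<in> traces X; j \<in> traces X; trace_tgt f = trace_src g;
        trace_tgt g = trace_src j; a \<in> K X f; b \<in> K X g; c \<in> K X j\<rbrakk>
      \<Longrightarrow> m X (trace_concat X f g) j (m X f g a b) c = m X f (trace_concat X g j) a (m X g j b c)"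
    and N_in: "\<lbrakk>dispace X; dispace Y; dimap X Y h; f \<in> traces X; c \<in> K X f\<rbrakk>
      \<Longrightarrow> N X h Y f c \<in> K Y (trace_map Y h f)"
    and N_e: "\<lbrakk>dispace X; dispace Y; dimap X Y h; f \<in> traces X\<rbrakk> \<Longrightarrow> N X h Y f (e X f) = e Y (trace_map Y h f)"
    and N_m: "\<lbrakk>dispace X; dispace Y; dimap X Y h; f \<in> traces X; g \<in> traces X; trace_tgt f = trace_src g;
        c \<in> K X f; d \<in> K X g\<rbrakk>
      \<Longrightarrow> N X h Y (trace_concat X f g) (m X f g c d) = m Y (trace_map Y h f) (trace_map Y h g) (N X h Y f c) (N X h Y g d)"
    and N_id: "\<lbrakk>dispace X; f \<in> traces X; c \<in> K X f\<rbrakk> \<Longrightarrow> N X (\<lambda>x\<in>topspace (spc X). x) X f c = c"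
    and N_comp: "\<lbrakk>dispace X; dispace Y; dispace Z; dimap X Y h; dimap Y Z k; f \<in> traces X; c \<in> K X f\<rbrakk>
      \<Longrightarrow> N X (restrict (k \<circ> h) (topspace (spc X))) Z f c = N Y k Z (trace_map Y h f) (N X h Y f c)"
begin

text \<open>The total category of the displayed category over the traces whose fibre over
  \<open>f\<close> is \<open>K X f\<close>.\<close>

definition total_cat :: "'a dispace \<Rightarrow> ('a, 'a trace \<times> 'c) cat" where
  "total_cat X = mk_cat (topspace (spc X)) {(f, c). f \<in> traces X \<and> c \<in> K X f}
    (\<lambda>(f, c). trace_src f) (\<lambda>(f, c). trace_tgt f)
    (\<lambda>x. (trace_of X (const_path x), e X (trace_of X (const_path x))))
    (\<lambda>(f, c) (g, d). (trace_concat X f g, m X f g c d))"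

text \<open>Only the action on arrows needs restricting: an arrow of \<open>dTop\<close> already
  carries a map that is extensional on the points.\<close>

definition total_functor ::
  "'a dispace \<times> ('a \<Rightarrow> 'a) \<times> 'a dispace \<Rightarrow> ('a, 'a trace \<times> 'c) cat_arrow" where
  "total_functor = (\<lambda>(X, h, Y).
    (total_cat X, (h, restrict (induced_action N X h Y) (Ar (total_cat X))), total_cat Y))"

lemma total_cat_simps [simp]:
  "Ob (total_cat X) = topspace (spc X)"
  "(f, c) \<in> Ar (total_cat X) \<longleftrightarrow> f \<in> traces X \<and> c \<in> K X f"
  "\<lbrakk>f \<in> traces X; c \<in> K X f\<rbrakk> \<Longrightarrow> src (total_cat X) (f, c) = trace_src f"
  "\<lbrakk>f \<in> traces X; c \<in> K X f\<rbrakk> \<Longrightarrow> tgt (total_cat X) (f, c) = trace_tgt f"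
  "x \<in> topspace (spc X) \<Longrightarrow> idt (total_cat X) x = (trace_of X (const_path x), e X (trace_of X (const_path x)))"
  "\<lbrakk>f \<in> traces X; c \<in> K X f; g \<in> traces X; d \<in> K X g; trace_tgt f = trace_src g\<rbrakk>
    \<Longrightarrow> cmp (total_cat X) (f, c) (g, d) = (trace_concat X f g, m X f g c d)"
  by (simp_all add: total_cat_def)

lemma category_total_cat:
  assumes X: "dispace X" shows "category (total_cat X)"
proof -
  interpret X: dispace X by fact
  show ?thesis
    unfolding total_cat_def
  proof (rule category_mk_cat, goal_cases)
    case (1 f) then show ?case by (auto simp: X.dip_in_topspace)
  next
    case (2 f) then show ?case by (auto simp: X.dip_in_topspace)
  next
    case (3 x) then show ?case using X.const_trace e_in[OF X] by simp
  next
    case (4 x) then show ?case using X.const_trace by simp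
  next
    case (5 x) then show ?case using X.const_trace by simp
  next
    case (6 f g) then show ?case
      by (clarsimp simp only: mem_Collect_eq prod.case split_paired_all) (simp add: X.trace_concat_in m_in[OF X])
  next
    case (7 f g) then show ?case
      by (clarsimp simp only: mem_Collect_eq prod.case split_paired_all) (simp add: X.trace_concat_in)
  next
    case (8 f g) then show ?case
      by (clarsimp simp only: mem_Collect_eq prod.case split_paired_all) (simp add: X.trace_concat_in)
  next
    case (9 p)
    then obtain f c where p: "p = (f, c)" and *: "f \<in> traces X" "c \<in> K X f" by blast
    show ?case unfolding p by (simp add: X.trace_concat_id[OF *(1)] m_left[OF X *])
  next
    case (10 p)
    then obtain f c where p: "p = (f, c)" and *: "f \<in> traces X" "c \<in> K X f" by blast
    show ?case unfolding p by (simp add: X.trace_concat_id[OF *(1)] m_right[OF X *])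
  next
    case (11 f g h) then show ?case
      by (clarsimp simp only: mem_Collect_eq prod.case split_paired_all) (simp add: X.trace_concat_assoc m_assoc[OF X])
  qed
qed

lemma over_object_total_cat:
  assumes X: "dispace X" shows "over_object (trace_category X) (total_cat X) fst"
proof -
  interpret X: dispace X by fact
  show ?thesis
    unfolding over_object_def
    by (intro conjI is_functor.intro is_functor_axioms.intro category_total_cat X X.category_trace_category)
      auto
qed

text \<open>Identities of \<open>total_cat\<close> are base points by construction, and
  \<open>m_e\<close> says that base points compose to base points.\<close>

lemma is_functor_section:
  assumes X: "dispace X" shows "is_functor (trace_category X) (total_cat X) (\<lambda>x. x) (\<lambda>f. (f, e X f))"
proof -
  interpret X: dispace X by fact
  show ?thesis
  proof (intro is_functor.intro is_functor_axioms.intro category_total_cat X X.category_trace_category, goal_cases)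
    case (6 f g) then show ?case using e_in[OF X] m_e[OF X] by simp
  qed (use e_in[OF X] in simp_all)
qed

lemma split_object_total_cat:
  "dispace X \<Longrightarrow> split_object (trace_category X) (total_cat X) fst (\<lambda>f. (f, e X f))"
  by (simp add: split_object_def over_object_total_cat is_functor_section)

lemma fibre_total_cat: "f \<in> traces X \<Longrightarrow> fibre (total_cat X) fst f = Pair f ` K X f"
  by (auto simp: fibre_def)

lemma is_functor_induced_action:
  assumes XY: "dispace X" "dispace Y" and h: "dimap X Y h"
  shows "is_functor (total_cat X) (total_cat Y) h (induced_action N X h Y)"
proof -
  interpret X: dispace X by fact
  interpret Y: dispace Y by fact
  note tm = trace_map_in[OF XY h]
  show ?thesis
  proof (intro is_functor.intro is_functor_axioms.intro category_total_cat XY, goal_cases)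
    case (1 x) then show ?case using h by (auto simp: dimap_def continuous_map_def)
  next
    case (2 f) then show ?case
      by (cases f) (simp add: induced_action_def tm N_in[OF XY h])
  next
    case (3 f) then show ?case
      by (cases f) (simp add: induced_action_def tm N_in[OF XY h])
  next
    case (4 f) then show ?case
      by (cases f) (simp add: induced_action_def tm N_in[OF XY h])
  next
    case (5 x)
    then have "h x \<in> topspace (spc Y)" using h by (auto simp: dimap_def continuous_map_def)
    then show ?case
      using 5 X.const_trace[of x] N_e[OF XY h, of "trace_of X (const_path x)"] trace_map_const[OF XY h, of x]
      by (simp add: induced_action_def)
  next
    case (6 p q)
    obtain f c g d where "p = (f, c)" "q = (g, d)" by fastforce
    with 6 have *: "f \<in> traces X" "c \<in> K X f" "g \<in> traces X" "d \<in> K X g" "trace_tgt f = trace_src g" by auto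
    show ?case
      using * tm[OF *(1)] tm[OF *(3)] N_in[OF XY h] trace_map_concat[OF XY h *(1,3,5)] N_m[OF XY h *(1,3,5,2,4)]
      by (simp add: \<open>p = _\<close> \<open>q = _\<close> induced_action_def)
  qed
qed

lemma total_functor_in:
  assumes "(X, h, Y) \<in> Ar dTop" shows "total_functor (X, h, Y) \<in> Ar Cat"
  using assms is_functor_induced_action
  by (auto simp: total_functor_def Ar_Cat_iff Ar_dTop_iff intro!: is_functor_cong[OF is_functor_induced_action])

lemma is_functor_total_functor: "is_functor dTop Cat total_cat total_functor"
proof (intro is_functor.intro is_functor_axioms.intro category_dTop category_Cat, goal_cases)
  case (1 X) then show ?case by (simp add: dTop_simps Cat_simps category_total_cat)
next
  case (2 f) then show ?case by (cases f) (simp add: total_functor_in)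
next
  case (3 f) then show ?case
    by (cases f) (simp add: total_functor_in dTop_simps Cat_simps, simp add: total_functor_def)
next
  case (4 f) then show ?case
    by (cases f) (simp add: total_functor_in dTop_simps Cat_simps, simp add: total_functor_def)
next
  case (5 X)
  then have X: "dispace X" by (simp add: dTop_simps)
  have "restrict (induced_action N X (\<lambda>x\<in>topspace (spc X). x) X) (Ar (total_cat X)) = (\<lambda>f\<in>Ar (total_cat X). f)"
    by (rule restrict_ext) (auto simp: induced_action_def trace_map_id[OF X] N_id[OF X])
  then show ?case using X by (simp add: dTop_simps Cat_simps category_total_cat total_functor_def)
next
  case (6 p q)
  obtain X h Y Y' k Z where pq: "p = (X, h, Y)" "q = (Y', k, Z)" by (metis prod_cases3)
  have "Y' = Y" using 6 by (simp add: pq dTop_simps)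
  note pq = pq[unfolded this]
  have a: "(X, h, Y) \<in> Ar dTop" "(Y, k, Z) \<in> Ar dTop" using 6 by (simp_all add: pq)
  then have d: "dispace X" "dispace Y" "dispace Z" "dimap X Y h" "dimap Y Z k" by (simp_all add: Ar_dTop_iff)
  have "restrict (induced_action N X (restrict (k \<circ> h) (topspace (spc X))) Z) (Ar (total_cat X))
    = restrict (restrict (induced_action N Y k Z) (Ar (total_cat Y)) \<circ> restrict (induced_action N X h Y) (Ar (total_cat X)))
        (Ar (total_cat X))"
    by (rule restrict_ext)
      (auto simp: induced_action_def trace_map_comp[OF d] N_comp[OF d] N_in[OF d(1,2,4)] trace_map_in[OF d(1,2,4)])
  then show ?case
    using Cat_simps(5)[OF total_functor_in[OF a(1), unfolded total_functor_def prod.case]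
        total_functor_in[OF a(2), unfolded total_functor_def prod.case]]
    by (simp add: pq dTop_simps(5)[OF a] total_functor_def)
qed

text \<open>The parameter \<open>P\<close> lets the conclusion match \<open>nat_htpy0\<close> and
  \<open>nat_htpy1\<close>, which deliver the fibre and its base point as a pair.\<close>

lemma split_realization:
  assumes P: "\<And>X f. \<lbrakk>dispace X; f \<in> traces X\<rbrakk> \<Longrightarrow> P X f = (K X f, e X f)"
  shows "\<exists>C p \<epsilon> F.
      (\<forall>X. dispace X \<longrightarrow>
         split_object (trace_category X) (C X) (p X) (\<epsilon> X) \<and>
         (\<forall>f \<in> Ar (trace_category X). pointed_iso (Pair f) (P X f) (fibre (C X) (p X) f, \<epsilon> X f))) \<and>
      is_functor dTop Cat C F \<and>
      (\<forall>X h Y. (X, h, Y) \<in> Ar dTop \<longrightarrow>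
         F (X, h, Y) = (C X, (h, restrict (induced_action N X h Y) (Ar (C X))), C Y))"
proof (intro exI conjI allI impI ballI)
  fix X :: "'a dispace" assume X: "dispace X"
  show "split_object (trace_category X) (total_cat X) fst (\<lambda>f. (f, e X f))" by (rule split_object_total_cat[OF X])
  fix f assume "f \<in> Ar (trace_category X)"
  then have f: "f \<in> traces X" by simp
  show "pointed_iso (Pair f) (P X f) (fibre (total_cat X) fst f, (f, e X f))"
    by (auto simp: pointed_iso_def P[OF X f] fibre_total_cat[OF f] bij_betw_def inj_on_def)
qed (use is_functor_total_functor in \<open>auto simp: total_functor_def\<close>)

end

text \<open>\<open>interchange\<close> says that each pairing is a homomorphism out of a product of
  groups. Read in the total category, it is exactly compatibility of the multiplication with
  composition.\<close>

locale trace_group_system =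
  trace_system "\<lambda>X f. carrier (G X f)" "\<lambda>X f. \<one>\<^bsub>G X f\<^esub>" m N
  for G :: "'a dispace \<Rightarrow> 'a trace \<Rightarrow> 'c monoid" and m N +
  assumes group: "\<lbrakk>dispace X; f \<in> traces X\<rbrakk> \<Longrightarrow> group (G X f)"
    and interchange: "\<lbrakk>dispace X; f \<in> traces X; g \<in> traces X; trace_tgt f = trace_src g;
        c \<in> carrier (G X f); c' \<in> carrier (G X f); d \<in> carrier (G X g); d' \<in> carrier (G X g)\<rbrakk>
      \<Longrightarrow> m X f g (c \<otimes>\<^bsub>G X f\<^esub> c') (d \<otimes>\<^bsub>G X g\<^esub> d')
        = m X f g c d \<otimes>\<^bsub>G X (trace_concat X f g)\<^esub> m X f g c' d'"
begin

definition total_mult :: "'a dispace \<Rightarrow> ('a trace \<times> 'c) \<times> ('a trace \<times> 'c) \<Rightarrow> 'a trace \<times> 'c" where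
  "total_mult X = (\<lambda>((f, c), (g, d)). (f, c \<otimes>\<^bsub>G X f\<^esub> d))"

definition total_inv :: "'a dispace \<Rightarrow> 'a trace \<times> 'c \<Rightarrow> 'a trace \<times> 'c" where
  "total_inv X = (\<lambda>(f, c). (f, inv\<^bsub>G X f\<^esub> c))"

text \<open>Homomorphisms preserve inverses: by \<open>interchange\<close> and \<open>m_e\<close>
  the left-hand side is a left inverse of \<open>m X f g c d\<close>.\<close>

lemma m_inv:
  assumes X: "dispace X" and fg: "f \<in> traces X" "g \<in> traces X" "trace_tgt f = trace_src g"
    and cd: "c \<in> carrier (G X f)" "d \<in> carrier (G X g)"
  shows "m X f g (inv\<^bsub>G X f\<^esub> c) (inv\<^bsub>G X g\<^esub> d) = inv\<^bsub>G X (trace_concat X f g)\<^esub> (m X f g c d)"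
proof -
  interpret X: dispace X by fact
  interpret F: group "G X f" by (rule group[OF X fg(1)])
  interpret G: group "G X g" by (rule group[OF X fg(2)])
  interpret FG: group "G X (trace_concat X f g)" by (rule group[OF X X.trace_concat_in(1)[OF fg]])
  have "m X f g (inv\<^bsub>G X f\<^esub> c) (inv\<^bsub>G X g\<^esub> d) \<otimes>\<^bsub>G X (trace_concat X f g)\<^esub> m X f g c d
      = m X f g (inv\<^bsub>G X f\<^esub> c \<otimes>\<^bsub>G X f\<^esub> c) (inv\<^bsub>G X g\<^esub> d \<otimes>\<^bsub>G X g\<^esub> d)"
    using cd by (subst interchange[OF X fg]) simp_all
  also have "\<dots> = \<one>\<^bsub>G X (trace_concat X f g)\<^esub>" using cd by (simp add: m_e[OF X fg])
  finally show ?thesis using cd by (simp add: FG.inv_equality m_in[OF X fg])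
qed

text \<open>The group diagrams commute because they do in each fibre. What remains is that the
  structure maps preserve composition: \<open>interchange\<close> for the multiplication,
  \<open>m_e\<close> for the unit, \<open>m_inv\<close> for the inverse.\<close>

lemma internal_group_total_cat:
  assumes X: "dispace X"
  shows "internal_group (trace_category X) (total_cat X) fst (total_mult X) (\<lambda>f. (f, \<one>\<^bsub>G X f\<^esub>)) (total_inv X)"
proof -
  interpret X: dispace X by fact
  let ?C = "total_cat X" and ?B = "trace_category X"
  let ?P = "fibre_product ?C fst ?C fst"
  interpret C: category ?C by (rule category_total_cat[OF X])
  interpret p: is_functor ?C ?B "\<lambda>x. x" fst
    using over_object_total_cat[OF X] by (simp add: over_object_def)
  have grp: "Group.group (G X f)" if "f \<in> traces X" for f by (rule group[OF X that])
  have closed: "c \<otimes>\<^bsub>G X f\<^esub> d \<in> carrier (G X f)" "inv\<^bsub>G X f\<^esub> c \<in> carrier (G X f)"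
    if "f \<in> traces X" "c \<in> carrier (G X f)" "d \<in> carrier (G X f)" for f c d
  proof -
    interpret group "G X f" by (rule grp[OF that(1)])
    show "c \<otimes>\<^bsub>G X f\<^esub> d \<in> carrier (G X f)" "inv\<^bsub>G X f\<^esub> c \<in> carrier (G X f)" using that by simp_all
  qed
  have P: "category ?P"
    by (rule category_fibre_product[OF over_object_total_cat[OF X] over_object_total_cat[OF X]])
  \<comment> \<open>As the projection is \<open>fst\<close>, an arrow of the fibre product is a pair
    of elements of one fibre, with the trace repeated.\<close>
  have P_simps: "Ob ?P = topspace (spc X)"
    "p \<in> Ar ?P \<longleftrightarrow> (\<exists>f c d. p = ((f, c), (f, d)) \<and> f \<in> traces X \<and> c \<in> carrier (G X f) \<and> d \<in> carrier (G X f))"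
    "\<lbrakk>f \<in> traces X; c \<in> carrier (G X f); d \<in> carrier (G X f)\<rbrakk> \<Longrightarrow> src ?P ((f, c), (f, d)) = trace_src f"
    "\<lbrakk>f \<in> traces X; c \<in> carrier (G X f); d \<in> carrier (G X f)\<rbrakk> \<Longrightarrow> tgt ?P ((f, c), (f, d)) = trace_tgt f"
    "x \<in> topspace (spc X) \<Longrightarrow> idt ?P x = (idt ?C x, idt ?C x)"
    "\<lbrakk>f \<in> traces X; c \<in> carrier (G X f); d \<in> carrier (G X f);
      g \<in> traces X; c' \<in> carrier (G X g); d' \<in> carrier (G X g); trace_tgt f = trace_src g\<rbrakk>
    \<Longrightarrow> cmp ?P ((f, c), (f, d)) ((g, c'), (g, d'))
      = ((trace_concat X f g, m X f g c c'), (trace_concat X f g, m X f g d d'))"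
    for p f c d g c' d' x
    by (auto simp: fibre_product_def)
  have "over_morphism ?B ?P (\<lambda>(c, d). fst c) ?C fst (total_mult X)"
    unfolding over_morphism_def over_object_def
  proof (intro conjI)
    show "is_functor ?P ?B (\<lambda>x. x) (\<lambda>(c, d). fst c)"
    proof (intro is_functor.intro is_functor_axioms.intro P X.category_trace_category, goal_cases)
      case (5 x) then show ?case by (simp add: P_simps)
    next
      case (6 p q) then show ?case by (auto simp: P_simps)
    qed (auto simp: P_simps)
    show "is_functor ?P ?C (\<lambda>x. x) (total_mult X)"
    proof (intro is_functor.intro is_functor_axioms.intro P C.category_axioms, goal_cases)
      case (5 x)
      then have "x \<in> topspace (spc X)" by (simp add: P_simps)
      then interpret group "G X (trace_of X (const_path x))" by (intro grp X.const_trace)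
      show ?case using \<open>x \<in> topspace (spc X)\<close> by (simp add: P_simps total_mult_def)
    next
      case (6 p q)
      obtain f c d where p: "p = ((f, c), (f, d))" "f \<in> traces X" "c \<in> carrier (G X f)" "d \<in> carrier (G X f)"
        using 6(1) unfolding P_simps by blast
      obtain g c' d' where q: "q = ((g, c'), (g, d'))" "g \<in> traces X" "c' \<in> carrier (G X g)" "d' \<in> carrier (G X g)"
        using 6(2) unfolding P_simps by blast
      note pq = p(1) q(1) and * = p(2-4) q(2-4)
      have t: "trace_tgt f = trace_src g" using 6(3) * by (simp add: P_simps(3,4) pq)
      show ?case
        unfolding pq
        using * t by (simp add: P_simps(6) total_mult_def closed interchange[OF X])
    qed (auto simp: P_simps total_mult_def closed)
    show "\<forall>c\<in>Ar ?P. fst (total_mult X c) = (case c of (c, d) \<Rightarrow> fst c)"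
      by (auto simp: P_simps total_mult_def)
  qed (use over_object_total_cat[OF X] in \<open>auto simp: over_object_def P_simps\<close>)
  moreover have "over_morphism ?B ?B (\<lambda>f. f) ?C fst (\<lambda>f. (f, \<one>\<^bsub>G X f\<^esub>))"
    using over_object_total_cat[OF X] is_functor_section[OF X] is_functor_id[OF X.category_trace_category]
    by (simp add: over_morphism_def over_object_def)
  moreover have "over_morphism ?B ?C fst ?C fst (total_inv X)"
    unfolding over_morphism_def
  proof (intro conjI over_object_total_cat X)
    show "is_functor ?C ?C (\<lambda>x. x) (total_inv X)"
    proof (intro is_functor.intro is_functor_axioms.intro C.category_axioms, goal_cases)
      case (5 x)
      then have "x \<in> topspace (spc X)" by simp
      then interpret group "G X (trace_of X (const_path x))" by (intro grp X.const_trace)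
      show ?case using \<open>x \<in> topspace (spc X)\<close> by (simp add: total_inv_def)
    next
      case (6 p q)
      obtain f c g d where pq: "p = (f, c)" "q = (g, d)" by fastforce
      with 6 have *: "f \<in> traces X" "c \<in> carrier (G X f)" "g \<in> traces X" "d \<in> carrier (G X g)"
        "trace_tgt f = trace_src g" by auto
      show ?case
        unfolding pq using * by (simp add: total_inv_def closed m_inv[OF X])
    qed (auto simp: total_inv_def closed)
    show "\<forall>c\<in>Ar ?C. fst (total_inv X c) = fst c" by (auto simp: total_inv_def)
  qed
  ultimately show ?thesis
    using over_object_total_cat[OF X] grp
    by (auto simp: internal_group_def total_mult_def total_inv_def group.is_monoid monoid.m_assoc group.l_inv group.r_inv)
qed

lemma Pair_iso_fibre_group:
  assumes X: "dispace X" and f: "f \<in> traces X"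
  shows "Pair f \<in> iso (G X f) (fibre_group (total_cat X) fst (total_mult X) (\<lambda>f. (f, \<one>\<^bsub>G X f\<^esub>)) f)"
  unfolding iso_def hom_def fibre_group_def
  by (auto simp: fibre_total_cat[OF f] total_mult_def bij_betw_def inj_on_def)

lemma group_realization:
  "\<exists>C p \<mu> \<eta> \<iota> F.
      (\<forall>X. dispace X \<longrightarrow>
         internal_group (trace_category X) (C X) (p X) (\<mu> X) (\<eta> X) (\<iota> X) \<and>
         (\<forall>f \<in> Ar (trace_category X).
            group (G X f) \<and> Pair f \<in> iso (G X f) (fibre_group (C X) (p X) (\<mu> X) (\<eta> X) f))) \<and>
      is_functor dTop Cat C F \<and>
      (\<forall>X h Y. (X, h, Y) \<in> Ar dTop \<longrightarrow>
         F (X, h, Y) = (C X, (h, restrict (induced_action N X h Y) (Ar (C X))), C Y))"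
proof (intro exI conjI allI impI ballI)
  fix X :: "'a dispace" assume X: "dispace X"
  show "internal_group (trace_category X) (total_cat X) fst (total_mult X) (\<lambda>f. (f, \<one>\<^bsub>G X f\<^esub>)) (total_inv X)"
    by (rule internal_group_total_cat[OF X])
  fix f assume "f \<in> Ar (trace_category X)"
  then have f: "f \<in> traces X" by simp
  show "Group.group (G X f)" by (rule group[OF X f])
  show "Pair f \<in> iso (G X f) (fibre_group (total_cat X) fst (total_mult X) (\<lambda>f. (f, \<one>\<^bsub>G X f\<^esub>)) f)"
    by (rule Pair_iso_fibre_group[OF X f])
qed (use is_functor_total_functor in \<open>auto simp: total_functor_def\<close>)

end

section \<open>Natural homotopy\<close>

abbreviation parallel_space :: "'a dispace \<Rightarrow> 'a trace \<Rightarrow> 'a trace topology" where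
  "parallel_space X f \<equiv> trace_space X (trace_src f) (trace_tgt f)"

lemma (in dispace) trace_in_parallel_space: "f \<in> traces X \<Longrightarrow> f \<in> topspace (parallel_space X f)"
  by (simp add: in_trace_space_iff)

lemma (in dispace) trace_concat_in_parallel_space:
  assumes "f \<in> traces X" "g \<in> traces X" "trace_tgt f = trace_src g"
    and "a \<in> topspace (parallel_space X f)" "b \<in> topspace (parallel_space X g)"
  shows "trace_concat X a b \<in> topspace (parallel_space X (trace_concat X f g))"
  using assms trace_concat_in[of a b] trace_concat_in[of f g] by (auto simp only: in_trace_space_iff)

lemma trace_map_in_parallel_space:
  assumes "dispace X" "dispace Y" "dimap X Y h" "f \<in> traces X" "a \<in> topspace (parallel_space X f)"
  shows "trace_map Y h a \<in> topspace (parallel_space Y (trace_map Y h f))"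
  using assms trace_map_in[OF assms(1-4)] trace_map_in[OF assms(1-3), of a]
  by (auto simp only: dispace.in_trace_space_iff)

lemma (in dispace) continuous_map_parallel_concat:
  assumes "f \<in> traces X" "g \<in> traces X" "trace_tgt f = trace_src g"
  shows "continuous_map (prod_topology (parallel_space X f) (parallel_space X g)) (parallel_space X (trace_concat X f g))
    (\<lambda>(a, b). trace_concat X a b)"
  using continuous_map_trace_concat[of "trace_src f" "trace_src g" "trace_tgt g"]
  by (simp add: trace_concat_in[OF assms] assms(3))

lemma continuous_map_parallel_map:
  assumes "dispace X" "dispace Y" "dimap X Y h" "f \<in> traces X"
  shows "continuous_map (parallel_space X f) (parallel_space Y (trace_map Y h f)) (trace_map Y h)"
  using continuous_map_trace_map[OF assms(1-3)] by (simp add: trace_map_in[OF assms])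

text \<open>The only element over \<open>f\<close> is \<open>f\<close>, so every required law is a
  law of traces or of the maps induced on them.\<close>

lemma trace_system_nat_htpy0: "trace_system (\<lambda>X f. {f}) (\<lambda>X f. f) (\<lambda>X f g. trace_concat X) nat_htpy0_map"
  by unfold_locales
    (simp_all add: nat_htpy0_map_def dispace.trace_concat_id dispace.trace_concat_assoc trace_map_concat
      trace_map_id trace_map_comp)

subsection \<open>Path components\<close>

abbreviation trace_component :: "'a dispace \<Rightarrow> 'a trace \<Rightarrow> 'a trace \<Rightarrow> 'a trace set" where
  "trace_component X f \<equiv> path_component_of_set (parallel_space X f)"

lemma UN_path_component:
  assumes "a \<in> topspace T" "\<And>a'. path_component_of T a a' \<Longrightarrow> H a' = H a"
  shows "(\<Union>a\<in>path_component_of_set T a. H a) = H a"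
proof -
  have "(\<Union>a'\<in>path_component_of_set T a. H a') = (\<Union>a'\<in>path_component_of_set T a. H a)"
    by (rule SUP_cong[OF refl], rule assms(2)) simp
  moreover have "a \<in> path_component_of_set T a" using assms(1) by (simp add: path_component_of_refl)
  ultimately show ?thesis by blast
qed

lemma path_component_of_compose:
  assumes "continuous_map T S g" "path_component_of T a b"
  shows "path_component_of S (g a) (g b)"
proof -
  obtain p where "pathin T p" "p 0 = a" "p 1 = b" using assms(2) by (auto simp: path_component_of_def)
  then show ?thesis
    using pathin_compose[OF _ assms(1), of p] unfolding path_component_of_def by (intro exI[of _ "g \<circ> p"]) simp
qed

lemma path_component_of_pair:
  assumes "path_component_of S a a'" "path_component_of T b b'"
  shows "path_component_of (prod_topology S T) (a, b) (a', b')"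
proof -
  obtain p q where "pathin S p" "p 0 = a" "p 1 = a'" "pathin T q" "q 0 = b" "q 1 = b'"
    using assms by (auto simp: path_component_of_def)
  then show ?thesis
    unfolding path_component_of_def by (intro exI[of _ "\<lambda>t. (p t, q t)"]) (simp add: pathin_def continuous_map_pairedI)
qed

lemma path_component_of_set_eq: "path_component_of T a b \<Longrightarrow> path_component_of_set T a = path_component_of_set T b"
  by (metis path_component_of_equiv)

definition component_concat ::
  "'a dispace \<Rightarrow> 'a trace \<Rightarrow> 'a trace \<Rightarrow> 'a trace set \<Rightarrow> 'a trace set \<Rightarrow> 'a trace set" where
  "component_concat X f g c d = (\<Union>a\<in>c. \<Union>b\<in>d. trace_component X (trace_concat X f g) (trace_concat X a b))"

text \<open>Paths in the two factors pair to a path in the product, and joint continuity of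
  concatenation carries it to a path of concatenated traces.\<close>

lemma component_concat_eq:
  assumes X: "dispace X" and fg: "f \<in> traces X" "g \<in> traces X" "trace_tgt f = trace_src g"
    and a: "a \<in> topspace (parallel_space X f)" and b: "b \<in> topspace (parallel_space X g)"
  shows "component_concat X f g (trace_component X f a) (trace_component X g b)
    = trace_component X (trace_concat X f g) (trace_concat X a b)"
proof -
  let ?pc = "trace_component X (trace_concat X f g)"
  have eq: "?pc (trace_concat X a' b') = ?pc (trace_concat X a b)"
    if "path_component_of (parallel_space X f) a a'" "path_component_of (parallel_space X g) b b'" for a' b'
    using path_component_of_compose[OF dispace.continuous_map_parallel_concat[OF X fg] path_component_of_pair[OF that]]
    by (intro path_component_of_set_eq[symmetric]) simp
  have rb: "path_component_of (parallel_space X g) b b" using b by (simp add: path_component_of_refl)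
  have inner: "(\<Union>b'\<in>trace_component X g b. ?pc (trace_concat X a' b')) = ?pc (trace_concat X a b)"
    if a': "path_component_of (parallel_space X f) a a'" for a'
    using UN_path_component[OF b, of "\<lambda>b'. ?pc (trace_concat X a' b')"] eq[OF a'] eq[OF a' rb] by simp
  have ra: "path_component_of (parallel_space X f) a a" using a by (simp add: path_component_of_refl)
  show ?thesis
    unfolding component_concat_def
    using UN_path_component[OF a, of "\<lambda>a'. \<Union>b'\<in>trace_component X g b. ?pc (trace_concat X a' b')"]
      inner inner[OF ra] by simp
qed

lemma nat_htpy1_map_eq:
  assumes XYh: "dispace X" "dispace Y" "dimap X Y h" "f \<in> traces X" and a: "a \<in> topspace (parallel_space X f)"
  shows "nat_htpy1_map X h Y f (trace_component X f a) = trace_component Y (trace_map Y h f) (trace_map Y h a)"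
  unfolding nat_htpy1_map_def
  using UN_path_component[OF a, of "\<lambda>a. trace_component Y (trace_map Y h f) (trace_map Y h a)"]
    path_component_of_set_eq[OF path_component_of_compose[OF continuous_map_parallel_map[OF XYh]], symmetric]
  by (simp add: trace_map_in[OF XYh])

text \<open>Each law is evaluated on representatives, where it is a strict equation between traces.
  A representative may be any trace parallel to \<open>f\<close>, so its endpoints have to be
  recovered from membership in \<open>parallel_space X f\<close>.\<close>

lemma trace_system_nat_htpy1:
  "trace_system (\<lambda>X f. path_components_of (parallel_space X f)) (\<lambda>X f. trace_component X f f)
    component_concat nat_htpy1_map"
proof (unfold_locales, goal_cases)
  case (1 X f)
  then show ?case unfolding path_components_of_def by (intro imageI dispace.trace_in_parallel_space)
next
  case (2 X f g c d)
  then obtain a b where *: "c = trace_component X f a" "a \<in> topspace (parallel_space X f)"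
    "d = trace_component X g b" "b \<in> topspace (parallel_space X g)"
    unfolding path_components_of_def by blast
  show ?case
    unfolding *(1,3) component_concat_eq[OF 2(1-4) *(2,4)] path_components_of_def
    by (intro imageI dispace.trace_concat_in_parallel_space[OF 2(1-4) *(2,4)])
next
  case (3 X f g)
  then show ?case by (intro component_concat_eq dispace.trace_in_parallel_space)
next
  case (4 X f c)
  then obtain a where a: "c = trace_component X f a" "a \<in> topspace (parallel_space X f)"
    unfolding path_components_of_def by blast
  interpret dispace X by (rule 4)
  let ?i = "trace_of X (const_path (trace_src f))"
  have i: "?i \<in> traces X" "trace_src ?i = trace_src f" "trace_tgt ?i = trace_src f"
    using const_trace[OF trace_ends_in_topspace(1)] 4 by auto
  have "trace_concat X ?i a = a" "trace_concat X ?i f = f"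
    using a(2) trace_concat_id(1)[of a] trace_concat_id(1)[of f] 4 by (auto simp only: in_trace_space_iff)
  then show ?case
    using component_concat_eq[OF 4(1) i(1) 4(2) i(3) trace_in_parallel_space[OF i(1)] a(2)] by (simp only: a(1))
next
  case (5 X f c)
  then obtain a where a: "c = trace_component X f a" "a \<in> topspace (parallel_space X f)"
    unfolding path_components_of_def by blast
  interpret dispace X by (rule 5)
  let ?i = "trace_of X (const_path (trace_tgt f))"
  have i: "?i \<in> traces X" "trace_src ?i = trace_tgt f" "trace_tgt ?i = trace_tgt f"
    using const_trace[OF trace_ends_in_topspace(2)] 5 by auto
  have "trace_concat X a ?i = a" "trace_concat X f ?i = f"
    using a(2) trace_concat_id(2)[of a] trace_concat_id(2)[of f] 5 by (auto simp only: in_trace_space_iff)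
  then show ?case
    using component_concat_eq[OF 5(1,2) i(1) i(2)[symmetric] a(2) trace_in_parallel_space[OF i(1)]] by (simp only: a(1))
next
  case (6 X f g j c d e)
  then obtain a1 a2 a3 where *: "c = trace_component X f a1" "a1 \<in> topspace (parallel_space X f)"
    "d = trace_component X g a2" "a2 \<in> topspace (parallel_space X g)"
    "e = trace_component X j a3" "a3 \<in> topspace (parallel_space X j)"
    unfolding path_components_of_def by blast
  interpret dispace X by (rule 6)
  have fg: "trace_concat X f g \<in> traces X" "trace_tgt (trace_concat X f g) = trace_src j"
    and gj: "trace_concat X g j \<in> traces X" "trace_tgt f = trace_src (trace_concat X g j)"
    using trace_concat_in 6 by simp_all
  have "trace_concat X (trace_concat X a1 a2) a3 = trace_concat X a1 (trace_concat X a2 a3)"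
    by (rule trace_concat_assoc) (use *(2,4,6) 6(5,6) in \<open>auto simp only: in_trace_space_iff\<close>)
  then show ?case
    unfolding *(1,3,5) component_concat_eq[OF 6(1,2,3,5) *(2,4)] component_concat_eq[OF 6(1,3,4,6) *(4,6)]
      component_concat_eq[OF 6(1) fg(1) 6(4) fg(2) trace_concat_in_parallel_space[OF 6(2,3,5) *(2,4)] *(6)]
      component_concat_eq[OF 6(1,2) gj *(2) trace_concat_in_parallel_space[OF 6(3,4,6) *(4,6)]]
      trace_concat_assoc[OF 6(2-6)] by (rule arg_cong)
next
  case (7 X Y h f c)
  then obtain a where *: "c = trace_component X f a" "a \<in> topspace (parallel_space X f)"
    unfolding path_components_of_def by blast
  show ?case
    unfolding *(1) nat_htpy1_map_eq[OF 7(1-4) *(2)] path_components_of_def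
    by (intro imageI trace_map_in_parallel_space[OF 7(1-4) *(2)])
next
  case (8 X Y h f)
  then show ?case by (intro nat_htpy1_map_eq dispace.trace_in_parallel_space)
next
  case (9 X Y h f g c d)
  then obtain a b where *: "c = trace_component X f a" "a \<in> topspace (parallel_space X f)"
    "d = trace_component X g b" "b \<in> topspace (parallel_space X g)"
    unfolding path_components_of_def by blast
  note d = 9(1-3)
  have fg: "trace_map Y h f \<in> traces Y" "trace_map Y h g \<in> traces Y" "trace_tgt (trace_map Y h f) = trace_src (trace_map Y h g)"
    using trace_map_in[OF d] 9(4-6) by simp_all
  have "trace_map Y h (trace_concat X a b) = trace_concat Y (trace_map Y h a) (trace_map Y h b)"
    by (rule trace_map_concat[OF d]) (use *(2,4) 9(1,6) in \<open>auto simp only: dispace.in_trace_space_iff\<close>)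
  then show ?case
    unfolding *(1,3) component_concat_eq[OF 9(1,4-6) *(2,4)] nat_htpy1_map_eq[OF d 9(4) *(2)] nat_htpy1_map_eq[OF d 9(5) *(4)]
      nat_htpy1_map_eq[OF d dispace.trace_concat_in(1)[OF 9(1,4-6)] dispace.trace_concat_in_parallel_space[OF 9(1,4-6) *(2,4)]]
      component_concat_eq[OF 9(2) fg trace_map_in_parallel_space[OF d 9(4) *(2)] trace_map_in_parallel_space[OF d 9(5) *(4)]]
      trace_map_concat[OF d 9(4-6)] by (rule arg_cong)
next
  case (10 X f c)
  then obtain a where a: "c = trace_component X f a" "a \<in> topspace (parallel_space X f)"
    unfolding path_components_of_def by blast
  interpret dispace X by (rule 10)
  have "dimap X X (\<lambda>x\<in>topspace (spc X). x)" by (rule dimap_cong[OF 10(1) _ dimap_id]) auto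
  from nat_htpy1_map_eq[OF 10(1,1) this 10(2) a(2)] show ?case
    using trace_map_id[OF 10(1)] 10(2) a by (simp only: in_trace_space_iff)
next
  case (11 X Y Z h k f c)
  then obtain a where a: "c = trace_component X f a" "a \<in> topspace (parallel_space X f)"
    unfolding path_components_of_def by blast
  have d: "dimap X Z (restrict (k \<circ> h) (topspace (spc X)))"
    by (rule dimap_cong[OF 11(1) _ dimap_comp[OF 11(1,4,5)]]) auto
  have "a \<in> traces X" using a(2) 11(1) by (simp only: dispace.in_trace_space_iff)
  then show ?case
    using nat_htpy1_map_eq[OF 11(1,3) d 11(6) a(2)] nat_htpy1_map_eq[OF 11(1,2,4,6) a(2)]
      nat_htpy1_map_eq[OF 11(2,3,5) trace_map_in(1)[OF 11(1,2,4,6)] trace_map_in_parallel_space[OF 11(1,2,4,6) a(2)]]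
      trace_map_comp[OF 11(1-6)] trace_map_comp[OF 11(1-5) \<open>a \<in> traces X\<close>] by (simp only: a(1))
qed

subsection \<open>Higher homotopy groups\<close>

abbreviation trace_loops :: "nat \<Rightarrow> 'a dispace \<Rightarrow> 'a trace \<Rightarrow> ((nat \<Rightarrow> real) \<Rightarrow> 'a trace) set" where
  "trace_loops k X f \<equiv> cube_loops k (parallel_space X f) f"

abbreviation trace_loop_class ::
  "nat \<Rightarrow> 'a dispace \<Rightarrow> 'a trace \<Rightarrow> ((nat \<Rightarrow> real) \<Rightarrow> 'a trace) \<Rightarrow> ((nat \<Rightarrow> real) \<Rightarrow> 'a trace) set" where
  "trace_loop_class k X f \<equiv> loop_class k (parallel_space X f) f"

lemma (in dispace) trace_loops_in:
  assumes "\<gamma> \<in> trace_loops k X f" "t \<in> topspace (cube k)"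
  shows "\<gamma> t \<in> traces X" "trace_src (\<gamma> t) = trace_src f" "trace_tgt (\<gamma> t) = trace_tgt f"
proof -
  have "\<gamma> t \<in> topspace (parallel_space X f)" using assms by (auto simp: cube_loops_def continuous_map_def)
  then show "\<gamma> t \<in> traces X" "trace_src (\<gamma> t) = trace_src f" "trace_tgt (\<gamma> t) = trace_tgt f"
    by (simp_all only: in_trace_space_iff)
qed

text \<open>The two homotopies pair to one in the product, based at \<open>(f, g)\<close>; composing
  with the jointly continuous concatenation moves the base point to the concatenated trace.\<close>

lemma (in dispace) loop_homotopic_trace_concat:
  assumes "f \<in> traces X" "g \<in> traces X" "trace_tgt f = trace_src g"
    and "loop_homotopic k (parallel_space X f) f \<gamma> \<gamma>'" "loop_homotopic k (parallel_space X g) g \<delta> \<delta>'"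
  shows "loop_homotopic k (parallel_space X (trace_concat X f g)) (trace_concat X f g)
    (\<lambda>t. trace_concat X (\<gamma> t) (\<delta> t)) (\<lambda>t. trace_concat X (\<gamma>' t) (\<delta>' t))"
  using loop_homotopic_compose[OF continuous_map_parallel_concat[OF assms(1-3)] loop_homotopic_pair[OF assms(4,5)]]
  by (simp add: o_def)

lemma (in dispace) trace_concat_loops:
  assumes "f \<in> traces X" "g \<in> traces X" "trace_tgt f = trace_src g" "\<gamma> \<in> trace_loops k X f" "\<delta> \<in> trace_loops k X g"
  shows "(\<lambda>t. trace_concat X (\<gamma> t) (\<delta> t)) \<in> trace_loops k X (trace_concat X f g)"
  using loop_homotopic_trace_concat[OF assms(1-3), of k \<gamma> \<gamma> \<delta> \<delta>] assms(4,5) by (simp only: loop_homotopic_refl)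

lemma trace_map_loops:
  assumes "dispace X" "dispace Y" "dimap X Y h" "f \<in> traces X" "\<gamma> \<in> trace_loops k X f"
  shows "trace_map Y h \<circ> \<gamma> \<in> trace_loops k Y (trace_map Y h f)"
  using loop_homotopic_compose[OF continuous_map_parallel_map[OF assms(1-4)], of k f \<gamma> \<gamma>] assms(5)
  by (simp only: loop_homotopic_refl)

text \<open>This concatenates the values of two loops, at traces \<open>f\<close> and
  \<open>g\<close>. It must be distinguished from \<open>loop_concat\<close>, which juxtaposes the
  domains of two loops at one base point.\<close>

definition loops_concat ::
  "nat \<Rightarrow> 'a dispace \<Rightarrow> 'a trace \<Rightarrow> 'a trace \<Rightarrow> ((nat \<Rightarrow> real) \<Rightarrow> 'a trace) set \<Rightarrow> ((nat \<Rightarrow> real) \<Rightarrow> 'a trace) set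
    \<Rightarrow> ((nat \<Rightarrow> real) \<Rightarrow> 'a trace) set" where
  "loops_concat k X f g c d =
    (\<Union>\<gamma>\<in>c. \<Union>\<delta>\<in>d. trace_loop_class k X (trace_concat X f g) (\<lambda>t. trace_concat X (\<gamma> t) (\<delta> t)))"

lemma loops_concat_eq:
  assumes X: "dispace X" and fg: "f \<in> traces X" "g \<in> traces X" "trace_tgt f = trace_src g"
    and "\<gamma> \<in> trace_loops k X f" "\<delta> \<in> trace_loops k X g"
  shows "loops_concat k X f g (trace_loop_class k X f \<gamma>) (trace_loop_class k X g \<delta>)
    = trace_loop_class k X (trace_concat X f g) (\<lambda>t. trace_concat X (\<gamma> t) (\<delta> t))"
  unfolding loops_concat_def
  by (rule UN_loop_class2[OF assms(5,6)], rule loop_class_eq[symmetric],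
      rule dispace.loop_homotopic_trace_concat[OF X fg])

lemma nat_htpy_map_eq:
  assumes XYh: "dispace X" "dispace Y" "dimap X Y h" "f \<in> traces X" and \<gamma>: "\<gamma> \<in> trace_loops (n - 1) X f"
  shows "nat_htpy_map n X h Y f (trace_loop_class (n - 1) X f \<gamma>)
    = trace_loop_class (n - 1) Y (trace_map Y h f) (trace_map Y h \<circ> \<gamma>)"
  unfolding nat_htpy_map_def trace_map_in(2,3)[OF XYh, symmetric]
  by (rule UN_loop_class[OF \<gamma>], rule loop_class_eq[symmetric],
      rule loop_homotopic_compose[OF continuous_map_parallel_map[OF XYh]])

text \<open>Strict laws of traces reach homotopy classes through this rule: on the cube a loop takes
  values in traces parallel to \<open>f\<close>, so the laws apply there.\<close>

lemma trace_loop_class_cong: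
  assumes "\<gamma> \<in> trace_loops k X f" "\<And>t. t \<in> topspace (cube k) \<Longrightarrow> \<delta> t = \<gamma> t"
  shows "trace_loop_class k X f \<delta> = trace_loop_class k X f \<gamma>"
  by (rule loop_class_eq[OF loop_homotopic_on_cube[OF assms]])

text \<open>Coordinate 0 selects the same branch for both factors, so this holds for arbitrary
  functions. On classes it becomes the interchange law.\<close>

lemma loop_concat_trace_concat:
  "loop_concat (\<lambda>t. trace_concat X (\<gamma> t) (\<delta> t)) (\<lambda>t. trace_concat X (\<gamma>' t) (\<delta>' t))
    = (\<lambda>t. trace_concat X (loop_concat \<gamma> \<gamma>' t) (loop_concat \<delta> \<delta>' t))"
  by (auto simp: loop_concat_def fun_eq_iff)

lemma nat_htpy_simps:
  "carrier (nat_htpy n X f) = trace_loop_class (n - 1) X f ` trace_loops (n - 1) X f"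
  "\<one>\<^bsub>nat_htpy n X f\<^esub> = trace_loop_class (n - 1) X f (\<lambda>_. f)"
  by (simp_all add: nat_htpy_def homotopy_group_def)

lemma nat_htpy_mult:
  assumes "n \<ge> 2" "\<gamma> \<in> trace_loops (n - 1) X f" "\<delta> \<in> trace_loops (n - 1) X f"
  shows "trace_loop_class (n - 1) X f \<gamma> \<otimes>\<^bsub>nat_htpy n X f\<^esub> trace_loop_class (n - 1) X f \<delta>
    = trace_loop_class (n - 1) X f (loop_concat \<gamma> \<delta>)"
  unfolding nat_htpy_def by (rule homotopy_group_mult) (use assms in auto)

lemma (in dispace) const_trace_loop: "f \<in> traces X \<Longrightarrow> (\<lambda>_. f) \<in> trace_loops k X f"
  by (intro const_cube_loops trace_in_parallel_space)

text \<open>The first eleven goals follow the same scheme as for path components, with loops for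
  representatives; the last two are the group axioms in each fibre and interchange.\<close>

lemma trace_group_system_nat_htpy:
  assumes n: "n \<ge> 2"
  shows "trace_group_system (nat_htpy n) (loops_concat (n - 1)) (nat_htpy_map n)"
proof (intro trace_group_system.intro trace_system.intro trace_group_system_axioms.intro, goal_cases)
  case (1 X f)
  then show ?case unfolding nat_htpy_simps by (intro imageI dispace.const_trace_loop)
next
  case (2 X f g c d)
  then obtain \<gamma> \<delta> where *: "c = trace_loop_class (n - 1) X f \<gamma>" "\<gamma> \<in> trace_loops (n - 1) X f"
    "d = trace_loop_class (n - 1) X g \<delta>" "\<delta> \<in> trace_loops (n - 1) X g"
    unfolding nat_htpy_simps by blast
  show ?case
    unfolding *(1,3) loops_concat_eq[OF 2(1-4) *(2,4)] nat_htpy_simps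
    by (intro imageI dispace.trace_concat_loops[OF 2(1-4) *(2,4)])
next
  case (3 X f g)
  then show ?case unfolding nat_htpy_simps by (intro loops_concat_eq dispace.const_trace_loop)
next
  case (4 X f c)
  then obtain \<gamma> where \<gamma>: "c = trace_loop_class (n - 1) X f \<gamma>" "\<gamma> \<in> trace_loops (n - 1) X f"
    unfolding nat_htpy_simps by blast
  interpret dispace X by (rule 4)
  let ?i = "trace_of X (const_path (trace_src f))"
  have i: "?i \<in> traces X" "trace_src ?i = trace_src f" "trace_tgt ?i = trace_src f"
    using const_trace[OF trace_ends_in_topspace(1)] 4 by auto
  have "trace_concat X ?i f = f" using trace_concat_id(1) 4 by simp
  moreover have "trace_loop_class (n - 1) X f (\<lambda>t. trace_concat X ?i (\<gamma> t)) = trace_loop_class (n - 1) X f \<gamma>"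
    using trace_concat_id(1)[OF trace_loops_in(1)[OF \<gamma>(2)]] trace_loops_in(2)[OF \<gamma>(2)]
    by (intro trace_loop_class_cong[OF \<gamma>(2)]) simp
  ultimately show ?case
    using loops_concat_eq[OF 4(1) i(1) 4(2) i(3) const_trace_loop[OF i(1)] \<gamma>(2)]
    by (simp only: \<gamma>(1) nat_htpy_simps)
next
  case (5 X f c)
  then obtain \<gamma> where \<gamma>: "c = trace_loop_class (n - 1) X f \<gamma>" "\<gamma> \<in> trace_loops (n - 1) X f"
    unfolding nat_htpy_simps by blast
  interpret dispace X by (rule 5)
  let ?i = "trace_of X (const_path (trace_tgt f))"
  have i: "?i \<in> traces X" "trace_src ?i = trace_tgt f" "trace_tgt ?i = trace_tgt f"
    using const_trace[OF trace_ends_in_topspace(2)] 5 by auto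
  have "trace_concat X f ?i = f" using trace_concat_id(2) 5 by simp
  moreover have "trace_loop_class (n - 1) X f (\<lambda>t. trace_concat X (\<gamma> t) ?i) = trace_loop_class (n - 1) X f \<gamma>"
    using trace_concat_id(2)[OF trace_loops_in(1)[OF \<gamma>(2)]] trace_loops_in(3)[OF \<gamma>(2)]
    by (intro trace_loop_class_cong[OF \<gamma>(2)]) simp
  ultimately show ?case
    using loops_concat_eq[OF 5(1,2) i(1) i(2)[symmetric] \<gamma>(2) const_trace_loop[OF i(1)]]
    by (simp only: \<gamma>(1) nat_htpy_simps)
next
  case (6 X f g j c d e)
  then obtain \<gamma> \<delta> \<epsilon> where *: "c = trace_loop_class (n - 1) X f \<gamma>" "\<gamma> \<in> trace_loops (n - 1) X f"
    "d = trace_loop_class (n - 1) X g \<delta>" "\<delta> \<in> trace_loops (n - 1) X g"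
    "e = trace_loop_class (n - 1) X j \<epsilon>" "\<epsilon> \<in> trace_loops (n - 1) X j"
    unfolding nat_htpy_simps by blast
  interpret dispace X by (rule 6)
  have fg: "trace_concat X f g \<in> traces X" "trace_tgt (trace_concat X f g) = trace_src j"
    and gj: "trace_concat X g j \<in> traces X" "trace_tgt f = trace_src (trace_concat X g j)"
    using trace_concat_in 6 by simp_all
  have l: "(\<lambda>t. trace_concat X (\<gamma> t) (\<delta> t)) \<in> trace_loops (n - 1) X (trace_concat X f g)"
    "(\<lambda>t. trace_concat X (\<delta> t) (\<epsilon> t)) \<in> trace_loops (n - 1) X (trace_concat X g j)"
    by (rule trace_concat_loops; use 6 * in simp)+
  have "trace_loop_class (n - 1) X (trace_concat X f (trace_concat X g j)) (\<lambda>t. trace_concat X (trace_concat X (\<gamma> t) (\<delta> t)) (\<epsilon> t))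
    = trace_loop_class (n - 1) X (trace_concat X f (trace_concat X g j)) (\<lambda>t. trace_concat X (\<gamma> t) (trace_concat X (\<delta> t) (\<epsilon> t)))"
    by (rule trace_loop_class_cong[OF trace_concat_loops[OF 6(2) gj *(2) l(2)]], rule trace_concat_assoc)
      (simp_all only: trace_loops_in[OF *(2)] trace_loops_in[OF *(4)] trace_loops_in[OF *(6)] 6)
  then show ?case
    unfolding *(1,3,5) loops_concat_eq[OF 6(1,2,3,5) *(2,4)] loops_concat_eq[OF 6(1,3,4,6) *(4,6)]
      loops_concat_eq[OF 6(1) fg(1) 6(4) fg(2) l(1) *(6)] loops_concat_eq[OF 6(1,2) gj *(2) l(2)]
      trace_concat_assoc[OF 6(2-6)] .
next
  case (7 X Y h f c)
  then obtain \<gamma> where *: "c = trace_loop_class (n - 1) X f \<gamma>" "\<gamma> \<in> trace_loops (n - 1) X f"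
    unfolding nat_htpy_simps by blast
  show ?case
    unfolding *(1) nat_htpy_map_eq[OF 7(1-4) *(2)] nat_htpy_simps
    by (intro imageI trace_map_loops[OF 7(1-4) *(2)])
next
  case (8 X Y h f)
  show ?case
    unfolding nat_htpy_simps nat_htpy_map_eq[OF 8 dispace.const_trace_loop[OF 8(1,4)]] by (simp only: o_def)
next
  case (9 X Y h f g c d)
  then obtain \<gamma> \<delta> where *: "c = trace_loop_class (n - 1) X f \<gamma>" "\<gamma> \<in> trace_loops (n - 1) X f"
    "d = trace_loop_class (n - 1) X g \<delta>" "\<delta> \<in> trace_loops (n - 1) X g"
    unfolding nat_htpy_simps by blast
  interpret X: dispace X by (rule 9)
  interpret Y: dispace Y by (rule 9)
  note d = 9(1-3)
  have fg: "trace_map Y h f \<in> traces Y" "trace_map Y h g \<in> traces Y" "trace_tgt (trace_map Y h f) = trace_src (trace_map Y h g)"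
    using trace_map_in[OF d] 9(4-6) by simp_all
  note l = trace_map_loops[OF d 9(4) *(2)] trace_map_loops[OF d 9(5) *(4)]
  have "trace_loop_class (n - 1) Y (trace_concat Y (trace_map Y h f) (trace_map Y h g)) (trace_map Y h \<circ> (\<lambda>t. trace_concat X (\<gamma> t) (\<delta> t)))
    = trace_loop_class (n - 1) Y (trace_concat Y (trace_map Y h f) (trace_map Y h g))
        (\<lambda>t. trace_concat Y ((trace_map Y h \<circ> \<gamma>) t) ((trace_map Y h \<circ> \<delta>) t))"
    unfolding o_apply o_def
    by (rule trace_loop_class_cong[OF Y.trace_concat_loops[OF fg l, unfolded o_def]], rule trace_map_concat[OF d])
      (simp_all only: X.trace_loops_in[OF *(2)] X.trace_loops_in[OF *(4)] 9(6))
  then show ?case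
    unfolding *(1,3) loops_concat_eq[OF 9(1,4-6) *(2,4)] nat_htpy_map_eq[OF d 9(4) *(2)] nat_htpy_map_eq[OF d 9(5) *(4)]
      nat_htpy_map_eq[OF d X.trace_concat_in(1)[OF 9(4-6)] X.trace_concat_loops[OF 9(4-6) *(2,4)]]
      loops_concat_eq[OF 9(2) fg l] trace_map_concat[OF d 9(4-6)] .
next
  case (10 X f c)
  then obtain \<gamma> where \<gamma>: "c = trace_loop_class (n - 1) X f \<gamma>" "\<gamma> \<in> trace_loops (n - 1) X f"
    unfolding nat_htpy_simps by blast
  interpret dispace X by (rule 10)
  let ?id = "\<lambda>x\<in>topspace (spc X). x"
  have d: "dimap X X ?id" by (rule dimap_cong[OF 10(1) _ dimap_id]) auto
  have "trace_loop_class (n - 1) X f (trace_map X ?id \<circ> \<gamma>) = trace_loop_class (n - 1) X f \<gamma>"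
    by (rule trace_loop_class_cong[OF \<gamma>(2)]) (simp only: o_apply trace_map_id[OF 10(1)] trace_loops_in[OF \<gamma>(2)])
  then show ?case
    unfolding \<gamma>(1) nat_htpy_map_eq[OF 10(1,1) d 10(2) \<gamma>(2)] trace_map_id[OF 10(1,2)] .
next
  case (11 X Y Z h k f c)
  then obtain \<gamma> where \<gamma>: "c = trace_loop_class (n - 1) X f \<gamma>" "\<gamma> \<in> trace_loops (n - 1) X f"
    unfolding nat_htpy_simps by blast
  interpret dispace X by (rule 11)
  let ?kh = "restrict (k \<circ> h) (topspace (spc X))"
  have d: "dimap X Z ?kh" by (rule dimap_cong[OF 11(1) _ dimap_comp[OF 11(1,4,5)]]) auto
  note hf = trace_map_in(1)[OF 11(1,2,4,6)] and h\<gamma> = trace_map_loops[OF 11(1,2,4,6) \<gamma>(2)]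
  have "trace_loop_class (n - 1) Z (trace_map Z k (trace_map Y h f)) (trace_map Z ?kh \<circ> \<gamma>)
    = trace_loop_class (n - 1) Z (trace_map Z k (trace_map Y h f)) (trace_map Z k \<circ> (trace_map Y h \<circ> \<gamma>))"
    by (rule trace_loop_class_cong[OF trace_map_loops[OF 11(2,3,5) hf h\<gamma>]])
      (simp only: o_apply trace_map_comp[OF 11(1-5)] trace_loops_in[OF \<gamma>(2)])
  then show ?case
    unfolding \<gamma>(1) nat_htpy_map_eq[OF 11(1,3) d 11(6) \<gamma>(2)] nat_htpy_map_eq[OF 11(1,2,4,6) \<gamma>(2)]
      nat_htpy_map_eq[OF 11(2,3,5) hf h\<gamma>] trace_map_comp[OF 11(1-6)] .
next
  case (12 X f)
  then show ?case
    unfolding nat_htpy_def by (intro group_homotopy_group dispace.trace_in_parallel_space) (use n in auto)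
next
  case (13 X f g c c' d d')
  then obtain \<gamma> \<gamma>' \<delta> \<delta>' where *: "c = trace_loop_class (n - 1) X f \<gamma>" "\<gamma> \<in> trace_loops (n - 1) X f"
    "c' = trace_loop_class (n - 1) X f \<gamma>'" "\<gamma>' \<in> trace_loops (n - 1) X f"
    "d = trace_loop_class (n - 1) X g \<delta>" "\<delta> \<in> trace_loops (n - 1) X g"
    "d' = trace_loop_class (n - 1) X g \<delta>'" "\<delta>' \<in> trace_loops (n - 1) X g"
    unfolding nat_htpy_simps by blast
  interpret dispace X by (rule 13)
  \<comment> \<open>Guarantees that the cube has a coordinate 0, along which loops are
    multiplied.\<close>
  have k: "0 < n - 1" using n by simp
  show ?case
    unfolding *(1,3,5,7) nat_htpy_mult[OF n *(2,4)] nat_htpy_mult[OF n *(6,8)]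
      loops_concat_eq[OF 13(1-4) *(2,6)] loops_concat_eq[OF 13(1-4) *(4,8)]
      nat_htpy_mult[OF n trace_concat_loops[OF 13(2-4) *(2,6)] trace_concat_loops[OF 13(2-4) *(4,8)]]
      loops_concat_eq[OF 13(1-4) loop_concat_cube_loops[OF *(2,4) k] loop_concat_cube_loops[OF *(6,8) k]]
      loop_concat_trace_concat ..
qed

theorem theorem3p2p3:
  shows
  "(\<exists>(C :: 'a dispace \<Rightarrow> ('a, 'a trace \<times> 'a trace) cat) p \<epsilon> F.
      (\<forall>X. dispace X \<longrightarrow>
         split_object (trace_category X) (C X) (p X) (\<epsilon> X) \<and>
         (\<forall>f \<in> Ar (trace_category X).
            pointed_iso (Pair f) (nat_htpy0 X f) (fibre (C X) (p X) f, \<epsilon> X f))) \<and>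
      is_functor dTop Cat C F \<and>
      (\<forall>X h Y. (X, h, Y) \<in> Ar dTop \<longrightarrow>
         F (X, h, Y) = (C X, (h, restrict (induced_action nat_htpy0_map X h Y) (Ar (C X))), C Y)))
   \<and>
   (\<exists>(C :: 'a dispace \<Rightarrow> ('a, 'a trace \<times> 'a trace set) cat) p \<epsilon> F.
      (\<forall>X. dispace X \<longrightarrow>
         split_object (trace_category X) (C X) (p X) (\<epsilon> X) \<and>
         (\<forall>f \<in> Ar (trace_category X).
            pointed_iso (Pair f) (nat_htpy1 X f) (fibre (C X) (p X) f, \<epsilon> X f))) \<and>
      is_functor dTop Cat C F \<and>
      (\<forall>X h Y. (X, h, Y) \<in> Ar dTop \<longrightarrow>
         F (X, h, Y) = (C X, (h, restrict (induced_action nat_htpy1_map X h Y) (Ar (C X))), C Y)))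
   \<and>
   (\<forall>n \<ge> 2. \<exists>(C :: 'a dispace \<Rightarrow> ('a, 'a trace \<times> ((nat \<Rightarrow> real) \<Rightarrow> 'a trace) set) cat) p \<mu> \<eta> \<iota> F.
      (\<forall>X. dispace X \<longrightarrow>
         internal_group (trace_category X) (C X) (p X) (\<mu> X) (\<eta> X) (\<iota> X) \<and>
         (\<forall>f \<in> Ar (trace_category X).
            group (nat_htpy n X f) \<and>
            Pair f \<in> iso (nat_htpy n X f) (fibre_group (C X) (p X) (\<mu> X) (\<eta> X) f))) \<and>
      is_functor dTop Cat C F \<and>
      (\<forall>X h Y. (X, h, Y) \<in> Ar dTop \<longrightarrow>
         F (X, h, Y) = (C X, (h, restrict (induced_action (nat_htpy_map n) X h Y) (Ar (C X))), C Y)))"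
proof (intro conjI allI impI)
  fix n :: nat assume "n \<ge> 2"
  then show "\<exists>(C :: 'a dispace \<Rightarrow> ('a, 'a trace \<times> ((nat \<Rightarrow> real) \<Rightarrow> 'a trace) set) cat) p \<mu> \<eta> \<iota> F.
      (\<forall>X. dispace X \<longrightarrow>
         internal_group (trace_category X) (C X) (p X) (\<mu> X) (\<eta> X) (\<iota> X) \<and>
         (\<forall>f \<in> Ar (trace_category X).
            group (nat_htpy n X f) \<and>
            Pair f \<in> iso (nat_htpy n X f) (fibre_group (C X) (p X) (\<mu> X) (\<eta> X) f))) \<and>
      is_functor dTop Cat C F \<and>
      (\<forall>X h Y. (X, h, Y) \<in> Ar dTop \<longrightarrow>
         F (X, h, Y) = (C X, (h, restrict (induced_action (nat_htpy_map n) X h Y) (Ar (C X))), C Y))"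
    by (rule trace_group_system.group_realization[OF trace_group_system_nat_htpy])
\<comment> \<open>Degrees 0 and 1 remain; \<open>rule\<close> selects whichever of the two
  realizations unifies with the goal.\<close>
qed (rule trace_system.split_realization[OF trace_system_nat_htpy0] trace_system.split_realization[OF trace_system_nat_htpy1],
    simp add: nat_htpy0_def nat_htpy1_def Let_def)+

end
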